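(* Let $p$ be a prime number such that $p=1+16a^2$ for some integer $a$. Then there exists a hemisystem of the Hermitian surface $\mathcal U_3$ of $\mathrm{PG}(3,p^2)$ which is left invariant by a subgroup of $\mathrm{PGU}(4,p)$ isomorphic to $\mathrm{PSL}(2,p)\times C_{(p+1)/2}$, where $C_{(p+1)/2}$ denotes the cyclic group of order $(p+1)/2$.
   Context: For a prime power $q$, the Hermitian surface $\mathcal U_3$ of $\mathrm{PG}(3,q^2)$ is the set of self-conjugate points of a non-degenerate unitary polarity; up to coordinates it is $X_0^{q+1}+X_1^{q+1}+X_2^{q+1}+X_3^{q+1}=0$, and $\mathrm{PGU}(4,q)$ is the group of linear collineations preserving it. A generator of $\mathcal U_3$ is a line of $\mathrm{PG}(3,q^2)$ contained in $\mathcal U_3$; there are $(q^3+1)(q+1)$ generators and $q+1$ of them pass through each point of $\mathcal U_3$. For $q$ odd, a hemisystem of $\mathcal U_3$ is a set of $\frac12(q^3+1)(q+1)$ generators such that exactly $\frac12(q+1)$ of them pass through each point of $\mathcal U_3$ (in $\mathrm{PG}(3,q^2)$). A group of collineations leaves a hemisystem invariant if it maps the set of generators onto itself. *)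

theory Defs
  imports "HOL-Analysis.Analysis" "HOL-Algebra.Elementary_Groups"
begin

definition GL :: "('a::field^'n^'n) monoid" where
  "GL = \<lparr>carrier = {A. invertible A}, monoid.mult = (**), one = mat 1\<rparr>"

definition SL :: "('a::field^'n^'n) monoid" where
  "SL = \<lparr>carrier = {A. det A = 1}, monoid.mult = (**), one = mat 1\<rparr>"

definition scalars :: "('a::field^'n^'n) set" where
  "scalars = {mat c | c. c \<noteq> 0}"

definition PGL :: "('a::field^'n^'n) set monoid" where
  "PGL = GL Mod scalars"

definition PSL :: "('a::field^'n^'n) set monoid" where
  "PSL = SL Mod (scalars \<inter> carrier SL)"

text \<open>Points and lines of the projective space are the subspaces of vector space dimension 1
  and 2 of the coordinate space; incidence is inclusion.\<close>

definition pg_points :: "('a::field^'n) set set" where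
  "pg_points = {P. vec.subspace P \<and> vec.dim P = 1}"

definition pg_lines :: "('a::field^'n) set set" where
  "pg_lines = {L. vec.subspace L \<and> vec.dim L = 2}"

definition collin :: "'a::field^'n^'n \<Rightarrow> ('a^'n) set \<Rightarrow> ('a^'n) set" where
  "collin g S = (\<lambda>x. g *v x) ` S"

text \<open>In the following the field is meant to have order \<open>q\<^sup>2\<close>, so that its involutory automorphism
  is \<open>x \<mapsto> x ^ q\<close>. A non-degenerate unitary polarity is given by the Gram matrix \<open>H\<close>
  of a non-degenerate Hermitian form.\<close>

definition nondeg_hermitian :: "nat \<Rightarrow> 'a::field^'n^'n \<Rightarrow> bool" where
  "nondeg_hermitian q H \<longleftrightarrow> (\<forall>i j. (H $ i $ j) ^ q = H $ j $ i) \<and> det H \<noteq> 0"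

definition hform :: "nat \<Rightarrow> 'a::field^'n^'n \<Rightarrow> 'a^'n \<Rightarrow> 'a^'n \<Rightarrow> 'a" where
  "hform q H x y = (\<Sum>i\<in>UNIV. \<Sum>j\<in>UNIV. x $ i * H $ i $ j * (y $ j) ^ q)"

definition polar :: "nat \<Rightarrow> 'a::field^'n^'n \<Rightarrow> ('a^'n) set \<Rightarrow> ('a^'n) set" where
  "polar q H S = {y. \<forall>x\<in>S. hform q H x y = 0}"

definition herm_points :: "nat \<Rightarrow> 'a::field^'n^'n \<Rightarrow> ('a^'n) set set" where
  "herm_points q H = {P \<in> pg_points. P \<subseteq> polar q H P}"

definition generators :: "nat \<Rightarrow> 'a::field^4^4 \<Rightarrow> ('a^4) set set" where
  "generators q H = {L \<in> pg_lines. \<forall>P\<in>pg_points. P \<subseteq> L \<longrightarrow> P \<in> herm_points q H}"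

definition hemisystem :: "nat \<Rightarrow> 'a::field^4^4 \<Rightarrow> ('a^4) set set \<Rightarrow> bool" where
  "hemisystem q H M \<longleftrightarrow>
     odd q \<and> M \<subseteq> generators q H \<and>
     card M = (q ^ 3 + 1) * (q + 1) div 2 \<and>
     (\<forall>P\<in>herm_points q H. card {L \<in> M. P \<subseteq> L} = (q + 1) div 2)"

text \<open>An element of PGL is a coset \<open>C\<close> of the scalar matrices, and all matrices in \<open>C\<close> induce the
  same map on subspaces; hence the quantifier over \<open>g \<in> C\<close> amounts to picking a representative.\<close>

definition preserves :: "('a::field^'n^'n) set \<Rightarrow> ('a^'n) set set \<Rightarrow> bool" where
  "preserves C M \<longleftrightarrow> (\<forall>g\<in>C. collin g ` M = M)"

definition PGU :: "nat \<Rightarrow> 'a::field^'n^'n \<Rightarrow> ('a^'n^'n) set monoid" where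
  "PGU q H = PGL\<lparr>carrier := {C \<in> carrier PGL. preserves C (herm_points q H)}\<rparr>"


lemma GL_simps [simp]:
  "carrier GL = {A. invertible A}" "monoid.mult GL = (**)" "one GL = mat 1"
  by (simp_all add: GL_def)

lemma SL_simps [simp]:
  "carrier SL = {A. det A = 1}" "monoid.mult SL = (**)" "one SL = mat 1"
  by (simp_all add: SL_def)

lemma group_GL: "group (GL :: ('a::field^'n^'n) monoid)"
proof (rule groupI)
  fix A :: "'a^'n^'n" assume "A \<in> carrier GL"
  then show "\<exists>B\<in>carrier GL. B \<otimes>\<^bsub>GL\<^esub> A = \<one>\<^bsub>GL\<^esub>"
    by (auto simp: invertible_def)
next
  show "\<one>\<^bsub>GL\<^esub> \<in> carrier (GL :: ('a^'n^'n) monoid)" by (simp add: invertible_det_nz)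
qed (auto simp: invertible_mult matrix_mul_assoc)

lemma SL_subgroup_GL: "subgroup {A. det A = 1} (GL :: ('a::field^'n^'n) monoid)"
proof (rule group.subgroupI[OF group_GL])
  fix A :: "'a^'n^'n" assume A: "A \<in> {A. det A = 1}"
  then have "A \<in> carrier GL" by (simp add: invertible_det_nz)
  then have "A ** inv\<^bsub>GL\<^esub> A = mat 1"
    using group.r_inv[OF group_GL] by fastforce
  then have "det A * det (inv\<^bsub>GL\<^esub> A) = 1" by (metis det_I det_mul)
  then show "inv\<^bsub>GL\<^esub> A \<in> {A. det A = 1}" using A by simp
next
  show "{A :: 'a^'n^'n. det A = 1} \<noteq> {}" using det_I by blast
qed (auto simp: invertible_det_nz det_mul)

lemma group_SL: "group (SL :: ('a::field^'n^'n) monoid)"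
proof -
  have "SL = (GL :: ('a^'n^'n) monoid)\<lparr>carrier := {A. det A = 1}\<rparr>"
    by (simp add: SL_def GL_def)
  then show ?thesis
    using group.subgroup_imp_group[OF group_GL SL_subgroup_GL] by metis
qed

lemma mat_mult_left: "mat c ** (A :: 'a::field^'n^'n) = (\<chi> i j. c * A $ i $ j)"
  by (simp add: matrix_matrix_mult_def mat_def vec_eq_iff if_distrib if_distribR cong: if_cong)

lemma mat_mult_right: "(A :: 'a::field^'n^'n) ** mat c = (\<chi> i j. c * A $ i $ j)"
  by (simp add: matrix_matrix_mult_def mat_def vec_eq_iff if_distrib if_distribR mult.commute cong: if_cong)

lemma mat_commute: "mat c ** (A :: 'a::field^'n^'n) = A ** mat c"
  by (simp add: mat_mult_left mat_mult_right)

lemma mat_mult_mat: "mat c ** (mat d :: 'a::field^'n^'n) = mat (c * d)"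
  by (simp add: mat_mult_left) (simp add: mat_def vec_eq_iff)

lemma scalars_subgroup_GL: "subgroup scalars (GL :: ('a::field^'n^'n) monoid)"
proof (rule group.subgroupI[OF group_GL])
  have inv: "mat c ** (mat (inverse c) :: 'a^'n^'n) = mat 1" "mat (inverse c) ** (mat c :: 'a^'n^'n) = mat 1"
    if "c \<noteq> 0" for c using that by (simp_all add: mat_mult_mat)
  show sub: "scalars \<subseteq> carrier (GL :: ('a^'n^'n) monoid)"
  proof
    fix A :: "'a^'n^'n" assume "A \<in> scalars"
    then obtain c where "c \<noteq> 0" "A = mat c" by (auto simp: scalars_def)
    then have "A ** mat (inverse c) = mat 1 \<and> mat (inverse c) ** A = mat 1" using inv by simp
    then show "A \<in> carrier GL" unfolding GL_simps mem_Collect_eq invertible_def by (rule exI)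
  qed
  fix A :: "'a^'n^'n" assume "A \<in> scalars"
  then obtain c where c: "c \<noteq> 0" "A = mat c" by (auto simp: scalars_def)
  have ic: "mat (inverse c) \<in> (scalars :: ('a^'n^'n) set)"
    unfolding scalars_def mem_Collect_eq by (rule exI[of _ "inverse c"]) (simp add: c)
  have "inv\<^bsub>GL\<^esub> A = mat (inverse c)"
  proof (rule group.inv_equality[OF group_GL])
    show "mat (inverse c) \<otimes>\<^bsub>GL\<^esub> A = \<one>\<^bsub>GL\<^esub>" using c inv(2)[of c] by simp
  qed (use sub ic \<open>A \<in> scalars\<close> in blast)+
  then show "inv\<^bsub>GL\<^esub> A \<in> scalars" using ic by simp
next
  have "mat 1 \<in> (scalars :: ('a^'n^'n) set)"
    unfolding scalars_def mem_Collect_eq by (rule exI[of _ 1]) simp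
  then show "(scalars :: ('a^'n^'n) set) \<noteq> {}" by (metis empty_iff)
next
  fix A B :: "'a^'n^'n" assume "A \<in> scalars" "B \<in> scalars"
  then obtain c d where "c \<noteq> 0" "d \<noteq> 0" "A = mat c" "B = mat d" by (auto simp: scalars_def)
  then have "A \<otimes>\<^bsub>GL\<^esub> B = mat (c * d) \<and> c * d \<noteq> 0" by (simp add: mat_mult_mat)
  then show "A \<otimes>\<^bsub>GL\<^esub> B \<in> scalars" unfolding scalars_def mem_Collect_eq by (rule exI)
qed

lemma scalars_normal_GL: "scalars \<lhd> (GL :: ('a::field^'n^'n) monoid)"
proof (rule group.normalI[OF group_GL scalars_subgroup_GL], rule ballI)
  fix A :: "'a^'n^'n"
  show "scalars #>\<^bsub>GL\<^esub> A = A <#\<^bsub>GL\<^esub> scalars"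
    unfolding r_coset_def l_coset_def GL_simps
    by (rule SUP_cong[OF refl]) (auto simp: scalars_def mat_commute)
qed

lemma group_PGL: "group (PGL :: ('a::field^'n^'n) set monoid)"
  unfolding PGL_def by (rule normal.factorgroup_is_group[OF scalars_normal_GL])

lemma PGU_subgroup_PGL: "subgroup (carrier (PGU q H)) (PGL :: ('a::field^'n^'n) set monoid)"
proof (rule group.subgroupI[OF group_PGL])
  let ?U = "herm_points q H"
  have one: "collin (mat 1) ` N = N" for N :: "('a^'n) set set"
    by (simp add: collin_def image_image)
  have mul: "collin (g ** h) ` N = collin g ` collin h ` N" for g h :: "'a^'n^'n" and N
    by (simp add: collin_def image_image matrix_vector_mul_assoc)
  have sc: "collin (mat c) S = S" if "c \<noteq> 0" "vec.subspace S" for c and S :: "('a^'n) set"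
  proof -
    have m: "mat c *v x = c *s x" for x :: "'a^'n"
      by (simp add: matrix_vector_mult_def mat_def vec_eq_iff if_distrib if_distribR cong: if_cong)
    have "x \<in> (*s) c ` S" if "x \<in> S" for x
      using that \<open>c \<noteq> 0\<close> vec.subspace_scale[OF \<open>vec.subspace S\<close>, of x "inverse c"]
      by (intro image_eqI[of _ _ "inverse c *s x"]) auto
    then show ?thesis
      using vec.subspace_scale[OF \<open>vec.subspace S\<close>] by (auto simp: collin_def m)
  qed
  have scU: "collin (mat c) ` ?U = ?U" if "c \<noteq> 0" for c
    using sc[OF that] by (force simp: herm_points_def pg_points_def)
  show "carrier (PGU q H) \<subseteq> carrier PGL" by (auto simp: PGU_def)
  have "preserves (\<one>\<^bsub>PGL\<^esub>) ?U"
    using scU by (auto simp: preserves_def PGL_def FactGroup_def scalars_def)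
  then have "\<one>\<^bsub>PGL\<^esub> \<in> carrier (PGU q H)"
    using monoid.one_closed[OF group.is_monoid[OF group_PGL]] by (simp add: PGU_def)
  then show "carrier (PGU q H) \<noteq> {}" by (metis empty_iff)
  fix C D assume C: "C \<in> carrier (PGU q H)"
  then have C': "C \<in> carrier PGL" "preserves C ?U" by (auto simp: PGU_def)
  show "inv\<^bsub>PGL\<^esub> C \<in> carrier (PGU q H)"
  proof -
    have "inv\<^bsub>PGL\<^esub> C = set_inv\<^bsub>GL\<^esub> C"
      using C'(1) normal.inv_FactGroup[OF scalars_normal_GL] unfolding PGL_def by blast
    moreover have "collin (inv\<^bsub>GL\<^esub> g) ` ?U = ?U" if "g \<in> C" for g
    proof -
      have "g \<in> carrier GL"
        using that C'(1) subgroup.rcosets_carrier[OF scalars_subgroup_GL group_GL, of C]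
        unfolding PGL_def FactGroup_def by auto
      then have "inv\<^bsub>GL\<^esub> g ** g = mat 1" using group.l_inv[OF group_GL] by fastforce
      then have "?U = collin (inv\<^bsub>GL\<^esub> g) ` collin g ` ?U" by (metis one mul)
      then show ?thesis using that C'(2) unfolding preserves_def by metis
    qed
    ultimately have "preserves (inv\<^bsub>PGL\<^esub> C) ?U"
      unfolding preserves_def SET_INV_def by auto
    then show ?thesis
      using group.inv_closed[OF group_PGL C'(1)] by (simp add: PGU_def)
  qed
  assume "D \<in> carrier (PGU q H)"
  then have D': "D \<in> carrier PGL" "preserves D ?U" by (auto simp: PGU_def)
  have "preserves (C \<otimes>\<^bsub>PGL\<^esub> D) ?U"
    unfolding preserves_def
  proof
    fix k assume "k \<in> C \<otimes>\<^bsub>PGL\<^esub> D"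
    then obtain g h where "g \<in> C" "h \<in> D" "k = g ** h"
      by (auto simp: PGL_def FactGroup_def set_mult_def)
    then show "collin k ` ?U = ?U" using C'(2) D'(2) by (simp add: mul preserves_def)
  qed
  then show "C \<otimes>\<^bsub>PGL\<^esub> D \<in> carrier (PGU q H)"
    using monoid.m_closed[OF group.is_monoid[OF group_PGL] C'(1) D'(1)] by (simp add: PGU_def)
qed

lemma group_PSL: "group (PSL :: ('a::field^'n^'n) set monoid)"
proof -
  have SL: "SL = (GL :: ('a^'n^'n) monoid)\<lparr>carrier := {A. det A = 1}\<rparr>"
    by (simp add: SL_def GL_def)
  have "scalars \<inter> {A. det A = 1} \<lhd> (SL :: ('a^'n^'n) monoid)" unfolding SL
    by (rule group.normal_Int_subgroup[OF group_GL SL_subgroup_GL scalars_normal_GL])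
  then show ?thesis unfolding PSL_def
    by (simp add: normal.factorgroup_is_group)
qed

text \<open>For the identity Gram matrix one obtains the familiar equation.\<close>

lemma herm_points_mat_1:
  fixes x :: "'a::field^'n"
  assumes "x \<noteq> 0"
  shows "vec.span {x} \<in> herm_points q (mat 1) \<longleftrightarrow> (\<Sum>i\<in>UNIV. (x $ i) ^ (q + 1)) = 0"
proof -
  have h: "hform q (mat 1) u v = (\<Sum>i\<in>UNIV. u $ i * (v $ i) ^ q)" for u v :: "'a^'n"
    by (simp add: hform_def mat_def if_distrib if_distribR cong: if_cong)
  let ?s = "\<Sum>i\<in>UNIV. (x $ i) ^ (q + 1)"
  have eq: "hform q (mat 1) (c *s x) (d *s x) = c * d ^ q * ?s" for c d
    by (simp add: h sum_distrib_left power_mult_distrib algebra_simps)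
  have dim: "vec.dim (vec.span {x}) = 1"
    using assms by (simp add: vec.dim_eq_card_independent)
  have "vec.span {x} \<in> herm_points q (mat 1) \<longleftrightarrow>
      (\<forall>u\<in>vec.span {x}. \<forall>v\<in>vec.span {x}. hform q (mat 1) u v = 0)"
    using dim by (auto simp: herm_points_def pg_points_def polar_def)
  also have "\<dots> \<longleftrightarrow> (\<forall>c d. c * d ^ q * ?s = 0)"
    unfolding vec.span_singleton ball_simps eq[symmetric] by simp
  also have "\<dots> \<longleftrightarrow> ?s = 0"
  proof
    assume "\<forall>c d. c * d ^ q * ?s = 0"
    then have "1 * 1 ^ q * ?s = 0" by blast
    then show "?s = 0" by simp
  qed simp
  finally show ?thesis .
qed

end

theory Submission
  imports "HOL-Algebra.Algebraic_Closure_Type" "HOL-Number_Theory.Residues" Defs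
begin

text \<open>Write the four-dimensional space as a line plus the space of binary quadratic forms \<open>w\<close> over
  the field of order \<open>p\<^sup>2\<close>, with the Hermitian form \<open>B(w, w') - x x'\<close> (second argument conjugated),
  where \<open>B\<close> is the discriminant form; it is invariant under \<open>SL(2,p)\<close>. A generator is spanned by
  \<open>(0, u)\<close> and \<open>(1, w)\<close>, where \<open>u\<close> is a point of the Hermitian curve and \<open>w\<close> is a unit vector
  orthogonal to \<open>u\<close>; given \<open>u\<close>, the vector \<open>w\<close> is unique modulo \<open>u\<close> up to factors of norm one.
  Put \<open>m = (p + 1)/2\<close>, which is odd. A system of generators that contains half of the generators on
  each \<open>u\<close> and is invariant under multiplication of \<open>w\<close> by \<open>m\<close>-th roots of unity is a choice of a
  sign for every flag \<open>(u, w)\<close> that changes under \<open>w \<mapsto> - w\<close>, and it is a hemisystem iff for each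
  unit vector \<open>w\<close> the signs of the \<open>p + 1\<close> flags \<open>(u, w)\<close> cancel.

  If the roots of \<open>u\<close> do not lie in the field, the sign tells on which of the two Fuhrmann-Torres
  curves \<open>x ^ m = \<plusminus>(t ^ p - t)\<close> the points \<open>(w(t), t)\<close> with \<open>u(t) = 0\<close> lie. The plane orthogonal to
  \<open>(1, w)\<close> meets both curves in \<open>p + 1\<close> points, and every other \<open>u\<close> contributes equally to both,
  so these signs cancel. The remaining signs are invariant under \<open>PGL(2,p)\<close>, and a half turn about a
  rational vector orthogonal to \<open>w\<close> maps \<open>w\<close> to \<open>- w\<close>, so they cancel too. The exception is when
  the only such vector is isotropic. Then one point \<open>u\<close> lies on the rational conic, and the others
  contribute half the Jacobsthal sum of \<open>x\<^sup>3 - x\<close>. This is the odd number \<open>A\<close> in \<open>p = A\<^sup>2 + B\<^sup>2\<close>, thus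
  \<open>\<plusminus>1\<close> if \<open>p = 1 + 16 a\<^sup>2\<close>, and it is cancelled by a suitable sign for the points of the conic.\<close>

no_notation fps_nth (infixl "$" 75)

section \<open>Finite fields\<close>

lemma
  fixes g :: "'a::idom poly"
  assumes "Polynomial.degree g < n"
  shows finite_power_eq_poly: "finite {x. x ^ n = poly g x}"
    and card_power_eq_poly_le: "card {x. x ^ n = poly g x} \<le> n"
proof -
  define f where "f = Polynomial.monom 1 n - g"
  have "Polynomial.coeff f n = 1" using assms by (simp add: f_def coeff_eq_0)
  then have nonzero: "f \<noteq> 0" by auto
  have degree: "Polynomial.degree f \<le> n"
    unfolding f_def using assms by (intro degree_diff_le) (simp_all add: degree_monom_le)
  have "{x. x ^ n = poly g x} = {x. poly f x = 0}" by (simp add: f_def poly_monom)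
  then show "finite {x. x ^ n = poly g x}" "card {x. x ^ n = poly g x} \<le> n"
    using poly_roots_finite[OF nonzero] card_poly_roots_bound[OF nonzero] degree by simp_all
qed

lemma card_nth_roots_le: "n > 0 \<Longrightarrow> card {x. x ^ n = c} \<le> n" for c :: "'a::idom"
  using card_power_eq_poly_le[of "[:c:]" n] by simp

lemma card_fiber_eq:
  assumes fin: "finite A" "finite C" and maps: "f ` A \<subseteq> C"
    and fiber_le: "\<And>c. c \<in> C \<Longrightarrow> card {x\<in>A. f x = c} \<le> n"
    and card: "card C \<le> k" "card A = n * k" and "c \<in> C"
  shows "card {x\<in>A. f x = c} = n"
proof (rule ccontr)
  assume "card {x\<in>A. f x = c} \<noteq> n"
  then have less: "card {x\<in>A. f x = c} < n" using fiber_le[OF \<open>c \<in> C\<close>] by simp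
  have "card A = (\<Sum>c\<in>C. card {x\<in>A. f x = c})"
    using sum.group[OF fin maps, of "\<lambda>_. 1::nat"] by simp
  also have "\<dots> < (\<Sum>c\<in>C. n)"
    by (rule sum_strict_mono_ex1) (use fin fiber_le \<open>c \<in> C\<close> less in auto)
  also have "\<dots> \<le> n * k" using card(1) by (simp add: mult.commute)
  finally show False using card(2) by simp
qed

lemma power_CARD_minus_1:
  fixes x :: "'a::{field,finite}"
  assumes "x \<noteq> 0"
  shows "x ^ (CARD('a) - 1) = 1"
proof -
  have "(\<Prod>y\<in>-{0}. x * y) = (\<Prod>y\<in>-{0::'a}. y)"
    by (rule prod.reindex_bij_witness[of _ "\<lambda>y. y / x" "\<lambda>y. x * y"]) (use assms in auto)
  moreover have "(\<Prod>y\<in>-{0}. x * y) = x ^ (CARD('a) - 1) * (\<Prod>y\<in>-{0::'a}. y)"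
    by (simp add: prod.distrib Compl_eq_Diff_UNIV card_Diff_singleton)
  moreover have "(\<Prod>y\<in>-{0::'a}. y) \<noteq> 0" by simp
  ultimately show ?thesis by simp
qed

lemma power_CARD_eq: "x ^ CARD('a) = x" for x :: "'a::{field,finite}"
proof (cases "x = 0")
  case False
  have "x ^ CARD('a) = x ^ (CARD('a) - 1) * x"
    using finite_UNIV_card_ge_0[where 'a='a] by (simp flip: power_Suc2)
  then show ?thesis using power_CARD_minus_1[OF False] by simp
qed (use finite_UNIV_card_ge_0[where 'a='a] in simp)

lemma card_nth_roots:
  fixes c :: "'a::{field,finite}"
  assumes order: "CARD('a) - 1 = n * k" and "n > 0" "k > 0" and "c ^ k = 1"
  shows "card {x. x ^ n = c} = n"
proof -
  have "c \<noteq> 0" using assms by (auto simp: power_0_left)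
  have "card {x\<in>-{0}. x ^ n = c} = n"
  proof (rule card_fiber_eq[where C = "{c. c ^ k = 1}" and k = k])
    show "(\<lambda>x. x ^ n) ` (-{0::'a}) \<subseteq> {c. c ^ k = 1}"
      using power_CARD_minus_1[where 'a='a] order by (auto simp flip: power_mult)
    show "card {x\<in>-{0}. x ^ n = c} \<le> n" for c :: 'a
      by (rule order_trans[OF card_mono card_nth_roots_le[OF \<open>n > 0\<close>, of c]]) auto
    show "card (-{0::'a}) = n * k"
      using order by (simp add: Compl_eq_Diff_UNIV card_Diff_singleton)
  qed (use assms card_nth_roots_le in auto)
  also have "{x\<in>-{0}. x ^ n = c} = {x. x ^ n = c}"
    using \<open>c \<noteq> 0\<close> \<open>n > 0\<close> by (auto simp: power_0_left)
  finally show ?thesis .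
qed

lemma finite_field_nth_root_exists:
  fixes c :: "'a::{field,finite}"
  assumes "CARD('a) - 1 = n * k" "n > 0" "k > 0" "c ^ k = 1"
  obtains x where "x ^ n = c"
proof -
  have "card {x. x ^ n = c} \<noteq> 0" using card_nth_roots[OF assms] assms(2) by simp
  then have "{x. x ^ n = c} \<noteq> {}" by (metis card.empty)
  then show thesis using that by blast
qed

lemma CHAR_of_CARD_prime_power:
  assumes "prime p" "CARD('a::{field,finite}) = p ^ n"
  shows "CHAR('a) = p"
proof -
  have prime: "prime CHAR('a)" by (rule prime_CHAR_semidom[OF finite_imp_CHAR_pos]) simp
  have "CHAR('a) dvd p ^ n" using CHAR_dvd_CARD[where 'a='a] assms(2) by simp
  then have "CHAR('a) dvd p" by (rule prime_dvd_power_nat[OF prime])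
  then show ?thesis using prime assms(1) by (simp add: primes_dvd_imp_eq)
qed

lemma two_neq_zero_of_odd_CARD:
  assumes "odd CARD('a::{field,finite})"
  shows "(2::'a) \<noteq> 0"
proof
  assume "(2::'a) = 0"
  then have "CHAR('a) dvd 2" using of_nat_eq_0_iff_char_dvd[of 2, where 'a='a] by simp
  moreover have "prime CHAR('a)" by (rule prime_CHAR_semidom[OF finite_imp_CHAR_pos]) simp
  ultimately have "CHAR('a) = 2" by (simp add: primes_dvd_imp_eq)
  then show False using CHAR_dvd_CARD[where 'a='a] assms by simp
qed

definition power_sign :: "nat \<Rightarrow> 'a::comm_ring_1 \<Rightarrow> int" where
  "power_sign n x = (if x ^ n = 1 then 1 else if x ^ n = - 1 then - 1 else 0)"

lemma power_sign_mult: "power_sign (k * n) x = power_sign n (x ^ k)"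
  by (simp add: power_sign_def power_mult)

locale field_embedding =
  fixes \<iota> :: "'k::field \<Rightarrow> 'f::field"
  assumes \<iota>_add: "\<iota> (x + y) = \<iota> x + \<iota> y" and \<iota>_mult: "\<iota> (x * y) = \<iota> x * \<iota> y" and \<iota>_1: "\<iota> 1 = 1"
    and \<iota>_inj: "inj \<iota>"
begin

lemma \<iota>_0: "\<iota> 0 = 0" using \<iota>_add[of 0 0] by (metis add_cancel_right_right)

lemma \<iota>_eq_iff [simp]: "\<iota> x = \<iota> y \<longleftrightarrow> x = y" using \<iota>_inj by (auto simp: inj_def)

lemma \<iota>_eq_0_iff [simp]: "\<iota> x = 0 \<longleftrightarrow> x = 0"
  using \<iota>_eq_iff[of x 0] by (simp add: \<iota>_0)

lemma \<iota>_minus: "\<iota> (- x) = - \<iota> x"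
  using \<iota>_add[of x "- x"] by (simp add: \<iota>_0 eq_neg_iff_add_eq_0 add.commute)

lemma \<iota>_diff: "\<iota> (x - y) = \<iota> x - \<iota> y"
  using \<iota>_add[of x "- y"] by (simp add: \<iota>_minus)

lemma \<iota>_power: "\<iota> (x ^ n) = \<iota> x ^ n"
  by (induction n) (simp_all add: \<iota>_1 \<iota>_mult)

lemma power_sign_\<iota>: "power_sign n (\<iota> x) = power_sign n x"
proof -
  have "\<iota> x ^ n = 1 \<longleftrightarrow> x ^ n = 1" "\<iota> x ^ n = - 1 \<longleftrightarrow> x ^ n = - 1"
    using \<iota>_eq_iff[of "x ^ n" 1] \<iota>_eq_iff[of "x ^ n" "- 1"] by (simp_all add: \<iota>_power \<iota>_minus \<iota>_1)
  then show ?thesis by (simp add: power_sign_def)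
qed

end

lemma surj_of_nat_of_CARD_prime:
  assumes "prime p" "CARD('k::{field,finite}) = p"
  shows "surj (of_nat :: nat \<Rightarrow> 'k::{field,finite})"
proof -
  have "CHAR('k) = p" using CHAR_of_CARD_prime_power[of p 1] assms by simp
  then have "inj_on (of_nat :: nat \<Rightarrow> 'k) {..<p}"
    by (auto simp: inj_on_def of_nat_eq_iff_cong_CHAR dest: cong_less_modulus_unique_nat)
  then have "card (of_nat ` {..<p} :: 'k set) = CARD('k)" by (simp add: card_image assms(2))
  then have "of_nat ` {..<p} = (UNIV :: 'k set)" by (intro card_subset_eq) auto
  then show ?thesis by blast
qed

lemma prime_field_embedding_exists:
  assumes "prime p" "CARD('k::{field,finite}) = p" "CHAR('f::field) = p"
  obtains \<iota> :: "'k::{field,finite} \<Rightarrow> 'f::field" where "field_embedding \<iota>"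
proof -
  have "CHAR('k) = p" using CHAR_of_CARD_prime_power[of p 1] assms by simp
  then have of_nat_eq_iff: "(of_nat a :: 'f) = of_nat b \<longleftrightarrow> (of_nat a :: 'k) = of_nat b" for a b
    by (simp add: of_nat_eq_iff_cong_CHAR assms(3))
  define \<iota> :: "'k \<Rightarrow> 'f" where "\<iota> x = of_nat (inv_into UNIV of_nat x)" for x
  have \<iota>_of_nat: "\<iota> (of_nat n) = of_nat n" for n
    unfolding \<iota>_def of_nat_eq_iff by (rule f_inv_into_f) simp
  have of_nat_exists: "\<exists>n. x = of_nat n" for x :: 'k
    using surj_of_nat_of_CARD_prime[OF assms(1,2)] by (rule surjD)
  have "field_embedding \<iota>"
  proof
    fix x y :: 'k
    obtain a b where ab: "x = of_nat a" "y = of_nat b" using of_nat_exists by meson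
    then show "\<iota> (x + y) = \<iota> x + \<iota> y" "\<iota> (x * y) = \<iota> x * \<iota> y"
      using \<iota>_of_nat[of "a + b"] \<iota>_of_nat[of "a * b"] \<iota>_of_nat by simp_all
  next
    show "\<iota> 1 = 1" using \<iota>_of_nat[of 1] by simp
    show "inj \<iota>" by (rule injI) (metis of_nat_exists \<iota>_of_nat of_nat_eq_iff)
  qed
  then show thesis by (rule that)
qed

lemma ring_of_type_algebra_pow:
  "g [^]\<^bsub>(ring_of_type_algebra :: 'a::field ring)\<^esub> (i::nat) = g ^ i"
  by (induction i) (simp_all add: nat_pow_def ring_of_type_algebra_def mult.commute)

lemma finite_field_generator:
  obtains g :: "'a::{field,finite}" where "g \<noteq> 0" "-{0} = range (\<lambda>i::nat. g ^ i)"
proof -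
  let ?R = "ring_of_type_algebra :: 'a ring"
  have carrier: "carrier (Multiplicative_Group.mult_of ?R) = -{0}"
    by (auto simp: ring_of_type_algebra_def)
  have "\<exists>g\<in>carrier (Multiplicative_Group.mult_of ?R).
      carrier (Multiplicative_Group.mult_of ?R) = {g [^]\<^bsub>?R\<^esub> i | i::nat. i \<in> UNIV}"
    by (rule field.finite_field_mult_group_has_gen[OF field_from_type_algebra]) simp
  then obtain g :: 'a where g: "g \<in> -{0}" "-{0} = {g ^ i | i::nat. i \<in> UNIV}"
    unfolding ring_of_type_algebra_pow carrier ..
  show thesis
  proof (rule that)
    show "g \<noteq> 0" using g(1) by simp
    show "-{0} = range (\<lambda>i::nat. g ^ i)" using g(2) by (simp add: full_SetCompr_eq)
  qed
qed

lemma finite_field_primitive_element: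
  obtains g :: "'a::{field,finite}"
  where "g \<noteq> 0" "\<And>j. j < CARD('a) - 1 \<Longrightarrow> g ^ j = 1 \<Longrightarrow> j = 0"
proof -
  obtain g :: 'a where "g \<noteq> 0" and powers: "-{0} = range (\<lambda>i::nat. g ^ i)"
    by (rule finite_field_generator)
  define N where "N = CARD('a) - 1"
  have card: "card (-{0::'a}) = N"
    by (simp add: Compl_eq_Diff_UNIV card_Diff_singleton N_def)
  have "card {1::'a} \<le> card (-{0::'a})" by (rule card_mono) simp_all
  then have "N > 0" by (simp add: card)
  have "g ^ i \<in> (\<lambda>i. g ^ i) ` {..<N}" for i
  proof (rule image_eqI)
    have "g ^ i = g ^ (N * (i div N) + i mod N)" by simp
    then show "g ^ i = g ^ (i mod N)"
      using power_CARD_minus_1[OF \<open>g \<noteq> 0\<close>] unfolding power_add power_mult N_def by simp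
    show "i mod N \<in> {..<N}" using \<open>N > 0\<close> by simp
  qed
  then have "-{0} \<subseteq> (\<lambda>i. g ^ i) ` {..<N}" unfolding powers by blast
  then have "card {..<N} \<le> card ((\<lambda>i. g ^ i) ` {..<N})"
    unfolding card_lessThan card[symmetric] by (rule card_mono[rotated]) simp
  then have "card ((\<lambda>i. g ^ i) ` {..<N}) = card {..<N}"
    using card_image_le[of "{..<N}" "\<lambda>i. g ^ i"] by simp
  then have inj: "inj_on (\<lambda>i. g ^ i) {..<N}" by (rule eq_card_imp_inj_on[OF finite_lessThan])
  have "j = 0" if "j < N" "g ^ j = 1" for j
    by (rule inj_onD[OF inj]) (use that \<open>N > 0\<close> in simp_all)
  then show thesis using that \<open>g \<noteq> 0\<close> unfolding N_def by blast
qed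

section \<open>Jacobsthal sums\<close>

locale field_card_1_mod_4 =
  fixes q :: nat and ty :: "'k::{field,finite} itself"
  assumes card_k: "CARD('k) = q" and q_mod_4: "q mod 4 = 1"
begin

definition chi :: "'k \<Rightarrow> int" where "chi = power_sign ((q - 1) div 2)"

lemma q_gt: "q > 4"
proof -
  have "card {0, 1::'k} \<le> CARD('k)" by (rule card_mono) auto
  then show ?thesis using q_mod_4 unfolding card_k by simp presburger
qed

lemma CARD_minus_1: "CARD('k) - 1 = 2 * ((q - 1) div 2)"
  and half_eq_twice_quarter: "(q - 1) div 2 = 2 * ((q - 1) div 4)"
  using q_mod_4 card_k by presburger+

lemma two_nz: "(2::'k) \<noteq> 0"
  by (rule two_neq_zero_of_odd_CARD) (use q_mod_4 card_k in presburger)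

lemma one_neq_minus_one: "(1::'k) \<noteq> - 1"
  using two_nz by (metis add.left_inverse one_add_one)

lemma neq_minus_self: "x \<noteq> 0 \<Longrightarrow> x \<noteq> - x" for x :: 'k
  using two_nz by (metis add_eq_0_iff mult_2 mult_eq_0_iff)

lemma power_half_cases: "x \<noteq> 0 \<Longrightarrow> x ^ ((q - 1) div 2) = 1 \<or> x ^ ((q - 1) div 2) = - 1" for x :: 'k
  using power_CARD_minus_1[of x] unfolding CARD_minus_1 power_even_eq by (simp add: power2_eq_1_iff)

lemma chi_0 [simp]: "chi 0 = 0"
  using q_gt by (simp add: chi_def power_sign_def power_0_left)

lemma chi_1 [simp]: "chi 1 = 1"
  by (simp add: chi_def power_sign_def)

lemma chi_cases: "x \<noteq> 0 \<Longrightarrow> chi x = 1 \<or> chi x = - 1"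
  using power_half_cases[of x] by (auto simp: chi_def power_sign_def)

lemma of_int_chi: "of_int (chi x) = x ^ ((q - 1) div 2)"
  using power_half_cases[of x] q_gt one_neq_minus_one
  by (cases "x = 0") (auto simp: chi_def power_sign_def power_0_left)

lemma chi_mult: "chi (x * y) = chi x * chi y"
proof (cases "x = 0 \<or> y = 0")
  case False
  then show ?thesis
    using power_half_cases[of x] power_half_cases[of y] one_neq_minus_one
    by (auto simp: chi_def power_sign_def power_mult_distrib)
qed auto

lemma chi_minus_1: "chi (- 1) = 1"
  unfolding chi_def power_sign_def half_eq_twice_quarter by simp

lemma chi_minus [simp]: "chi (- x) = chi x"
  using chi_mult[of "- 1" x] chi_minus_1 by simp

lemma chi_square: "x \<noteq> 0 \<Longrightarrow> chi (x ^ 2) = 1"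
  using chi_mult[of x x] chi_cases[of x] by (auto simp: power2_eq_square)

lemma chi_square_nonneg: "chi (x ^ 2) \<ge> 0"
  by (cases "x = 0") (simp_all add: chi_square)

lemma card_sqrt: "int (card {y. y ^ 2 = c}) = 1 + chi c"
proof (cases "c = 0")
  case True
  then have "{y::'k. y ^ 2 = c} = {0}" by auto
  then show ?thesis using True by simp
next
  case False
  show ?thesis
  proof (cases "chi c = 1")
    case True
    then have "c ^ ((q - 1) div 2) = 1" using of_int_chi[of c] by simp
    then have "card {y. y ^ 2 = c} = 2"
      using card_nth_roots[OF CARD_minus_1, of c] q_gt by simp
    then show ?thesis using True by simp
  next
    case nonsquare: False
    then have "{y. y ^ 2 = c} = {}" using chi_square \<open>c \<noteq> 0\<close> by auto
    then show ?thesis using nonsquare chi_cases[OF False] by simp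
  qed
qed

lemma sum_chi: "(\<Sum>x\<in>UNIV. chi x) = 0"
proof -
  have "(\<Sum>c\<in>(UNIV::'k set). \<Sum>y\<in>{y\<in>UNIV. y ^ 2 = c}. (1::int)) = (\<Sum>y\<in>(UNIV::'k set). 1)"
    by (rule sum.group) auto
  then have "(\<Sum>c\<in>(UNIV::'k set). 1 + chi c) = int (CARD('k))"
    by (simp add: card_sqrt)
  then show ?thesis by (simp add: sum.distrib)
qed

lemma nonsquare_exists: obtains d where "chi d = - 1"
proof -
  have "\<exists>d. chi d < 0"
  proof (rule ccontr)
    assume "\<not> ?thesis"
    then have "(\<Sum>x\<in>UNIV. chi x) \<ge> (\<Sum>x\<in>{1}. chi x)"
      by (intro sum_mono2) (auto simp: not_less)
    then show False using sum_chi by simp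
  qed
  then obtain d where "chi d < 0" by blast
  then show thesis using that chi_cases[of d] by (cases "d = 0") auto
qed

lemma chi_eq_imp_square_multiple:
  assumes "chi c = chi d" "c \<noteq> 0" "d \<noteq> 0"
  obtains t where "t \<noteq> 0" "c = d * t ^ 2"
proof -
  have "chi (c / d) * chi d = chi d" using assms chi_mult[of "c / d" d] by simp
  then have "chi (c / d) = 1" using chi_cases[OF assms(3)] by auto
  then have "card {y. y ^ 2 = c / d} \<noteq> 0" using card_sqrt[of "c / d"] by simp
  then obtain t where "t ^ 2 = c / d" by (metis (mono_tags, lifting) card.empty empty_Collect_eq)
  then show thesis using that[of t] assms by (auto simp: field_simps)
qed

lemma sum_chi_translates:
  assumes "a \<noteq> b"
  shows "(\<Sum>c\<in>UNIV. chi (a + c) * chi (b + c)) = - 1"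
proof -
  define e where "e = b - a"
  have "e \<noteq> 0" using assms by (simp add: e_def)
  have "(\<Sum>c\<in>UNIV. chi (a + c) * chi (b + c)) = (\<Sum>t\<in>UNIV. chi t * chi (t + e))"
    by (rule sum.reindex_bij_witness[of _ "\<lambda>t. t - a" "\<lambda>c. a + c"]) (auto simp: e_def algebra_simps)
  also have "\<dots> = (\<Sum>t\<in>-{0}. chi t * chi (t + e))"
    by (rule sum.mono_neutral_right) auto
  also have "\<dots> = (\<Sum>t\<in>-{0}. chi (1 + e / t))"
  proof (rule sum.cong[OF refl])
    fix t :: 'k assume "t \<in> -{0}"
    then have "t \<noteq> 0" by simp
    then have "t * (t + e) = t ^ 2 * (1 + e / t)" by (simp add: field_simps power2_eq_square)
    then show "chi t * chi (t + e) = chi (1 + e / t)"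
      using chi_mult chi_square[OF \<open>t \<noteq> 0\<close>] by (metis mult_1)
  qed
  also have "\<dots> = (\<Sum>s\<in>-{1}. chi s)"
    by (rule sum.reindex_bij_witness[of _ "\<lambda>s. e / (s - 1)" "\<lambda>t. 1 + e / t"]) (use \<open>e \<noteq> 0\<close> in auto)
  also have "\<dots> = - 1"
    using sum_chi by (simp add: Compl_eq_Diff_UNIV sum_diff1)
  finally show ?thesis .
qed

lemma sum_chi_translate_self: "(\<Sum>c\<in>UNIV. chi (a + c) * chi (a + c)) = int q - 1"
proof -
  have "(\<Sum>c\<in>UNIV. chi (a + c) * chi (a + c)) = (\<Sum>t\<in>UNIV. chi t * chi t)"
    by (rule sum.reindex_bij_witness[of _ "\<lambda>t. t - a" "\<lambda>c. a + c"]) auto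
  also have "\<dots> = (\<Sum>t\<in>-{0}. chi t * chi t)"
    by (rule sum.mono_neutral_right) auto
  also have "\<dots> = (\<Sum>t\<in>-{0::'k}. 1)"
    by (rule sum.cong) (use chi_cases in force)+
  finally show ?thesis using q_gt by (simp add: Compl_eq_Diff_UNIV card_Diff_singleton card_k)
qed

lemma sum_chi_same_square:
  "(\<Sum>y\<in>UNIV. chi x * chi y * of_bool (x ^ 2 = y ^ 2)) = (if x = 0 then 0 else 2)"
proof (cases "x = 0")
  case False
  have "(\<Sum>y\<in>UNIV. chi x * chi y * of_bool (x ^ 2 = y ^ 2)) = (\<Sum>y\<in>{x, - x}. chi x * chi y)"
    by (rule sum.mono_neutral_cong_right) (auto simp: power2_eq_iff)
  also have "\<dots> = 2 * (chi x * chi x)" using neq_minus_self[OF False] by simp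
  finally show ?thesis using chi_cases[OF False] False by auto
qed simp

definition jacobsthal :: "'k \<Rightarrow> int" where
  "jacobsthal c = (\<Sum>x\<in>UNIV. chi x * chi (x ^ 2 + c))"

lemma jacobsthal_0: "jacobsthal 0 = 0"
proof -
  have summand: "chi x * chi (x ^ 2 + 0) = chi x" for x
    by (cases "x = 0") (simp_all add: chi_square)
  show ?thesis unfolding jacobsthal_def summand by (rule sum_chi)
qed

lemma jacobsthal_scale:
  assumes "t \<noteq> 0" shows "jacobsthal (c * t ^ 2) = chi t * jacobsthal c"
proof -
  have "jacobsthal (c * t ^ 2) = (\<Sum>x\<in>UNIV. chi (t * x) * chi ((t * x) ^ 2 + c * t ^ 2))"
    unfolding jacobsthal_def
    by (rule sum.reindex_bij_witness[of _ "\<lambda>x. t * x" "\<lambda>x. x / t"]) (use assms in auto)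
  also have "\<dots> = (\<Sum>x\<in>UNIV. chi t * (chi x * chi (x ^ 2 + c)))"
  proof (rule sum.cong[OF refl])
    fix x
    have "(t * x) ^ 2 + c * t ^ 2 = t ^ 2 * (x ^ 2 + c)" by (simp add: algebra_simps)
    then show "chi (t * x) * chi ((t * x) ^ 2 + c * t ^ 2) = chi t * (chi x * chi (x ^ 2 + c))"
      using chi_square[OF assms] by (simp add: chi_mult)
  qed
  finally show ?thesis by (simp add: jacobsthal_def sum_distrib_left)
qed

lemma jacobsthal_squared_eq:
  assumes "chi c = chi e" "c \<noteq> 0" "e \<noteq> 0"
  shows "(jacobsthal c) ^ 2 = (jacobsthal e) ^ 2"
proof -
  obtain t where t: "t \<noteq> 0" "c = e * t ^ 2" by (rule chi_eq_imp_square_multiple[OF assms])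
  then show ?thesis using jacobsthal_scale[OF t(1), of e] chi_cases[OF t(1)] by auto
qed

lemma sum_jacobsthal_squared: "(\<Sum>c\<in>UNIV. (jacobsthal c) ^ 2) = 2 * int q * (int q - 1)"
proof -
  have correlation: "(\<Sum>c\<in>UNIV. chi (a + c) * chi (b + c)) = int q * of_bool (a = b) - 1" for a b
    by (simp add: sum_chi_translates sum_chi_translate_self)
  have "(\<Sum>c\<in>UNIV. (jacobsthal c) ^ 2)
      = (\<Sum>c\<in>UNIV. \<Sum>x\<in>UNIV. \<Sum>y\<in>UNIV. chi x * chi y * (chi (x ^ 2 + c) * chi (y ^ 2 + c)))"
    by (simp add: jacobsthal_def power2_eq_square sum_product algebra_simps)
  also have "\<dots> = (\<Sum>x\<in>UNIV. \<Sum>y\<in>UNIV. \<Sum>c\<in>UNIV. chi x * chi y * (chi (x ^ 2 + c) * chi (y ^ 2 + c)))"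
    by (subst sum.swap, rule sum.cong[OF refl], rule sum.swap)
  also have "\<dots> = (\<Sum>x\<in>UNIV. \<Sum>y\<in>UNIV. chi x * chi y * (int q * of_bool (x ^ 2 = y ^ 2) - 1))"
    by (simp add: sum_distrib_left[symmetric] correlation)
  also have "\<dots>
      = (\<Sum>x\<in>UNIV. int q * (\<Sum>y\<in>UNIV. chi x * chi y * of_bool (x ^ 2 = y ^ 2))
          - chi x * (\<Sum>y\<in>UNIV. chi y))"
    by (simp add: sum_distrib_left sum_subtractf right_diff_distrib mult_ac del: of_bool_eq_iff)
  also have "\<dots> = (\<Sum>x\<in>(UNIV::'k set). if x = 0 then 0 else 2 * int q)"
    unfolding sum_chi_same_square sum_chi by (rule sum.cong) simp_all
  also have "\<dots> = (\<Sum>x\<in>-{0::'k}. 2 * int q)"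
    by (rule sum.mono_neutral_cong_right) auto
  finally show ?thesis using q_gt
    by (simp add: Compl_eq_Diff_UNIV card_Diff_singleton card_k of_nat_diff)
qed

lemma jacobsthal_sum_two_squares:
  assumes "chi d = - 1"
  shows "(jacobsthal (- 1)) ^ 2 + (jacobsthal d) ^ 2 = 4 * int q"
proof -
  let ?A = "(jacobsthal (- 1)) ^ 2" and ?B = "(jacobsthal d) ^ 2"
  have "d \<noteq> 0" using assms by auto
  have "2 * (jacobsthal c) ^ 2 = (?A + ?B) + (?A - ?B) * chi c" if "c \<noteq> 0" for c
    using jacobsthal_squared_eq[of c "- 1"] jacobsthal_squared_eq[of c d] chi_cases[OF that]
      that \<open>d \<noteq> 0\<close> assms chi_minus_1 by auto
  then have "(\<Sum>c\<in>-{0}. 2 * (jacobsthal c) ^ 2) = (\<Sum>c\<in>-{0}. (?A + ?B) + (?A - ?B) * chi c)"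
    by (intro sum.cong) auto
  also have "\<dots> = (int q - 1) * (?A + ?B) + (?A - ?B) * (\<Sum>c\<in>-{0}. chi c)"
    using q_gt by (simp add: sum.distrib sum_distrib_left Compl_eq_Diff_UNIV
        card_Diff_singleton card_k of_nat_diff)
  also have "(\<Sum>c\<in>-{0}. chi c) = 0"
    using sum_chi by (simp add: Compl_eq_Diff_UNIV sum_diff1)
  finally have "(int q - 1) * (?A + ?B) = (\<Sum>c\<in>-{0}. 2 * (jacobsthal c) ^ 2)" by simp
  also have "\<dots> = (\<Sum>c\<in>UNIV. 2 * (jacobsthal c) ^ 2)"
    by (rule sum.mono_neutral_left) (auto simp: jacobsthal_0)
  also have "\<dots> = (int q - 1) * (4 * int q)"
    by (simp add: sum_jacobsthal_squared sum_distrib_left[symmetric])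
  finally show ?thesis using q_gt by simp
qed

lemma even_card_symmetric:
  assumes symmetric: "\<And>x::'k. x \<in> S \<Longrightarrow> - x \<in> S" and "0 \<notin> S"
  shows "even (card S)"
proof -
  have "card S = (\<Sum>c\<in>(\<lambda>x. x ^ 2) ` S. card {x\<in>S. x ^ 2 = c})"
    using sum.group[of S "(\<lambda>x. x ^ 2) ` S" "\<lambda>x. x ^ 2" "\<lambda>_. 1::nat"] by simp
  also have "\<dots> = (\<Sum>c\<in>(\<lambda>x. x ^ 2) ` S. 2)"
  proof (rule sum.cong[OF refl])
    fix c assume "c \<in> (\<lambda>x. x ^ 2) ` S"
    then obtain x where x: "x \<in> S" "c = x ^ 2" by auto
    then have "{x\<in>S. x ^ 2 = c} = {x, - x}" using symmetric by (auto simp: power2_eq_iff)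
    moreover have "x \<noteq> - x" using x \<open>0 \<notin> S\<close> by (intro neq_minus_self) auto
    ultimately show "card {x\<in>S. x ^ 2 = c} = 2" by simp
  qed
  finally show ?thesis by simp
qed

text \<open>The substitution \<open>x \<mapsto> - x\<close> pairs the terms of the sum that are equal to \<open>- 1\<close>.\<close>

lemma jacobsthal_cong: "[jacobsthal c = int (card {x. x \<noteq> 0 \<and> x ^ 2 + c \<noteq> 0})] (mod 4)"
proof -
  define S where "S = {x. x \<noteq> 0 \<and> x ^ 2 + c \<noteq> 0}"
  define N where "N = {x\<in>S. chi x * chi (x ^ 2 + c) = - 1}"
  have "chi x * chi (x ^ 2 + c) = 1 - 2 * of_bool (x \<in> N)" if "x \<in> S" for x
    using that chi_cases[of x] chi_cases[of "x ^ 2 + c"] by (auto simp: N_def S_def)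
  moreover have "jacobsthal c = (\<Sum>x\<in>S. chi x * chi (x ^ 2 + c))"
    unfolding jacobsthal_def by (rule sum.mono_neutral_right) (auto simp: S_def)
  ultimately have "jacobsthal c = (\<Sum>x\<in>S. 1 - 2 * of_bool (x \<in> N))" by simp
  also have "\<dots> = int (card S) - 2 * int (card (S \<inter> N))"
    by (simp add: sum_subtractf sum_distrib_left[symmetric])
  also have "S \<inter> N = N" by (auto simp: N_def)
  finally have "jacobsthal c = int (card S) - 2 * int (card N)" .
  moreover have "even (card N)" by (rule even_card_symmetric) (auto simp: N_def S_def)
  ultimately show ?thesis
    unfolding S_def[symmetric] by (auto simp: cong_iff_dvd_diff elim!: evenE)
qed

lemma jacobsthal_minus_1_cong: "[jacobsthal (- 1) = 2] (mod 4)"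
proof -
  have "{x::'k. x \<noteq> 0 \<and> x ^ 2 + (- 1) \<noteq> 0} = UNIV - {0, 1, - 1}"
    by (auto simp: power2_eq_1_iff)
  moreover have "card {0, 1, - 1::'k} = 3" using one_neq_minus_one by simp
  ultimately have "int (card {x::'k. x \<noteq> 0 \<and> x ^ 2 + (- 1) \<noteq> 0}) = int q - 3"
    using q_gt by (simp add: card_Diff_subset card_k)
  moreover have "[int q - 3 = 2] (mod 4)"
    using q_mod_4 unfolding unique_euclidean_semiring_class.cong_def by presburger
  ultimately show ?thesis using jacobsthal_cong[of "- 1"] by (metis cong_trans)
qed

lemma even_jacobsthal_nonsquare:
  assumes "chi d = - 1"
  shows "even (jacobsthal d)"
proof -
  have "x ^ 2 + d \<noteq> 0" for x
  proof
    assume "x ^ 2 + d = 0"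
    then have "chi d = chi (x ^ 2)" by (metis add_eq_0_iff chi_minus)
    then show False using assms chi_square_nonneg[of x] by simp
  qed
  then have "{x::'k. x \<noteq> 0 \<and> x ^ 2 + d \<noteq> 0} = UNIV - {0}" by auto
  then have "int (card {x::'k. x \<noteq> 0 \<and> x ^ 2 + d \<noteq> 0}) = int q - 1"
    using q_gt by (simp add: card_k)
  then have "[jacobsthal d = int q - 1] (mod 4)" using jacobsthal_cong[of d] by simp
  then show ?thesis using q_mod_4 unfolding unique_euclidean_semiring_class.cong_def by presburger
qed

end

lemma sum_two_squares_dvd_imp_unit:
  fixes A B c p :: int
  assumes "prime p" and c: "p = 1 + c ^ 2" and AB: "A ^ 2 + B ^ 2 = p" and "odd A" "even c"
    and dvd: "p dvd c * A - B"
  shows "A ^ 2 = 1"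
proof -
  have "p > 0" using \<open>prime p\<close> by (rule prime_gt_0_int)
  have "(A + c * B) ^ 2 + (c * A - B) ^ 2 = (1 + c ^ 2) * (A ^ 2 + B ^ 2)"
    by (simp add: power2_eq_square algebra_simps)
  then have "(A + c * B) ^ 2 + (c * A - B) ^ 2 = p ^ 2"
    unfolding AB c[symmetric] by (simp add: power2_eq_square)
  moreover have "A + c * B \<noteq> 0" using \<open>odd A\<close> \<open>even c\<close> by (metis even_add even_mult_iff even_zero)
  then have "(A + c * B) ^ 2 > 0" by (rule zero_less_power2[THEN iffD2])
  ultimately have "\<bar>c * A - B\<bar> ^ 2 < p ^ 2" unfolding power2_abs by linarith
  then have "\<bar>c * A - B\<bar> < p" by (rule power2_less_imp_less) (use \<open>p > 0\<close> in simp)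
  then have "c * A - B = 0" using dvd_imp_le_int[OF _ dvd] by force
  then have "B = c * A" by simp
  have "A ^ 2 * p = A ^ 2 + (c * A) ^ 2"
    by (subst c) (simp add: power_mult_distrib distrib_left mult.commute)
  also have "\<dots> = 1 * p" using AB \<open>B = c * A\<close> by simp
  finally show ?thesis unfolding mult_cancel_right using \<open>p > 0\<close> by simp
qed

lemma prime_sum_two_squares_unit:
  fixes A B c p :: int
  assumes p: "prime p" "p = 1 + c ^ 2" and AB: "A ^ 2 + B ^ 2 = p" and parity: "odd A" "even c"
  shows "A ^ 2 = 1"
proof -
  have "(c * A - B) * (c * A + B) = (1 + c ^ 2) * A ^ 2 - (A ^ 2 + B ^ 2)" by Groebner_Basis.algebra
  also have "\<dots> = p * (A ^ 2 - 1)" unfolding AB p(2)[symmetric] by (simp add: algebra_simps)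
  finally have "p dvd (c * A - B) * (c * A + B)" by simp
  then consider (minus) "p dvd c * A - B" | (plus) "p dvd c * A - (- B)"
    using p(1) by (auto simp: prime_dvd_mult_iff)
  then show ?thesis
  proof cases
    case minus
    then show ?thesis by (rule sum_two_squares_dvd_imp_unit[OF p AB parity])
  next
    case plus
    then show ?thesis
      by (rule sum_two_squares_dvd_imp_unit[OF p _ parity, rotated]) (use AB in simp)
  qed
qed

context field_card_1_mod_4
begin

lemma jacobsthal_minus_1:
  assumes "prime q" "int q = 1 + 16 * a ^ 2"
  shows "jacobsthal (- 1) \<in> {2, - 2}"
proof -
  obtain d where d: "chi d = - 1" by (rule nonsquare_exists)
  obtain k where "jacobsthal (- 1) - 2 = 4 * k"
    using jacobsthal_minus_1_cong by (auto simp: cong_iff_dvd_diff elim: dvdE)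
  then have "jacobsthal (- 1) = 2 * (2 * k + 1)" by simp
  then obtain A where A: "jacobsthal (- 1) = 2 * A" and "odd A" by fastforce
  obtain B where B: "jacobsthal d = 2 * B" using even_jacobsthal_nonsquare[OF d] by (rule evenE)
  have "A ^ 2 + B ^ 2 = int q"
    using jacobsthal_sum_two_squares[OF d] unfolding A B power_mult_distrib by simp
  moreover have "int q = 1 + (4 * a) ^ 2" using assms(2) by (simp add: power_mult_distrib)
  moreover have "prime (int q)" using assms(1) by simp
  ultimately have "A ^ 2 = 1"
    using \<open>odd A\<close> by (intro prime_sum_two_squares_unit[of "int q" "4 * a" A B]) simp_all
  then show ?thesis using A(1) by (auto simp: power2_eq_1_iff)
qed

lemma sum_chi_sqrt: "(\<Sum>z\<in>UNIV. chi z * of_bool (z ^ 2 = y)) = 2 * power_sign ((q - 1) div 4) y"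
proof -
  have "chi z = power_sign ((q - 1) div 4) (z ^ 2)" for z
    by (simp only: chi_def half_eq_twice_quarter power_sign_mult)
  then have "(\<Sum>z\<in>UNIV. chi z * of_bool (z ^ 2 = y))
      = (\<Sum>z\<in>(UNIV::'k set). of_bool (z ^ 2 = y) * power_sign ((q - 1) div 4) y)"
    by (intro sum.cong) auto
  also have "\<dots> = (1 + chi y) * power_sign ((q - 1) div 4) y"
    unfolding sum_distrib_right[symmetric] by (simp flip: card_sqrt)
  also have "\<dots> = 2 * power_sign ((q - 1) div 4) y"
  proof -
    have "y ^ ((q - 1) div 2) = (y ^ ((q - 1) div 4)) ^ 2"
      unfolding half_eq_twice_quarter by (rule power_even_eq)
    then have "power_sign ((q - 1) div 4) y \<noteq> 0 \<Longrightarrow> chi y = 1"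
      by (auto simp: chi_def power_sign_def split: if_splits)
    then show ?thesis by (cases "power_sign ((q - 1) div 4) y = 0") simp_all
  qed
  finally show ?thesis .
qed

lemma sum_power_sign_quarter:
  assumes "chi d = - 1"
  shows "2 * (\<Sum>x\<in>UNIV. power_sign ((q - 1) div 4) (d * (d - x ^ 2))) = jacobsthal (- 1)"
proof -
  have "d \<noteq> 0" using assms by auto
  have fiber: "(\<Sum>x\<in>UNIV. of_bool (z ^ 2 = d * (d - x ^ 2))) = 1 - chi (z ^ 2 - d ^ 2)" for z
  proof -
    have "{x. z ^ 2 = d * (d - x ^ 2)} = {x. x ^ 2 = d - z ^ 2 / d}"
      using \<open>d \<noteq> 0\<close> by (auto simp: field_simps power2_eq_square)
    then have "(\<Sum>x\<in>UNIV. of_bool (z ^ 2 = d * (d - x ^ 2))) = 1 + chi (d - z ^ 2 / d)"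
      by (simp add: card_sqrt)
    also have "d * (d - z ^ 2 / d) = - (z ^ 2 - d ^ 2)"
      using \<open>d \<noteq> 0\<close> by (simp add: field_simps power2_eq_square)
    then have "chi d * chi (d - z ^ 2 / d) = chi (z ^ 2 - d ^ 2)" by (metis chi_mult chi_minus)
    then have "chi (d - z ^ 2 / d) = - chi (z ^ 2 - d ^ 2)" using assms by simp
    finally show ?thesis by simp
  qed
  have "2 * (\<Sum>x\<in>UNIV. power_sign ((q - 1) div 4) (d * (d - x ^ 2)))
      = (\<Sum>x\<in>UNIV. \<Sum>z\<in>UNIV. chi z * of_bool (z ^ 2 = d * (d - x ^ 2)))"
    by (simp only: sum_chi_sqrt sum_distrib_left)
  also have "\<dots> = (\<Sum>z\<in>UNIV. chi z * (\<Sum>x\<in>UNIV. of_bool (z ^ 2 = d * (d - x ^ 2))))"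
    unfolding sum_distrib_left by (rule sum.swap)
  also have "\<dots> = (\<Sum>z\<in>UNIV. chi z - chi z * chi (z ^ 2 - d ^ 2))"
    unfolding fiber by (simp add: right_diff_distrib)
  also have "\<dots> = - jacobsthal ((- 1) * d ^ 2)"
    by (simp add: sum_subtractf sum_chi jacobsthal_def)
  also have "\<dots> = jacobsthal (- 1)" using jacobsthal_scale[OF \<open>d \<noteq> 0\<close>, of "- 1"] assms by simp
  finally show ?thesis .
qed

end

section \<open>Quadratic extensions of prime fields\<close>

locale quadratic_extension =
  fixes p :: nat and \<delta> :: "'f::{field,finite}"
  assumes prime_p: "prime p" and p_mod_4: "p mod 4 = 1" and card_f: "CARD('f) = p ^ 2"
    and \<delta>_nz: "\<delta> \<noteq> 0" and \<delta>_conj: "\<delta> ^ p = - \<delta>"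
begin

definition m :: nat where "m = (p + 1) div 2"

definition half_order :: nat where "half_order = (p ^ 2 - 1) div 2"

definition quarter_order :: nat where "quarter_order = (p ^ 2 - 1) div 4"

abbreviation rational :: "'f \<Rightarrow> bool" where "rational x \<equiv> x ^ p = x"

lemma p_gt: "p > 4"
proof -
  have "p \<noteq> 1" using prime_p by auto
  then show ?thesis using p_mod_4 by presburger
qed

lemma odd_p: "odd p" using p_mod_4 by presburger

lemma two_m: "2 * m = p + 1" and odd_m: "odd m"
  using p_mod_4 unfolding m_def by presburger+

lemma m_pos: "m > 0" using two_m by simp

lemma
  shows card_minus_1: "CARD('f) - 1 = (p + 1) * (p - 1)"
    and half_order_eq: "half_order = m * (p - 1)"
    and half_order_eq_twice_quarter: "half_order = 2 * quarter_order"
    and quarter_order_eq: "quarter_order = (p + 1) * ((p - 1) div 4)"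
    and m_mult_p: "m * p = m ^ 2 + quarter_order"
    and two_m_squared: "2 * m ^ 2 = half_order + (p + 1)"
proof -
  obtain k where p: "p = 4 * k + 1" using p_mod_4 by (metis mod_mult_div_eq add.commute)
  have m: "m = 2 * k + 1" using two_m p by simp
  have order: "p ^ 2 - 1 = 4 * (2 * k * (2 * k + 1))"
    by (simp add: p power2_eq_square algebra_simps)
  have half: "half_order = 4 * k * (2 * k + 1)" and quarter: "quarter_order = 2 * k * (2 * k + 1)"
    unfolding half_order_def quarter_order_def order by simp_all
  show "CARD('f) - 1 = (p + 1) * (p - 1)" unfolding card_f order by (simp add: p algebra_simps)
  show "half_order = m * (p - 1)" "half_order = 2 * quarter_order"
    "quarter_order = (p + 1) * ((p - 1) div 4)"
    unfolding half quarter m by (simp_all add: p algebra_simps)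
  show "m * p = m ^ 2 + quarter_order" "2 * m ^ 2 = half_order + (p + 1)"
    unfolding half quarter m by (simp_all add: p power2_eq_square algebra_simps)
qed

lemma half_order_pos: "half_order > 0"
  using half_order_eq m_pos p_gt by simp

lemma CARD_minus_1_eq_half_order: "CARD('f) - 1 = 2 * half_order"
  using half_order_eq two_m card_minus_1 by (metis mult.assoc)

lemma CHAR_f [simp]: "CHAR('f) = p" and CHAR_ac [simp]: "CHAR('f alg_closure) = p"
  using CHAR_of_CARD_prime_power[OF prime_p card_f] by simp_all

lemma two_nz [simp]: "(2::'f) \<noteq> 0" and two_ac_nz [simp]: "(2::'f alg_closure) \<noteq> 0"
proof -
  show "(2::'f) \<noteq> 0" by (rule two_neq_zero_of_odd_CARD) (simp add: card_f odd_p)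
  then show "(2::'f alg_closure) \<noteq> 0" by (metis to_ac_eq_0_iff to_ac_numeral)
qed

lemma four_nz [simp]: "(4::'f) \<noteq> 0"
proof -
  have "(4::'f) = 2 * 2" by simp
  then show ?thesis by (metis mult_eq_0_iff two_nz)
qed

lemma eq_minus_self_iff [simp]: "x = - x \<longleftrightarrow> x = 0"
  and eq_minus_self_iff_ac [simp]: "s = - s \<longleftrightarrow> s = 0"
  for x :: 'f and s :: "'f alg_closure"
proof -
  have "x = - x \<longleftrightarrow> 2 * x = 0" "s = - s \<longleftrightarrow> 2 * s = 0" by (simp_all only: eq_neg_iff_add_eq_0 mult_2)
  then show "x = - x \<longleftrightarrow> x = 0" "s = - s \<longleftrightarrow> s = 0" by simp_all
qed

lemma frob_add [simp]: "(x + y :: 'f) ^ p = x ^ p + y ^ p"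
  and frob_add_ac [simp]: "(s + t :: 'f alg_closure) ^ p = s ^ p + t ^ p"
  by (rule freshmans_dream; simp add: prime_p)+

lemma frob_sum: "(\<Sum>i\<in>A. f i :: 'f) ^ p = (\<Sum>i\<in>A. f i ^ p)"
  by (rule freshmans_dream_sum) (simp_all add: prime_p)

lemma frob_minus [simp]: "(- x :: 'f) ^ p = - (x ^ p)"
  and frob_minus_ac [simp]: "(- s :: 'f alg_closure) ^ p = - (s ^ p)"
  using odd_p by simp_all

lemma frob_diff [simp]: "(x - y :: 'f) ^ p = x ^ p - y ^ p"
  and frob_diff_ac [simp]: "(s - t :: 'f alg_closure) ^ p = s ^ p - t ^ p"
  using frob_add[of x "- y"] frob_add_ac[of s "- t"] by simp_all

lemma frob_mult [simp]: "((x::'f) * y) ^ p = x ^ p * y ^ p"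
  and frob_mult_ac [simp]: "((s::'f alg_closure) * t) ^ p = s ^ p * t ^ p"
  by (simp_all add: power_mult_distrib)

lemma frob_divide [simp]: "((x::'f) / y) ^ p = x ^ p / y ^ p"
  and frob_divide_ac [simp]: "((s::'f alg_closure) / t) ^ p = s ^ p / t ^ p"
  by (simp_all add: power_divide)

lemma frob_square [simp]: "((x::'f) ^ 2) ^ p = (x ^ p) ^ 2"
  and frob_square_ac [simp]: "((s::'f alg_closure) ^ 2) ^ p = (s ^ p) ^ 2"
  by (simp_all add: power2_eq_square)

lemma frob_zero [simp]: "(0::'f) ^ p = 0" "(0::'f alg_closure) ^ p = 0"
  using p_gt by (simp_all add: power_0_left)

lemma frob_numeral [simp]: "(numeral n :: 'f) ^ p = numeral n"
  and frob_numeral_ac [simp]: "(numeral n :: 'f alg_closure) ^ p = numeral n"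
proof -
  have "(of_nat k :: 'f) ^ p = of_nat k" for k by (induction k) simp_all
  from this[of "numeral n"] show "(numeral n :: 'f) ^ p = numeral n" by simp
  then show "(numeral n :: 'f alg_closure) ^ p = numeral n" by (metis to_ac_numeral to_ac_power)
qed

lemma frob_frob [simp]: "((x::'f) ^ p) ^ p = x"
  using power_CARD_eq[of x] by (simp add: card_f power2_eq_square power_mult)

lemma frob_inj_ac [simp]: "(s::'f alg_closure) ^ p = t ^ p \<longleftrightarrow> s = t"
proof
  assume "s ^ p = t ^ p"
  then have "(s - t) ^ p = 0" by simp
  then show "s = t" by (metis eq_iff_diff_eq_0 power_not_zero)
qed simp

lemma to_ac_frob_frob: "(to_ac x ^ p) ^ p = to_ac x" for x :: 'f
  by (simp flip: to_ac_power)

lemma \<delta>_not_rational: "\<not> rational \<delta>"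
  using \<delta>_nz by (simp add: \<delta>_conj eq_commute[of "- \<delta>"])

lemma power_p_plus_1: "x ^ (p + 1) = x * x ^ p" for x :: "'a::comm_monoid_mult"
  by simp

lemma power_2m: "x ^ (2 * m) = x * x ^ p" for x :: "'a::comm_monoid_mult"
  by (simp only: two_m power_p_plus_1)

lemma power_m_squared: "(x ^ m) ^ 2 = x * x ^ p" for x :: "'a::comm_monoid_mult"
  by (simp only: power_2m flip: power_even_eq)

lemma square_power_m: "(x ^ 2) ^ m = x * x ^ p" for x :: "'a::comm_monoid_mult"
  by (simp only: power_2m flip: power_mult)

lemma norm_power_m: "(x * x ^ p) ^ m = (x * x) ^ (m ^ 2)" for x :: "'a::comm_monoid_mult"
  by (simp only: square_power_m[symmetric] power2_eq_square power_mult)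

lemma rational_power_p_minus_1: "rational x \<Longrightarrow> x \<noteq> 0 \<Longrightarrow> x ^ (p - 1) = 1"
  using p_gt power_minus_mult[of p x] by simp

lemma rational_power_half_order: "rational x \<Longrightarrow> x \<noteq> 0 \<Longrightarrow> x ^ half_order = 1"
  using rational_power_p_minus_1[of x] half_order_eq by (metis mult.commute power_mult power_one)

lemma power_half_order_squared: "x \<noteq> 0 \<Longrightarrow> (x ^ half_order) ^ 2 = 1" for x :: 'f
  using power_CARD_minus_1[of x] unfolding CARD_minus_1_eq_half_order power_even_eq by blast

lemma power_half_order_cases: "x \<noteq> 0 \<Longrightarrow> x ^ half_order = 1 \<or> x ^ half_order = - 1" for x :: 'f
  using power_half_order_squared by (simp add: power2_eq_1_iff)

lemma square_power_half_order: "x \<noteq> 0 \<Longrightarrow> (x * x) ^ half_order = 1" for x :: 'f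
  using power_half_order_squared[of x] by (simp add: power_mult_distrib power2_eq_square)

lemma rational_square_exists:
  assumes "rational x"
  obtains y where "y ^ 2 = x"
proof (cases "x = 0")
  case False
  then show thesis
    using finite_field_nth_root_exists[OF CARD_minus_1_eq_half_order, of x] that
      half_order_pos rational_power_half_order[OF assms] by auto
qed (use that[of 0] in simp)

lemma card_norm_fiber:
  assumes "rational c" "c \<noteq> 0"
  shows "card {x. x * x ^ p = c} = p + 1"
  using card_nth_roots[OF card_minus_1, of c] rational_power_p_minus_1[OF assms] p_gt by simp

lemma norm_surj:
  assumes "rational c" "c \<noteq> 0"
  obtains x where "x * x ^ p = c"
  using finite_field_nth_root_exists[OF card_minus_1, of c] rational_power_p_minus_1[OF assms] p_gt
  by auto

lemma card_m_torsion: "card {l::'f. l ^ m = 1} = m"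
proof (rule card_nth_roots)
  show "CARD('f) - 1 = m * (2 * (p - 1))" using card_minus_1 two_m by (simp add: algebra_simps)
qed (use p_gt m_pos in auto)

lemma m_torsion_nz: "l ^ m = 1 \<Longrightarrow> l \<noteq> 0" for l :: 'f
  using m_pos by (auto simp: power_0_left)

lemma m_torsion_norm: "l ^ m = 1 \<Longrightarrow> l * l ^ p = 1" for l :: 'f
  using power_m_squared[of l] by simp

lemma norm_one_cases:
  assumes "(l::'f) * l ^ p = 1" shows "l ^ m = 1 \<or> (- l) ^ m = 1"
proof -
  have "(l ^ m) ^ 2 = 1" using assms power_m_squared[of l] by simp
  then show ?thesis using odd_m by (auto simp: power2_eq_1_iff)
qed

lemma primitive_m_torsion_exists:
  obtains \<zeta> :: 'f where "\<zeta> ^ m = 1" "\<And>j. j < m \<Longrightarrow> \<zeta> ^ j = 1 \<Longrightarrow> j = 0"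
proof -
  obtain g :: 'f where g: "g \<noteq> 0" "\<And>j. j < CARD('f) - 1 \<Longrightarrow> g ^ j = 1 \<Longrightarrow> j = 0"
    by (rule finite_field_primitive_element) blast
  have order: "CARD('f) - 1 = 2 * (p - 1) * m" using card_minus_1 two_m by (simp add: algebra_simps)
  show thesis
  proof (rule that)
    show "(g ^ (2 * (p - 1))) ^ m = 1"
      using power_CARD_minus_1[OF g(1)] by (simp only: order power_mult)
    fix j assume j: "j < m" "(g ^ (2 * (p - 1))) ^ j = 1"
    then have "2 * (p - 1) * j < CARD('f) - 1" unfolding order using p_gt by simp
    moreover have "g ^ (2 * (p - 1) * j) = 1" using j(2) by (simp only: power_mult)
    ultimately have "2 * (p - 1) * j = 0" by (rule g(2))
    then show "j = 0" using p_gt by simp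
  qed
qed

lemma card_trace_fiber:
  assumes "rational c"
  shows "card {x::'f. x + x ^ p = c} = p"
proof -
  have card_le: "card {x::'f. x ^ p + b * x = c} \<le> p" for b c
  proof -
    have "{x. x ^ p + b * x = c} = {x. x ^ p = poly [:c, - b:] x}" by (auto simp: algebra_simps)
    then show ?thesis using card_power_eq_poly_le[of "[:c, - b:]" p] p_gt by simp
  qed
  have "card {x\<in>UNIV. x + x ^ p = c} = p"
  proof (rule card_fiber_eq[where C = "{c. rational c}" and k = p])
    show "card {c::'f. rational c} \<le> p" using card_le[of "- 1" 0] by simp
    show "card {x\<in>UNIV. x + x ^ p = c} \<le> p" for c :: 'f
      using card_le[of 1 c] by (simp add: add.commute)
  qed (use assms card_f in \<open>auto simp: power2_eq_square add.commute\<close>)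
  then show ?thesis by simp
qed

lemma card_rational: "card {x::'f. rational x} = p"
proof -
  have "bij_betw (\<lambda>x. x * \<delta>) {x. rational x} {x. x + x ^ p = 0}"
    by (rule bij_betw_byWitness[where f' = "\<lambda>x. x / \<delta>"])
      (auto simp: \<delta>_nz \<delta>_conj add_eq_0_iff field_simps)
  then show ?thesis using card_trace_fiber[of 0] by (simp add: bij_betw_same_card)
qed

lemma rational_parts:
  obtains a b where "rational a" "rational b" "(x::'f) = a + b * \<delta>"
proof
  show "rational ((x + x ^ p) / 2)" by (simp add: add.commute)
  show "rational ((x - x ^ p) / (2 * \<delta>))" by (simp add: \<delta>_conj field_simps \<delta>_nz)
  show "x = (x + x ^ p) / 2 + (x - x ^ p) / (2 * \<delta>) * \<delta>"
    by (simp add: \<delta>_nz field_simps)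
qed

definition quartic_sum :: int where
  "quartic_sum = (\<Sum>y\<in>{y. rational y}. power_sign quarter_order (\<delta> * (y - \<delta>)))"

lemma range_embedding_eq_rational:
  fixes \<iota> :: "'k::{field,finite} \<Rightarrow> 'f"
  assumes "field_embedding \<iota>" "CARD('k) = p"
  shows "range \<iota> = {y. rational y}"
proof (rule card_subset_eq)
  interpret field_embedding \<iota> by (rule assms(1))
  show "range \<iota> \<subseteq> {y. rational y}"
    using power_CARD_eq[where 'a='k] assms(2) by (auto simp flip: \<iota>_power)
  show "card (range \<iota>) = card {y. rational y}"
    using card_image[OF \<iota>_inj] assms(2) card_rational by simp
qed simp

lemma quartic_sum_cases:
  fixes \<iota> :: "'k::{field,finite} \<Rightarrow> 'f" and a :: int
  assumes \<iota>: "field_embedding \<iota>" and card_k: "CARD('k) = p" and \<delta>_squared: "\<delta> ^ 2 = \<iota> d"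
    and p: "int p = 1 + 16 * a ^ 2"
  shows "quartic_sum \<in> {1, - 1}"
proof -
  interpret field_embedding \<iota> by (rule \<iota>)
  interpret J: field_card_1_mod_4 p "TYPE('k)" by unfold_locales (use card_k p_mod_4 in auto)
  note range = range_embedding_eq_rational[OF \<iota> card_k]
  then have rational_\<iota>: "rational (\<iota> x)" for x by auto
  have "\<nexists>y. y ^ 2 = d"
  proof
    assume "\<exists>y. y ^ 2 = d"
    then obtain y where "\<delta> ^ 2 = (\<iota> y) ^ 2" by (auto simp: \<delta>_squared \<iota>_power)
    then have "\<delta> = \<iota> y \<or> \<delta> = - \<iota> y" by (simp add: power2_eq_iff)
    then show False using \<delta>_not_rational rational_\<iota>[of y] by auto
  qed
  then have d: "J.chi d = - 1" using J.card_sqrt[of d] by simp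
  have "power_sign quarter_order (\<delta> * (\<iota> x - \<delta>))
      = power_sign ((p - 1) div 4) (d * (d - x ^ 2))" for x
  proof -
    have "(\<delta> * (\<iota> x - \<delta>)) ^ (p + 1) = \<delta> ^ 2 * (\<delta> ^ 2 - \<iota> x ^ 2)"
      unfolding power_p_plus_1
      by (simp add: \<delta>_conj rational_\<iota>) (simp add: power2_eq_square algebra_simps)
    also have "\<dots> = \<iota> (d * (d - x ^ 2))" by (simp add: \<delta>_squared \<iota>_mult \<iota>_diff \<iota>_power)
    finally show ?thesis unfolding quarter_order_eq power_sign_mult by (simp only: power_sign_\<iota>)
  qed
  then have "quartic_sum = (\<Sum>x\<in>UNIV. power_sign ((p - 1) div 4) (d * (d - x ^ 2)))"
    by (simp add: quartic_sum_def range[symmetric] sum.reindex[OF \<iota>_inj])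
  then have "2 * quartic_sum = J.jacobsthal (- 1)" using J.sum_power_sign_quarter[OF d] by simp
  then show ?thesis using J.jacobsthal_minus_1[OF prime_p p] by auto
qed

end

section \<open>Binary quadratic forms\<close>

text \<open>The triple \<open>(u\<^sub>0, u\<^sub>1, u\<^sub>2)\<close> stands for the polynomial \<open>u\<^sub>0 + 2 u\<^sub>1 t + u\<^sub>2 t\<^sup>2\<close>,
  on which \<open>GL\<^sub>2\<close> acts by substitution and \<open>bil\<close> is the polar form of the discriminant.\<close>

type_synonym 'a quad = "'a \<times> 'a \<times> 'a"

fun evalq :: "'a::comm_ring_1 quad \<Rightarrow> 'a \<Rightarrow> 'a" where
  "evalq (u0, u1, u2) t = u0 + 2 * u1 * t + u2 * t ^ 2"

fun scaleq :: "'a::comm_ring_1 \<Rightarrow> 'a quad \<Rightarrow> 'a quad" where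
  "scaleq c (u0, u1, u2) = (c * u0, c * u1, c * u2)"

fun bil :: "'a::comm_ring_1 quad \<Rightarrow> 'a quad \<Rightarrow> 'a" where
  "bil (f0, f1, f2) (g0, g1, g2) = f0 * g2 + f2 * g0 - 2 * f1 * g1"

fun cross :: "'a::comm_ring_1 quad \<Rightarrow> 'a quad \<Rightarrow> 'a quad" where
  "cross (f0, f1, f2) (g0, g1, g2)
      = (2 * (f0 * g1 - f1 * g0), f0 * g2 - f2 * g0, 2 * (f1 * g2 - f2 * g1))"

fun act :: "'a::comm_ring_1^2^2 \<Rightarrow> 'a quad \<Rightarrow> 'a quad" where
  "act A (w0, w1, w2) =
    ((A $ 1 $ 1) ^ 2 * w0 + 2 * A $ 1 $ 1 * A $ 1 $ 2 * w1 + (A $ 1 $ 2) ^ 2 * w2,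
     A $ 1 $ 1 * A $ 2 $ 1 * w0 + (A $ 1 $ 1 * A $ 2 $ 2 + A $ 1 $ 2 * A $ 2 $ 1) * w1
       + A $ 1 $ 2 * A $ 2 $ 2 * w2,
     (A $ 2 $ 1) ^ 2 * w0 + 2 * A $ 2 $ 1 * A $ 2 $ 2 * w1 + (A $ 2 $ 2) ^ 2 * w2)"

definition rot :: "'a::field^2^2 \<Rightarrow> 'a quad \<Rightarrow> 'a quad" where
  "rot A f = scaleq (inverse (det A)) (act A f)"

definition conic_pt :: "'a::comm_ring_1 \<Rightarrow> 'a quad" where
  "conic_pt t = (t ^ 2, - t, 1)"

definition monic_quad :: "'a::field \<Rightarrow> 'a \<Rightarrow> 'a quad" where
  "monic_quad t t' = (t * t', - ((t + t') / 2), 1)"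

lemma scaleq_simps [simp]:
  "scaleq c (scaleq d f) = scaleq (c * d) f" "scaleq 1 f = f" "scaleq 0 f = 0"
  "scaleq (- c) f = - scaleq c f"
  "scaleq c (- f) = - scaleq c f" "scaleq c 0 = 0"
  by (cases f; simp add: algebra_simps zero_prod_def)+

lemma scaleq_distrib:
  "scaleq c (f + g) = scaleq c f + scaleq c g"
  "scaleq (c + d) f = scaleq c f + scaleq d f"
  by (cases f; cases g; simp add: algebra_simps)+

lemma scaleq_eq_0_iff [simp]: "scaleq c f = 0 \<longleftrightarrow> c = 0 \<or> f = 0" for c :: "'a::idom"
  by (cases f) (auto simp: zero_prod_def)

lemma scaleq_cancel_right [simp]: "f \<noteq> 0 \<Longrightarrow> scaleq c f = scaleq d f \<longleftrightarrow> c = d" for c :: "'a::idom"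
  by (cases f) (auto simp: zero_prod_def)

lemma scaleq_cancel_left [simp]: "c \<noteq> 0 \<Longrightarrow> scaleq c f = scaleq c g \<longleftrightarrow> f = g" for c :: "'a::idom"
  by (cases f; cases g) auto

lemma evalq_linear [simp]:
  "evalq (scaleq c f) t = c * evalq f t" "evalq (f + g) t = evalq f t + evalq g t"
  "evalq (- f) t = - evalq f t"
  by (cases f; cases g; simp add: algebra_simps)+

lemma bil_commute: "bil f g = bil g f"
  by (cases f; cases g) (simp add: algebra_simps)

lemma bil_linear [simp]:
  "bil (scaleq c f) g = c * bil f g" "bil f (scaleq c g) = c * bil f g"
  "bil (f + f') g = bil f g + bil f' g" "bil f (g + g') = bil f g + bil f g'"
  "bil (- f) g = - bil f g" "bil f (- g) = - bil f g"
  by (cases f; cases g; cases f'; cases g'; simp add: algebra_simps)+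

lemma cross_linear [simp]:
  "cross (scaleq c f) g = scaleq c (cross f g)" "cross f (scaleq c g) = scaleq c (cross f g)"
  "cross f (g + g') = cross f g + cross f g'" "cross f (- g) = - cross f g" "cross f f = 0"
  by (cases f; cases g; cases g'; simp add: algebra_simps zero_prod_def)+

lemma bil_cross_self [simp]: "bil (cross f g) f = 0" "bil (cross f g) g = 0"
  by (cases f; cases g; simp add: algebra_simps)+

lemma bil_conic_pt: "bil f (conic_pt t) = evalq f t"
  by (cases f) (simp add: conic_pt_def algebra_simps)

lemma bil_conic_pt_self: "bil (conic_pt t) (conic_pt t) = 0"
  by (simp add: conic_pt_def power2_eq_square)

lemma monic_quad_commute: "monic_quad t t' = monic_quad t' t"
  by (simp add: monic_quad_def mult.commute add.commute)

lemma evalq_monic_quad: "(2::'a::field) \<noteq> 0 \<Longrightarrow> evalq (monic_quad t t') (x::'a) = (x - t) * (x - t')"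
  by (simp add: monic_quad_def field_simps power2_eq_square)

lemma bil_monic_quad:
  "(2::'a::field) \<noteq> 0 \<Longrightarrow>
    2 * bil (monic_quad t t') (monic_quad s s') = (t - s) * (t' - s') + (t - s') * (t' - (s::'a))"
proof -
  assume "(2::'a) \<noteq> 0"
  define h k where "h = (t + t') / 2" and "k = (s + s') / 2"
  have "2 * h = t + t'" "2 * k = s + s'" using \<open>2 \<noteq> 0\<close> by (simp_all add: h_def k_def)
  moreover have "2 * bil (monic_quad t t') (monic_quad s s')
      = 2 * (t * t' + s * s') - (2 * h) * (2 * k)"
    by (simp add: monic_quad_def algebra_simps flip: h_def k_def)
  ultimately show ?thesis by (simp add: algebra_simps)
qed

lemma act_linear [simp]:
  "act A (scaleq k f) = scaleq k (act A f)" "act A (f + g) = act A f + act A g"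
  by (cases f; cases g; simp add: algebra_simps)+

lemma bil_act: "bil (act A f) (act A g) = (det A) ^ 2 * bil f g"
  by (cases f; cases g) (simp add: det_2 algebra_simps power2_eq_square)

lemma cross_act: "cross (act A f) (act A g) = scaleq (det A) (act A (cross f g))"
  by (cases f; cases g) (simp add: det_2 algebra_simps power2_eq_square)

lemma act_act: "act A (act B f) = act (A ** B) f"
  by (cases f) (simp add: matrix_matrix_mult_def sum_2 algebra_simps power2_eq_square)

lemma act_mat: "act (mat c) f = scaleq (c ^ 2) f"
  by (cases f) (simp add: mat_def power2_eq_square)

lemma det_mat_2: "det (mat c :: 'a::comm_ring_1^2^2) = c ^ 2"
  by (simp add: det_2 mat_def power2_eq_square)

lemma rot_linear [simp]:
  "rot A (scaleq k f) = scaleq k (rot A f)"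
  "rot A (f + g) = rot A f + rot A g"
  by (simp_all add: rot_def scaleq_distrib mult.commute)

lemma rot_rot: "rot A (rot B f) = rot (A ** B) f"
  by (simp add: rot_def act_act det_mul mult.commute)

lemma rot_mat: "c \<noteq> 0 \<Longrightarrow> rot (mat c) f = f"
  by (simp add: rot_def act_mat det_mat_2)

lemma bil_rot: "det A \<noteq> 0 \<Longrightarrow> bil (rot A f) (rot A g) = bil f g"
  by (simp add: rot_def bil_act power2_eq_square field_simps)

lemma cross_rot: "det A \<noteq> 0 \<Longrightarrow> cross (rot A f) (rot A g) = rot A (cross f g)"
  by (simp add: rot_def cross_act field_simps)

definition adjugate_2 :: "'a::comm_ring_1^2^2 \<Rightarrow> 'a^2^2" where
  "adjugate_2 A = vector [vector [A $ 2 $ 2, - A $ 1 $ 2], vector [- A $ 2 $ 1, A $ 1 $ 1]]"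

lemma det_adjugate_2: "det (adjugate_2 A) = det A"
  by (simp add: det_2 adjugate_2_def mult.commute)

lemma adjugate_2_mult: "adjugate_2 A ** A = mat (det A)" "A ** adjugate_2 A = mat (det A)"
  by (simp_all add: vec_eq_iff forall_2 matrix_matrix_mult_def sum_2 adjugate_2_def mat_def det_2
      mult.commute)

lemma rot_adjugate_2 [simp]:
  assumes "det A \<noteq> 0"
  shows "rot (adjugate_2 A) (rot A f) = f" "rot A (rot (adjugate_2 A) f) = f"
  by (simp_all add: rot_rot adjugate_2_mult rot_mat assms)

lemma rot_eq_iff [simp]: "det A \<noteq> 0 \<Longrightarrow> rot A f = rot A g \<longleftrightarrow> f = g"
  by (metis rot_adjugate_2(1))

lemma rot_eq_0_iff [simp]: "det A \<noteq> 0 \<Longrightarrow> rot A f = 0 \<longleftrightarrow> f = 0"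
  by (metis rot_eq_iff rot_linear(1) scaleq_simps(3))

definition mobius_denom :: "'a::field^2^2 \<Rightarrow> 'a \<Rightarrow> 'a" where
  "mobius_denom A t = A $ 1 $ 1 + A $ 2 $ 1 * t"

definition mobius :: "'a::field^2^2 \<Rightarrow> 'a \<Rightarrow> 'a" where
  "mobius A t = (A $ 1 $ 2 + A $ 2 $ 2 * t) / mobius_denom A t"

lemma evalq_act:
  assumes "mobius_denom A t \<noteq> 0"
  shows "evalq (act A f) t = (mobius_denom A t) ^ 2 * evalq f (mobius A t)"
proof (cases f)
  case (fields f0 f1 f2)
  define K N where "K = mobius_denom A t" and "N = A $ 1 $ 2 + A $ 2 $ 2 * t"
  have N: "N = mobius A t * K" using assms by (simp add: mobius_def K_def N_def)
  have "evalq (act A f) t = f0 * K ^ 2 + 2 * f1 * K * N + f2 * N ^ 2"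
    unfolding fields act.simps evalq.simps K_def N_def mobius_denom_def by Groebner_Basis.algebra
  also have "\<dots> = K ^ 2 * evalq f (mobius A t)"
    unfolding fields evalq.simps N by Groebner_Basis.algebra
  finally show ?thesis by (simp add: K_def)
qed

lemma mobius_diff:
  assumes "mobius_denom A t \<noteq> 0" "mobius_denom A t' \<noteq> 0"
  shows "mobius_denom A t * mobius_denom A t' * (mobius A t' - mobius A t) = det A * (t' - t)"
proof -
  have "mobius_denom A t * mobius_denom A t' * (mobius A t' - mobius A t)
      = mobius_denom A t * (A $ 1 $ 2 + A $ 2 $ 2 * t')
        - mobius_denom A t' * (A $ 1 $ 2 + A $ 2 $ 2 * t)"
    using assms by (simp add: mobius_def field_simps)
  also have "\<dots> = det A * (t' - t)" by (simp add: mobius_denom_def det_2 algebra_simps)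
  finally show ?thesis .
qed

lemma triple_product_gram:
  fixes w :: "'a::idom quad"
  shows "bil (cross u u') w * bil (cross u' u) w' =
    2 * (bil w w' * (bil u u' * bil u u' - bil u u * bil u' u')
       - bil w u' * (bil u w' * bil u u' - bil u u * bil u' w')
       + bil w u * (bil u w' * bil u' u' - bil u u' * bil u' w'))"
proof -
  obtain u0 u1 u2 where u: "u = (u0, u1, u2)" by (cases u)
  obtain v0 v1 v2 where v: "u' = (v0, v1, v2)" by (cases u')
  obtain w0 w1 w2 where w: "w = (w0, w1, w2)" by (cases w)
  obtain x0 x1 x2 where x: "w' = (x0, x1, x2)" by (cases w')
  show ?thesis unfolding u v w x bil.simps cross.simps by Groebner_Basis.algebra
qed

text \<open>Moving \<open>T\<close> to infinity and \<open>S\<close> to zero turns the hypotheses into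
  \<open>w\<^sub>0 w'\<^sub>2 = 2 w\<^sub>1 w'\<^sub>1\<close>, so that only one term of \<open>bil w w'\<close> survives.\<close>

lemma evalq_product:
  fixes T S :: "'a::field"
  assumes roots: "evalq u T = 0" "evalq u' S = 0"
    and orthogonal: "bil u u' = 0" "bil w u' = 0" "bil w' u = 0"
    and "evalq u S \<noteq> 0" "evalq u' T \<noteq> 0"
  shows "evalq w T * evalq w' S = bil w w' * (T - S) ^ 2"
proof -
  obtain u0 u1 u2 where u: "u = (u0, u1, u2)" by (cases u)
  obtain v0 v1 v2 where v: "u' = (v0, v1, v2)" by (cases u')
  obtain w0 w1 w2 where w: "w = (w0, w1, w2)" by (cases w)
  obtain x0 x1 x2 where x: "w' = (x0, x1, x2)" by (cases w')
  have u0: "u0 = - 2 * u1 * T - u2 * T ^ 2"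
    using roots(1) unfolding u evalq.simps by Groebner_Basis.algebra
  have v0: "v0 = - 2 * v1 * S - v2 * S ^ 2"
    using roots(2) unfolding v evalq.simps by Groebner_Basis.algebra
  let ?W = "w0 + w1 * (T + S) + w2 * T * S" and ?X = "x0 + x1 * (T + S) + x2 * T * S"
  let ?V = "v0 + v1 * (T + S) + v2 * T * S"
  have "(bil w w' * (T - S) ^ 2 - evalq w T * evalq w' S) * (evalq u S * evalq u' T)
      = (T - S) ^ 2 * (bil w u' * (evalq w' T * evalq u S)
          + 2 * ?W * ?V * bil w' u - 2 * ?W * ?X * bil u u')"
    unfolding u v w x bil.simps evalq.simps u0 v0 by Groebner_Basis.algebra
  then show ?thesis using assms by simp
qed

lemma orthogonal_common_root:
  fixes u w h :: "'a::field quad"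
  assumes monic: "snd (snd u) = 1" "snd (snd w) = 1" and "u \<noteq> w"
    and roots: "evalq u y = 0" "evalq w y = 0" and orthogonal: "bil u h = 0" "bil w h = 0"
    and two_nz: "(2::'a) \<noteq> 0"
  obtains k where "h = scaleq k (conic_pt y)"
proof -
  obtain u0 u1 where u: "u = (u0, u1, 1)" using monic(1) by (cases u) auto
  obtain w0 w1 where w: "w = (w0, w1, 1)" using monic(2) by (cases w) auto
  obtain h0 h1 h2 where h: "h = (h0, h1, h2)" by (cases h)
  have u0: "u0 = - 2 * u1 * y - y ^ 2"
    using roots(1) unfolding u evalq.simps by Groebner_Basis.algebra
  have w0: "w0 = - 2 * w1 * y - y ^ 2"
    using roots(2) unfolding w evalq.simps by Groebner_Basis.algebra
  have "2 * (u1 - w1) * (h1 + y * h2) = bil w h - bil u h"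
    unfolding u w h bil.simps u0 w0 by Groebner_Basis.algebra
  moreover have "u1 \<noteq> w1" using \<open>u \<noteq> w\<close> by (auto simp: u w u0 w0)
  ultimately have h1: "h1 = - (y * h2)" using orthogonal two_nz by (simp add: eq_neg_iff_add_eq_0)
  have "h0 - y ^ 2 * h2 = bil u h"
    unfolding u h bil.simps u0 h1 by Groebner_Basis.algebra
  then have "h = scaleq h2 (conic_pt y)"
    using orthogonal(1) by (simp add: h h1 conic_pt_def mult.commute)
  then show thesis by (rule that)
qed

fun embq :: "'a::field quad \<Rightarrow> 'a alg_closure quad" where
  "embq (u0, u1, u2) = (to_ac u0, to_ac u1, to_ac u2)"

lemma embq_simps [simp]:
  "embq (scaleq c f) = scaleq (to_ac c) (embq f)" "embq (f + g) = embq f + embq g"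
  "embq (- f) = - embq f"
  by (cases f; cases g; simp)+

lemma bil_embq [simp]: "bil (embq f) (embq g) = to_ac (bil f g)"
  by (cases f; cases g) simp

lemma evalq_embq_to_ac: "evalq (embq f) (to_ac y) = to_ac (evalq f y)"
  by (cases f) simp

lemma embq_act: "embq (act A f) = act (map_matrix to_ac A) (embq f)"
  by (cases f) simp

lemma det_map_matrix_to_ac: "det (map_matrix to_ac A :: 'a::field alg_closure^2^2) = to_ac (det A)"
  by (simp add: det_2)

section \<open>Flags of the Hermitian curve\<close>

locale hermitian_quads = quadratic_extension p \<delta> for p :: nat and \<delta> :: "'f::{field,finite}" +
  fixes \<kappa> \<kappa>' :: 'f
  assumes \<kappa>_squared: "\<kappa> ^ 2 = - 2" and \<kappa>'_squared: "\<kappa>' ^ 2 = - 2"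
begin

lemma \<kappa>_nz [simp]: "\<kappa> \<noteq> 0" and \<kappa>'_nz [simp]: "\<kappa>' \<noteq> 0"
  using \<kappa>_squared \<kappa>'_squared by (metis neg_equal_0_iff_equal power_zero_numeral two_nz)+

fun frobq :: "'f quad \<Rightarrow> 'f quad" where
  "frobq (u0, u1, u2) = (u0 ^ p, u1 ^ p, u2 ^ p)"

abbreviation herm :: "'f quad \<Rightarrow> 'f quad \<Rightarrow> 'f" where
  "herm f g \<equiv> bil f (frobq g)"

abbreviation rational_matrix :: "'f^2^2 \<Rightarrow> bool" where
  "rational_matrix A \<equiv> \<forall>i j. rational (A $ i $ j)"

lemma frobq_simps [simp]:
  "frobq (frobq f) = f" "frobq (scaleq c f) = scaleq (c ^ p) (frobq f)"
  "frobq (f + g) = frobq f + frobq g" "frobq (- f) = - frobq f" "frobq 0 = 0"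
  by (cases f; cases g; simp add: zero_prod_def)+

lemma bil_frobq: "bil (frobq f) (frobq g) = (bil f g) ^ p"
  by (cases f; cases g) simp

lemma cross_frobq: "cross (frobq f) (frobq g) = frobq (cross f g)"
  by (cases f; cases g) simp

lemma herm_conj: "herm f g = (herm g f) ^ p"
  using bil_frobq[of g "frobq f"] bil_commute[of f] by (simp only: frobq_simps)

lemma evalq_embq_frobq: "evalq (embq (frobq f)) (t ^ p) = (evalq (embq f) t) ^ p"
  by (cases f) simp

lemma embq_frobq_monic_quad:
  "embq u = monic_quad t t' \<Longrightarrow> embq (frobq u) = monic_quad (t ^ p) (t' ^ p)"
  by (cases u) (simp add: monic_quad_def)

lemma rational_det: "rational_matrix A \<Longrightarrow> rational (det A)"
  by (simp add: det_2)

lemma frobq_rot: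
  assumes "rational_matrix A"
  shows "frobq (rot A f) = rot A (frobq f)"
proof -
  have "frobq (act A f) = act A (frobq f)" using assms by (cases f) simp
  then show ?thesis by (simp add: rot_def power_inverse rational_det[OF assms])
qed

lemma herm_rot: "rational_matrix A \<Longrightarrow> det A \<noteq> 0 \<Longrightarrow> herm (rot A f) (rot A g) = herm f g"
  by (simp add: frobq_rot bil_rot)

definition isotropic :: "'f quad \<Rightarrow> bool" where
  "isotropic u \<longleftrightarrow> u \<noteq> 0 \<and> herm u u = 0"

text \<open>The vectors \<open>(0, u)\<close> and \<open>(1, w)\<close> of a flag span a generator, see \<open>gen_line_generator\<close>.\<close>

definition flag :: "'f quad \<Rightarrow> 'f quad \<Rightarrow> bool" where
  "flag u w \<longleftrightarrow> isotropic u \<and> herm u w = 0 \<and> herm w w = 1"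

lemma flagD:
  assumes "flag u w"
  shows "u \<noteq> 0" "isotropic u" "herm u u = 0" "herm u w = 0" "herm w u = 0" "herm w w = 1"
proof -
  show "herm w u = 0" using assms by (simp only: herm_conj[of w u] flag_def frob_zero)
qed (use assms in \<open>auto simp: flag_def isotropic_def\<close>)

lemma isotropic_infinity: "isotropic (1, 0, 0)"
  by (simp add: isotropic_def zero_prod_def)

lemma isotropic_scaleq: "c \<noteq> 0 \<Longrightarrow> isotropic (scaleq c u) \<longleftrightarrow> isotropic u"
  by (simp add: isotropic_def)

lemma isotropic_rot: "rational_matrix A \<Longrightarrow> det A \<noteq> 0 \<Longrightarrow> isotropic (rot A u) \<longleftrightarrow> isotropic u"
  by (simp add: isotropic_def herm_rot)

lemma flag_scaleq: "c \<noteq> 0 \<Longrightarrow> flag (scaleq c u) w \<longleftrightarrow> flag u w"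
  by (simp add: flag_def isotropic_scaleq)

lemma flag_add: "flag u w \<Longrightarrow> flag u (w + scaleq c u)"
  by (frule flagD(5)) (simp add: flag_def isotropic_def)

lemma flag_norm_one: "l * l ^ p = 1 \<Longrightarrow> flag u w \<Longrightarrow> flag u (scaleq l w)"
  by (auto simp: flag_def mult.commute)

lemma flag_minus: "flag u w \<Longrightarrow> flag u (- w)"
  by (simp add: flag_def)

lemma flag_rot: "rational_matrix A \<Longrightarrow> det A \<noteq> 0 \<Longrightarrow> flag (rot A u) (rot A w) \<longleftrightarrow> flag u w"
  by (simp add: flag_def isotropic_rot herm_rot)

lemma isotropic_conic_cases:
  assumes "isotropic u" "bil u u = 0"
  obtains (infinity) c where "c \<noteq> 0" "u = scaleq c (1, 0, 0)"
    | (affine) c t where "c \<noteq> 0" "rational t" "u = scaleq c (conic_pt t)"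
proof -
  obtain u0 u1 u2 where u: "u = (u0, u1, u2)" by (cases u)
  have "2 * (u0 * u2 - u1 ^ 2) = 0" using assms(2) by (simp add: u algebra_simps power2_eq_square)
  then have u1: "u1 ^ 2 = u0 * u2" by simp
  show thesis
  proof (cases "u2 = 0")
    case True
    then have "u = scaleq u0 (1, 0, 0)" using u1 by (simp add: u)
    then show thesis
      using that(1)[of u0] assms(1) by (cases "u0 = 0") (auto simp: isotropic_def zero_prod_def)
  next
    case False
    define t where "t = - u1 / u2"
    have eq: "u = scaleq u2 (conic_pt t)"
      using u1 False by (simp add: u t_def conic_pt_def power_divide power2_eq_square)
    have "u2 * u2 ^ p * (t - t ^ p) ^ 2 = herm u u"
      unfolding eq conic_pt_def by (simp add: algebra_simps power2_eq_square)
    then have "rational t" using assms(1) False by (simp add: isotropic_def)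
    then show thesis using that(2)[OF False _ eq] by blast
  qed
qed

lemma conic_pt_to_infinity:
  assumes "isotropic u" "bil u u = 0"
  obtains A c where "rational_matrix A" "det A = 1" "c \<noteq> 0" "rot A u = scaleq c (1, 0, 0)"
  using assms
proof (cases rule: isotropic_conic_cases)
  case (infinity c)
  show thesis
  proof (rule that)
    show "rational_matrix (mat 1)" by (simp add: mat_def)
    show "rot (mat 1) u = scaleq c (1, 0, 0)" using infinity(2) by (simp add: rot_mat)
  qed (use infinity(1) in simp_all)
next
  case (affine c t)
  define A :: "'f^2^2" where "A = vector [vector [0, - 1], vector [1, t]]"
  have A: "A $ 1 $ 1 = 0" "A $ 1 $ 2 = - 1" "A $ 2 $ 1 = 1" "A $ 2 $ 2 = t" by (simp_all add: A_def)
  show thesis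
  proof (rule that)
    show "rational_matrix A" using affine(2) by (simp add: forall_2 A)
    show "det A = 1" by (simp add: det_2 A)
    then show "rot A u = scaleq c (1, 0, 0)"
      unfolding affine(3) by (simp add: rot_def conic_pt_def A power2_eq_square)
  qed (rule affine(1))
qed

lemma conic_eigenvalue:
  assumes flag: "flag u w" and "bil u u = 0"
  obtains \<nu> where "cross u w = scaleq \<nu> u" "\<nu> * \<nu> ^ p = - 2"
proof -
  obtain A c where A: "rational_matrix A" "det A = 1" and "c \<noteq> 0"
    and infinity: "rot A u = scaleq c (1, 0, 0)"
    by (rule conic_pt_to_infinity[OF flagD(2)[OF flag] assms(2)])
  have det: "det A \<noteq> 0" using A(2) by simp
  obtain w0 w1 w2 where w: "rot A w = (w0, w1, w2)" by (cases "rot A w")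
  have "flag (1, 0, 0) (w0, w1, w2)"
    using flag flag_rot[OF A(1) det, of u w] flag_scaleq[OF \<open>c \<noteq> 0\<close>] unfolding infinity w by blast
  then have "w2 = 0" "- 2 * (w1 * w1 ^ p) = 1"
    using flagD[of "(1, 0, 0)" "(w0, w1, w2)"] by (simp_all add: mult.assoc)
  moreover have "(2 * w1) * (2 * w1) ^ p = - 2 * (- 2 * (w1 * w1 ^ p))" by simp
  ultimately have "(2 * w1) * (2 * w1) ^ p = - 2" by simp
  moreover have "rot A (cross u w) = rot A (scaleq (2 * w1) u)"
    unfolding cross_rot[OF det, symmetric] rot_linear infinity w by (simp add: \<open>w2 = 0\<close>)
  then have "cross u w = scaleq (2 * w1) u" unfolding rot_eq_iff[OF det] .
  ultimately show thesis using that by blast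
qed

lemma norm_minus_2_power_m:
  fixes k :: 'f
  assumes "\<nu> * \<nu> ^ p = - 2" "k ^ 2 = - 2"
  shows "\<nu> ^ m = k \<or> \<nu> ^ m = - k"
proof -
  have "(\<nu> ^ m) ^ 2 = k ^ 2" using assms power_m_squared[of \<nu>] by simp
  then show ?thesis by (simp add: power2_eq_iff)
qed

definition conj_triple :: "'f quad \<Rightarrow> 'f quad \<Rightarrow> 'f" where
  "conj_triple u w = bil (cross u (frobq u)) w"

lemma conj_triple_scaleq: "conj_triple (scaleq c u) w = c * c ^ p * conj_triple u w"
  by (simp add: conj_triple_def mult.commute)

lemma conj_triple_rot:
  "rational_matrix A \<Longrightarrow> det A \<noteq> 0 \<Longrightarrow> conj_triple (rot A u) (rot A w) = conj_triple u w"
  by (simp add: conj_triple_def frobq_rot cross_rot bil_rot)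

lemma conj_triple_norm:
  assumes "flag u w"
  shows "conj_triple u w * conj_triple u w ^ p = - 2 * (bil u u * bil u u ^ p)"
proof -
  have "conj_triple u w ^ p = bil (cross (frobq u) u) (frobq w)"
    using bil_frobq[of "cross u (frobq u)" w] cross_frobq[of u "frobq u"]
    by (simp add: conj_triple_def)
  then show ?thesis
    using triple_product_gram[of u "frobq u" w "frobq w"] flagD[OF assms] bil_frobq[of u u]
    by (simp add: conj_triple_def)
qed

lemma conj_triple_power_m:
  assumes "flag u w" "bil u u ^ half_order = 1"
  shows "conj_triple u w ^ m = \<kappa> * bil u u ^ (m ^ 2)
    \<or> conj_triple u w ^ m = - (\<kappa> * bil u u ^ (m ^ 2))"
proof -
  let ?b = "bil u u"
  have "(?b ^ (m ^ 2)) ^ 2 = ?b ^ half_order * ?b ^ (p + 1)"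
    by (simp only: power_mult[symmetric] mult.commute[of _ 2] two_m_squared power_add)
  then have "(\<kappa> * ?b ^ (m ^ 2)) ^ 2 = - 2 * (?b * ?b ^ p)"
    using assms(2) \<kappa>_squared by (simp add: power_mult_distrib)
  then have "(conj_triple u w ^ m) ^ 2 = (\<kappa> * ?b ^ (m ^ 2)) ^ 2"
    using conj_triple_norm[OF assms(1)] by (simp add: power_m_squared)
  then show ?thesis by (simp add: power2_eq_iff)
qed

lemma monic_quad_roots_exist:
  fixes u :: "'f quad"
  assumes "snd (snd u) = 1"
  obtains t t' where "embq u = monic_quad t t'"
proof -
  obtain u0 u1 where u: "u = (u0, u1, 1)" using assms by (cases u) auto
  obtain s where s: "s ^ 2 = to_ac (u1 ^ 2 - u0)"
    using nth_root_exists[of 2 "to_ac (u1 ^ 2 - u0)"] by auto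
  then have "to_ac u0 = to_ac u1 ^ 2 - s ^ 2" by simp
  then have "embq u = monic_quad (- to_ac u1 + s) (- to_ac u1 - s)"
    by (simp add: u monic_quad_def power2_eq_square algebra_simps)
  then show thesis by (rule that)
qed

lemma discriminant_roots:
  fixes u :: "'f quad"
  assumes "embq u = monic_quad t t'"
  shows "2 * to_ac (bil u u) = - ((t - t') ^ 2)"
  using bil_monic_quad[OF two_ac_nz, of t t' t t'] unfolding assms[symmetric] bil_embq
  by (simp add: power2_eq_square algebra_simps)

lemma isotropic_roots_product:
  assumes "isotropic u" "embq u = monic_quad t t'"
  shows "(t - t ^ p) * (t' - t' ^ p) = (t - t' ^ p) * (t ^ p - t')"
proof -
  have "(t - t ^ p) * (t' - t' ^ p) + (t - t' ^ p) * (t' - t ^ p) = 2 * to_ac (herm u u)"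
    using bil_monic_quad[OF two_ac_nz, of t t' "t ^ p" "t' ^ p"]
    unfolding assms(2)[symmetric] embq_frobq_monic_quad[OF assms(2), symmetric] bil_embq by simp
  then show ?thesis using assms(1) by (simp add: isotropic_def algebra_simps)
qed

lemma isotropic_roots_distinct:
  assumes iso: "isotropic u" and "bil u u \<noteq> 0" and roots: "embq u = monic_quad t t'"
  shows "t \<noteq> t'" "t ^ p \<noteq> t" "t' ^ p \<noteq> t'" "t ^ p \<noteq> t'" "t' ^ p \<noteq> t"
proof -
  note product = isotropic_roots_product[OF iso roots]
  show distinct: "t \<noteq> t'" using discriminant_roots[OF roots] assms(2) by auto
  show "t ^ p \<noteq> t"
  proof
    assume "t ^ p = t"
    then have "t = t' ^ p \<or> t = t'" using product by auto
    then show False using distinct \<open>t ^ p = t\<close> by (metis frob_inj_ac)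
  qed
  moreover show "t' ^ p \<noteq> t'"
  proof
    assume "t' ^ p = t'"
    then have "t = t' \<or> t ^ p = t'" using product by auto
    then show False using distinct \<open>t' ^ p = t'\<close> by (metis frob_inj_ac)
  qed
  ultimately show "t ^ p \<noteq> t'" "t' ^ p \<noteq> t" using product by auto
qed

lemma flag_eval_roots:
  assumes flag: "flag u w" and "bil u u \<noteq> 0" and roots: "embq u = monic_quad t t'" and "s \<in> {t, t'}"
  shows "evalq (embq w) t * (evalq (embq w) s) ^ p = (t - s ^ p) ^ 2"
proof -
  note D = flagD[OF flag]
  note distinct = isotropic_roots_distinct[OF D(2) assms(2) roots]
  note conj_roots = embq_frobq_monic_quad[OF roots]
  have "evalq (embq w) t * evalq (embq (frobq w)) (s ^ p)
      = bil (embq w) (embq (frobq w)) * (t - s ^ p) ^ 2"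
  proof (rule evalq_product[where u = "embq u" and u' = "embq (frobq u)"])
    show "evalq (embq u) t = 0" by (simp add: roots evalq_monic_quad)
    show "evalq (embq (frobq u)) (s ^ p) = 0"
      using \<open>s \<in> {t, t'}\<close> by (auto simp: conj_roots evalq_monic_quad)
    show "evalq (embq u) (s ^ p) \<noteq> 0"
      using \<open>s \<in> {t, t'}\<close> distinct by (auto simp: roots evalq_monic_quad)
    show "evalq (embq (frobq u)) t \<noteq> 0" using distinct by (auto simp: conj_roots evalq_monic_quad)
    show "bil (embq (frobq w)) (embq u) = 0" using D(4) by (simp add: bil_commute)
  qed (use D in simp_all)
  then show ?thesis using D(6) by (simp add: evalq_embq_frobq)
qed

lemma flag_eval_root_power_m:
  assumes "flag u w" "bil u u \<noteq> 0" "embq u = monic_quad t t'"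
  shows "(evalq (embq w) t) ^ m = t ^ p - t \<or> (evalq (embq w) t) ^ m = - (t ^ p - t)"
proof -
  have "((evalq (embq w) t) ^ m) ^ 2 = (t ^ p - t) ^ 2"
    using flag_eval_roots[OF assms, of t] by (simp add: power_m_squared power2_commute[of t])
  then show ?thesis by (simp add: power2_eq_iff)
qed

lemma root_frob_frob:
  fixes u :: "'f quad"
  assumes "bil u u \<noteq> 0" and roots: "embq u = monic_quad t t'"
  shows "(t ^ p) ^ p = (if bil u u ^ half_order = 1 then t else t')"
proof -
  let ?b = "bil u u"
  have "embq (frobq (frobq u)) = monic_quad ((t ^ p) ^ p) ((t' ^ p) ^ p)"
    by (intro embq_frobq_monic_quad roots)
  then have sum: "(t ^ p) ^ p + (t' ^ p) ^ p = t + t'" by (simp add: roots monic_quad_def)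
  have "(t - t') ^ (p * p) = (t - t') * ((t - t') ^ 2) ^ half_order"
  proof -
    have "p * p = 1 + 2 * half_order"
      using CARD_minus_1_eq_half_order mult_pos_pos[of p p] p_gt unfolding card_f power2_eq_square
      by linarith
    then show ?thesis by (simp add: power_mult)
  qed
  also have "(t - t') ^ 2 = to_ac (- 2 * ?b)" using discriminant_roots[OF roots] by simp
  also have "to_ac (- 2 * ?b) ^ half_order = to_ac (?b ^ half_order)"
    using rational_power_half_order[of "- 2"] unfolding to_ac_power[symmetric] power_mult_distrib
    by simp
  finally have diff: "(t ^ p) ^ p - (t' ^ p) ^ p = (t - t') * to_ac (?b ^ half_order)"
    by (simp add: power_mult)
  have "2 * (t ^ p) ^ p = (t + t') + (t - t') * to_ac (?b ^ half_order)"
    unfolding sum[symmetric] diff[symmetric] by simp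
  also have "\<dots> = 2 * (if ?b ^ half_order = 1 then t else t')"
    using power_half_order_cases[OF assms(1)] by (auto simp del: to_ac_power)
  finally show ?thesis using mult_left_cancel[OF two_ac_nz] by blast
qed

lemma real_roots_opposite:
  assumes flag: "flag u w" and "bil u u \<noteq> 0" and real: "bil u u ^ half_order = 1"
    and roots: "embq u = monic_quad t t'" and power_m: "(evalq (embq w) t) ^ m = e * (t ^ p - t)"
  shows "(evalq (embq w) t') ^ m = - e * (t' ^ p - t')"
proof -
  let ?v = "evalq (embq w) t" and ?v' = "evalq (embq w) t'"
  let ?a = "t - t ^ p" and ?a' = "t' - t' ^ p" and ?z = "t - t' ^ p"
  have roots': "embq u = monic_quad t' t" using roots by (simp only: monic_quad_commute[of t' t])
  have frob_frob: "(t' ^ p) ^ p = t'" using root_frob_frob[OF assms(2) roots'] real by simp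
  have "?v * (?v' * ?v' ^ p) = ?v' * (?v * ?v' ^ p)" by (simp only: mult_ac)
  then have "?v * ?a' ^ 2 = ?v' * ?z ^ 2"
    using flag_eval_roots[OF flag assms(2) roots, of t']
      flag_eval_roots[OF flag assms(2) roots', of t'] by simp
  then have "?v ^ m * (?a' ^ 2) ^ m = ?v' ^ m * (?z ^ 2) ^ m"
    by (metis power_mult_distrib)
  moreover have "(?a' ^ 2) ^ m = - (?a' * ?a')"
    unfolding square_power_m by (simp add: frob_frob algebra_simps)
  moreover have "(?z ^ 2) ^ m = ?a * ?a'"
    unfolding square_power_m using isotropic_roots_product[OF flagD(2)[OF flag] roots]
    by (simp add: frob_frob)
  moreover have "?v ^ m = - e * ?a" using power_m by (simp add: algebra_simps)
  ultimately have "(?a * ?a') * (e * ?a') = (?a * ?a') * ?v' ^ m" by (simp add: mult_ac)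
  moreover have "?a * ?a' \<noteq> 0"
    using isotropic_roots_distinct[OF flagD(2)[OF flag] assms(2) roots] by auto
  ultimately have "e * ?a' = ?v' ^ m" using mult_left_cancel[of "?a * ?a'"] by blast
  then show ?thesis by (simp add: algebra_simps)
qed

lemma imaginary_roots_agree:
  fixes u :: "'f quad"
  assumes "bil u u \<noteq> 0" "bil u u ^ half_order \<noteq> 1" and roots: "embq u = monic_quad t t'"
    and power_m: "(evalq (embq w) t) ^ m = t ^ p - t"
  shows "(evalq (embq w) t') ^ m = t' ^ p - t'"
proof -
  have t': "(t ^ p) ^ p = t'" using root_frob_frob[OF assms(1) roots] assms(2) by simp
  have "evalq (embq w) t' = (evalq (embq w) t ^ p) ^ p"
    using evalq_embq_frobq[of w t] evalq_embq_frobq[of "frobq w" "t ^ p"] t' by simp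
  then have "evalq (embq w) t' ^ m = ((evalq (embq w) t ^ m) ^ p) ^ p"
    by (simp only: power_mult[symmetric] mult_ac)
  also have "\<dots> = t' ^ p - t'" using power_m t' by simp
  finally show ?thesis .
qed

section \<open>The sign of a flag\<close>

text \<open>The point \<open>u\<close> of the Hermitian curve lies on the conic if \<open>bil u u = 0\<close>, and otherwise
  \<open>bil u u ^ half_order\<close> tells whether the roots of \<open>u\<close> lie in the field. If they do not, the sign
  says on which of the two curves \<open>x ^ m = \<plusminus>(t ^ p - t)\<close> the roots of \<open>u\<close> lie, where \<open>x = w(t)\<close>.\<close>

definition real_pt :: "'f quad \<Rightarrow> bool" where
  "real_pt u \<longleftrightarrow> bil u u = 0 \<or> bil u u ^ half_order = 1"

definition positive :: "'f quad \<Rightarrow> 'f quad \<Rightarrow> bool" where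
  "positive u w \<longleftrightarrow>
    (if bil u u = 0 then \<exists>\<nu>. cross u w = scaleq \<nu> u \<and> \<nu> ^ m = \<kappa>'
     else if bil u u ^ half_order = 1 then conj_triple u w ^ m = \<kappa> * bil u u ^ (m ^ 2)
     else \<forall>t. evalq (embq u) t = 0 \<longrightarrow> evalq (embq w) t ^ m = t ^ p - t)"

lemma real_pt_scaleq: "c \<noteq> 0 \<Longrightarrow> real_pt (scaleq c u) \<longleftrightarrow> real_pt u"
  using square_power_half_order[of c] by (simp add: real_pt_def power_mult_distrib flip: mult.assoc)

lemma real_pt_rot: "det A \<noteq> 0 \<Longrightarrow> real_pt (rot A u) \<longleftrightarrow> real_pt u"
  by (simp add: real_pt_def bil_rot)

lemma positive_scaleq:
  assumes "c \<noteq> 0" shows "positive (scaleq c u) w \<longleftrightarrow> positive u w"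
proof -
  have "cross (scaleq c u) w = scaleq \<nu> (scaleq c u) \<longleftrightarrow> cross u w = scaleq \<nu> u" for \<nu>
    using scaleq_cancel_left[OF assms, of "cross u w" "scaleq \<nu> u"] by (simp add: mult.commute)
  moreover have "conj_triple (scaleq c u) w ^ m = \<kappa> * bil (scaleq c u) (scaleq c u) ^ (m ^ 2)
      \<longleftrightarrow> conj_triple u w ^ m = \<kappa> * bil u u ^ (m ^ 2)"
  proof -
    have "conj_triple (scaleq c u) w ^ m = (c * c) ^ (m ^ 2) * conj_triple u w ^ m"
      by (simp only: conj_triple_scaleq power_mult_distrib[of "c * c ^ p"] norm_power_m)
    moreover have "bil (scaleq c u) (scaleq c u) ^ (m ^ 2) = (c * c) ^ (m ^ 2) * bil u u ^ (m ^ 2)"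
      by (simp add: power_mult_distrib)
    ultimately show ?thesis using assms by (auto simp: mult.left_commute)
  qed
  ultimately show ?thesis
    using assms square_power_half_order[OF assms] unfolding positive_def
    by (simp add: power_mult_distrib flip: mult.assoc)
qed

lemma positive_add: "positive u (w + scaleq c u) \<longleftrightarrow> positive u w"
  by (simp add: positive_def conj_triple_def cong: conj_cong)

lemma positive_torsion_imp:
  assumes "l ^ m = 1" and "positive u w" shows "positive u (scaleq l w)"
proof -
  have "\<exists>\<mu>. scaleq l (scaleq \<nu> u) = scaleq \<mu> u \<and> \<mu> ^ m = \<nu> ^ m" for \<nu>
    by (rule exI[of _ "l * \<nu>"]) (simp add: power_mult_distrib assms(1))
  then show ?thesis using assms
    by (auto simp: positive_def conj_triple_def power_mult_distrib
        simp flip: to_ac_power split: if_splits)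
qed

lemma positive_torsion:
  assumes "l ^ m = 1" shows "positive u (scaleq l w) \<longleftrightarrow> positive u w"
proof
  assume "positive u (scaleq l w)"
  then have "positive u (scaleq (inverse l) (scaleq l w))"
    by (rule positive_torsion_imp[rotated]) (simp add: assms power_inverse)
  then show "positive u w" using m_torsion_nz[OF assms] by simp
qed (rule positive_torsion_imp[OF assms])

lemma imaginary_multiple_of_monic:
  assumes "isotropic u" "\<not> real_pt u"
  obtains c u' where "c \<noteq> 0" "u = scaleq c u'" "snd (snd u') = 1" "isotropic u'" "\<not> real_pt u'"
proof -
  obtain u0 u1 u2 where u: "u = (u0, u1, u2)" by (cases u)
  have "u2 \<noteq> 0" using assms by (auto simp: u isotropic_def real_pt_def)
  then have multiple: "u = scaleq u2 (u0 / u2, u1 / u2, 1)" by (simp add: u)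
  then have "isotropic (u0 / u2, u1 / u2, 1)" "\<not> real_pt (u0 / u2, u1 / u2, 1)"
    using assms isotropic_scaleq[OF \<open>u2 \<noteq> 0\<close>] real_pt_scaleq[OF \<open>u2 \<noteq> 0\<close>] by metis+
  then show thesis using that[OF \<open>u2 \<noteq> 0\<close> multiple] by simp
qed

lemma imaginary_positive_iff:
  assumes "\<not> real_pt u" and roots: "embq u = monic_quad t t'"
  shows "positive u w \<longleftrightarrow> evalq (embq w) t ^ m = t ^ p - t"
proof
  have imaginary: "bil u u \<noteq> 0" "bil u u ^ half_order \<noteq> 1"
    using assms(1) by (auto simp: real_pt_def)
  assume "evalq (embq w) t ^ m = t ^ p - t"
  moreover from this have "evalq (embq w) t' ^ m = t' ^ p - t'"
    by (rule imaginary_roots_agree[OF imaginary roots])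
  ultimately show "positive u w"
    using imaginary by (auto simp: positive_def roots evalq_monic_quad)
next
  assume "positive u w"
  then show "evalq (embq w) t ^ m = t ^ p - t"
    using assms(1) by (simp add: positive_def real_pt_def roots evalq_monic_quad)
qed

lemma positive_minus_conic:
  assumes flag: "flag u w" and "bil u u = 0"
  shows "positive u (- w) \<longleftrightarrow> \<not> positive u w"
proof -
  obtain \<nu> where \<nu>: "cross u w = scaleq \<nu> u" "\<nu> * \<nu> ^ p = - 2" by (rule conic_eigenvalue[OF assms])
  have "- scaleq \<nu> u = scaleq \<mu> u \<longleftrightarrow> \<mu> = - \<nu>" for \<mu>
    using scaleq_cancel_right[OF flagD(1)[OF flag], of "- \<nu>" \<mu>] by auto
  then have "positive u (- w) \<longleftrightarrow> - (\<nu> ^ m) = \<kappa>'"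
    using assms(2) \<nu>(1) odd_m by (simp add: positive_def)
  moreover have "positive u w \<longleftrightarrow> \<nu> ^ m = \<kappa>'"
    using assms(2) \<nu>(1) flagD(1)[OF flag] by (auto simp: positive_def)
  ultimately show ?thesis
    using norm_minus_2_power_m[OF \<nu>(2) \<kappa>'_squared] \<kappa>'_nz
    by (metis add.inverse_inverse eq_minus_self_iff)
qed

lemma positive_minus_imaginary:
  assumes flag: "flag u w" and imaginary: "\<not> real_pt u"
  shows "positive u (- w) \<longleftrightarrow> \<not> positive u w"
proof -
  obtain c u' where "c \<noteq> 0" and multiple: "u = scaleq c u'" and monic: "snd (snd u') = 1"
    and iso': "isotropic u'" and imaginary': "\<not> real_pt u'"
    by (rule imaginary_multiple_of_monic[OF flagD(2)[OF flag] imaginary])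
  have flag': "flag u' w" using flag flag_scaleq[OF \<open>c \<noteq> 0\<close>] unfolding multiple by blast
  have nonconic: "bil u' u' \<noteq> 0" using imaginary' by (auto simp: real_pt_def)
  obtain t t' where roots: "embq u' = monic_quad t t'" by (rule monic_quad_roots_exist[OF monic])
  have "t ^ p - t \<noteq> 0" using isotropic_roots_distinct(2)[OF iso' nonconic roots] by simp
  then have "t ^ p - t \<noteq> - (t ^ p - t)" by (simp only: eq_minus_self_iff_ac not_False_eq_True)
  moreover have "evalq (embq (- w)) t ^ m = - (evalq (embq w) t ^ m)" using odd_m by simp
  ultimately have "positive u' (- w) \<longleftrightarrow> \<not> positive u' w"
    unfolding imaginary_positive_iff[OF imaginary' roots]
    using flag_eval_root_power_m[OF flag' nonconic roots] by (metis add.inverse_inverse)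
  then show ?thesis unfolding multiple positive_scaleq[OF \<open>c \<noteq> 0\<close>] .
qed

lemma positive_minus:
  assumes flag: "flag u w" shows "positive u (- w) \<longleftrightarrow> \<not> positive u w"
proof -
  consider (conic) "bil u u = 0"
    | (split) "bil u u \<noteq> 0" "bil u u ^ half_order = 1"
    | (imaginary) "\<not> real_pt u"
    by (auto simp: real_pt_def)
  then show ?thesis
  proof cases
    case conic
    then show ?thesis by (rule positive_minus_conic[OF flag])
  next
    case split
    have "\<kappa> * bil u u ^ (m ^ 2) \<noteq> 0" using split by simp
    moreover have "conj_triple u (- w) ^ m = - (conj_triple u w ^ m)"
      using odd_m by (simp add: conj_triple_def)
    ultimately show ?thesis using split conj_triple_power_m[OF flag split(2)] unfolding positive_def
      by (auto simp del: mult_eq_0_iff)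
  next
    case imaginary
    then show ?thesis by (rule positive_minus_imaginary[OF flag])
  qed
qed

lemma positive_rot_real:
  assumes "rational_matrix A" "det A \<noteq> 0" "real_pt u"
  shows "positive (rot A u) (rot A w) \<longleftrightarrow> positive u w"
proof -
  have eigenvalue: "rot A (cross u w) = scaleq \<nu> (rot A u) \<longleftrightarrow> cross u w = scaleq \<nu> u" for \<nu>
    using rot_eq_iff[OF assms(2), of "cross u w" "scaleq \<nu> u"] by simp
  show ?thesis using assms(3)
    unfolding positive_def real_pt_def cross_rot[OF assms(2)] bil_rot[OF assms(2)]
      conj_triple_rot[OF assms(1,2)] eigenvalue by auto
qed

lemma imaginary_no_rational_root:
  assumes "isotropic u" "\<not> real_pt u"
  shows "evalq u y \<noteq> 0"
proof
  assume root: "evalq u y = 0"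
  obtain c u' where "c \<noteq> 0" and multiple: "u = scaleq c u'" and monic: "snd (snd u') = 1"
    and iso': "isotropic u'" and imaginary': "\<not> real_pt u'"
    by (rule imaginary_multiple_of_monic[OF assms])
  have nonconic: "bil u' u' \<noteq> 0" "bil u' u' ^ half_order \<noteq> 1"
    using imaginary' by (auto simp: real_pt_def)
  obtain t t' where roots: "embq u' = monic_quad t t'" by (rule monic_quad_roots_exist[OF monic])
  then have roots': "embq u' = monic_quad t' t" by (simp only: monic_quad_commute[of t' t])
  have "evalq (embq u') (to_ac y) = 0" using root \<open>c \<noteq> 0\<close> by (simp add: multiple evalq_embq_to_ac)
  then have "to_ac y = t \<or> to_ac y = t'" by (simp add: roots evalq_monic_quad)
  moreover have "t \<noteq> t'" by (rule isotropic_roots_distinct[OF iso' nonconic(1) roots])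
  ultimately show False
    using root_frob_frob[OF nonconic(1) roots] root_frob_frob[OF nonconic(1) roots'] nonconic(2)
      to_ac_frob_frob[of y] by auto
qed

lemma imaginary_root_not_fixed:
  assumes "isotropic u" "\<not> real_pt u" and root: "evalq (embq u) t = 0"
  shows "t ^ p \<noteq> t"
proof -
  obtain c u' where "c \<noteq> 0" and multiple: "u = scaleq c u'" and monic: "snd (snd u') = 1"
    and iso': "isotropic u'" and imaginary': "\<not> real_pt u'"
    by (rule imaginary_multiple_of_monic[OF assms(1,2)])
  obtain s s' where roots: "embq u' = monic_quad s s'" by (rule monic_quad_roots_exist[OF monic])
  have "t = s \<or> t = s'" using root \<open>c \<noteq> 0\<close> by (simp add: multiple roots evalq_monic_quad)
  moreover have "bil u' u' \<noteq> 0" using imaginary' by (auto simp: real_pt_def)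
  ultimately show ?thesis using isotropic_roots_distinct(2,3)[OF iso' _ roots] by blast
qed

lemma mobius_denom_neq_0:
  assumes rational: "rational_matrix A" and det: "det A \<noteq> 0" and t: "t ^ p \<noteq> t"
  shows "mobius_denom (map_matrix to_ac A) t \<noteq> 0"
proof
  assume denom: "mobius_denom (map_matrix to_ac A) t = 0"
  show False
  proof (cases "A $ 2 $ 1 = 0")
    case True
    then show False using denom det by (simp add: mobius_denom_def det_2)
  next
    case False
    then have t_eq: "t = - to_ac (A $ 1 $ 1) / to_ac (A $ 2 $ 1)"
      using denom by (simp add: mobius_denom_def field_simps add_eq_0_iff)
    have "to_ac (A $ i $ j) ^ p = to_ac (A $ i $ j)" for i j
      using rational by (simp flip: to_ac_power)
    then show False using t t_eq by simp
  qed
qed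

lemma positive_rot_imaginary:
  assumes A: "rational_matrix A" "det A = 1" and "isotropic u"
    and imaginary: "\<not> real_pt u" and "positive u w"
  shows "positive (rot A u) (rot A w)"
proof -
  let ?A = "map_matrix to_ac A :: 'f alg_closure^2^2"
  have imaginary': "\<not> real_pt (rot A u)" using imaginary A(2) by (simp add: real_pt_rot)
  have iso': "isotropic (rot A u)" using \<open>isotropic u\<close> A by (simp add: isotropic_rot)
  have embq_rot: "embq (rot A f) = act ?A (embq f)" for f
    by (simp add: rot_def A(2) embq_act)
  have A_frob: "to_ac (A $ i $ j) ^ p = to_ac (A $ i $ j)" for i j
    using A(1) by (simp flip: to_ac_power)
  have "evalq (embq (rot A w)) t ^ m = t ^ p - t" if root: "evalq (embq (rot A u)) t = 0" for t
  proof -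
    define K s where "K = mobius_denom ?A t" and "s = mobius ?A t"
    have t: "t ^ p \<noteq> t" by (rule imaginary_root_not_fixed[OF iso' imaginary' root])
    have "K \<noteq> 0"
      unfolding K_def by (rule mobius_denom_neq_0[OF A(1) _ t]) (simp add: A(2))
    have K_frob: "K ^ p = mobius_denom ?A (t ^ p)" by (simp add: K_def mobius_denom_def A_frob)
    then have s_frob: "s ^ p = mobius ?A (t ^ p)" by (simp add: s_def mobius_def A_frob flip: K_def)
    have eval: "evalq (embq (rot A f)) t = K ^ 2 * evalq (embq f) s" for f
      unfolding embq_rot using evalq_act[of ?A t] \<open>K \<noteq> 0\<close> by (simp add: K_def s_def)
    then have "evalq (embq u) s = 0" using root \<open>K \<noteq> 0\<close> by simp
    then have "evalq (embq w) s ^ m = s ^ p - s"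
      using \<open>positive u w\<close> imaginary by (simp add: positive_def real_pt_def)
    then have "evalq (embq (rot A w)) t ^ m = K * K ^ p * (s ^ p - s)"
      unfolding eval power_mult_distrib square_power_m by simp
    also have "\<dots> = t ^ p - t"
      using mobius_diff[of ?A t "t ^ p"] \<open>K \<noteq> 0\<close> A(2)
      by (simp add: det_map_matrix_to_ac flip: K_frob s_frob K_def s_def)
    finally show ?thesis .
  qed
  then show ?thesis using imaginary' unfolding positive_def real_pt_def by auto
qed

lemma positive_rot:
  assumes "rational_matrix A" "det A = 1" "flag u w" "positive u w"
  shows "positive (rot A u) (rot A w)"
  using positive_rot_real[of A u w] positive_rot_imaginary[of A u w] flagD(2)[of u w] assms
  by (cases "real_pt u") auto

section \<open>Points of the Hermitian curve on a line\<close>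

text \<open>Every point of the Hermitian curve has a unique representative in \<open>curve_pts\<close>.\<close>

definition curve_pts :: "'f quad set" where
  "curve_pts = {u. isotropic u \<and> (snd (snd u) = 1 \<or> u = (1, 0, 0))}"

definition normalize_pt :: "'f quad \<Rightarrow> 'f quad" where
  "normalize_pt u = scaleq (inverse (if snd (snd u) = 0 then fst u else snd (snd u))) u"

lemma normalize_pt_multiple:
  assumes "isotropic u"
  obtains c where "c \<noteq> 0" "normalize_pt u = scaleq c u"
proof
  let ?c = "inverse (if snd (snd u) = 0 then fst u else snd (snd u))"
  show "normalize_pt u = scaleq ?c u" by (simp add: normalize_pt_def)
  show "?c \<noteq> 0" using assms by (cases u) (auto simp: isotropic_def zero_prod_def)
qed

lemma normalize_pt_curve: "isotropic u \<Longrightarrow> normalize_pt u \<in> curve_pts"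
proof -
  assume iso: "isotropic u"
  then obtain c where "c \<noteq> 0" "normalize_pt u = scaleq c u" by (rule normalize_pt_multiple)
  then have "isotropic (normalize_pt u)" using iso by (simp add: isotropic_scaleq)
  then show ?thesis using iso
    by (cases u) (auto simp: curve_pts_def normalize_pt_def isotropic_def zero_prod_def)
qed

lemma normalize_pt_scaleq: "c \<noteq> 0 \<Longrightarrow> isotropic u \<Longrightarrow> normalize_pt (scaleq c u) = normalize_pt u"
  by (cases u) (auto simp: normalize_pt_def isotropic_def zero_prod_def field_simps)

lemma normalize_pt_id: "u \<in> curve_pts \<Longrightarrow> normalize_pt u = u"
  by (cases u) (auto simp: curve_pts_def normalize_pt_def)

lemma curve_pts_multiple_eq:
  assumes "u \<in> curve_pts" "u' \<in> curve_pts" "u' = scaleq c u"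
  shows "u' = u"
proof -
  have "c \<noteq> 0" "isotropic u" using assms by (auto simp: curve_pts_def isotropic_def)
  then show ?thesis using assms normalize_pt_scaleq normalize_pt_id by metis
qed

lemma normalize_rot_inverse:
  assumes "u \<in> curve_pts" "isotropic (rot B u)" "\<And>f. rot A (rot B f) = f"
  shows "normalize_pt (rot A (normalize_pt (rot B u))) = u"
proof -
  obtain c where "c \<noteq> 0" "normalize_pt (rot B u) = scaleq c (rot B u)"
    by (rule normalize_pt_multiple[OF assms(2)])
  then show ?thesis
    using assms(1,3) by (simp add: normalize_pt_scaleq normalize_pt_id curve_pts_def)
qed

lemma card_curve_pts: "card curve_pts = p ^ 3 + 1"
proof -
  let ?f = "\<lambda>(x::'f, y::'f). (y, x, 1::'f)"
  let ?S = "SIGMA x:UNIV. {y::'f. y + y ^ p = 2 * (x * x ^ p)}"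
  have "u \<in> curve_pts \<longleftrightarrow> u \<in> insert (1, 0, 0) (?f ` ?S)" for u
    using isotropic_infinity
    by (cases u) (auto simp: curve_pts_def isotropic_def zero_prod_def mult.assoc)
  then have curve: "curve_pts = insert (1, 0, 0) (?f ` ?S)" by blast
  have "card {y::'f. y + y ^ p = 2 * (x * x ^ p)} = p" for x
    by (rule card_trace_fiber) (simp add: mult.commute)
  then have "card ?S = p ^ 3" by (simp add: card_f power2_eq_square power3_eq_cube)
  moreover have "inj_on ?f ?S" by (auto simp: inj_on_def)
  moreover have "(1, 0, 0) \<notin> ?f ` ?S" by auto
  ultimately show ?thesis unfolding curve card_insert_disjoint[OF finite \<open>(1, 0, 0) \<notin> ?f ` ?S\<close>]
    by (simp add: card_image)
qed

definition polar_pts :: "'f quad \<Rightarrow> 'f quad set" where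
  "polar_pts v = {u \<in> curve_pts. herm u v = 0}"

definition affine_polar_pts :: "'f quad \<Rightarrow> 'f quad set" where
  "affine_polar_pts v = {u \<in> polar_pts v. snd (snd u) = 1}"

lemma polar_pts_flag: "herm v v = 1 \<Longrightarrow> u \<in> polar_pts v \<Longrightarrow> flag u v"
  by (simp add: polar_pts_def curve_pts_def flag_def)

lemma polar_pts_minus: "polar_pts (- v) = polar_pts v"
  by (simp add: polar_pts_def)

lemma affine_polar_pts_flag: "herm v v = 1 \<Longrightarrow> u \<in> affine_polar_pts v \<Longrightarrow> flag u v"
  by (simp add: affine_polar_pts_def polar_pts_flag)

lemma imaginary_polar_pts_affine: "u \<in> polar_pts v \<Longrightarrow> \<not> real_pt u \<Longrightarrow> u \<in> affine_polar_pts v"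
  by (auto simp: affine_polar_pts_def polar_pts_def curve_pts_def real_pt_def)

lemma affine_polar_pts_iff:
  "(u0, u1, u2) \<in> affine_polar_pts (v0, v1, v2) \<longleftrightarrow>
    u2 = 1 \<and> u0 + u0 ^ p = 2 * (u1 * u1 ^ p) \<and> u0 * v2 ^ p + v0 ^ p = 2 * (u1 * v1 ^ p)"
  by (auto simp: affine_polar_pts_def polar_pts_def curve_pts_def isotropic_def zero_prod_def mult.assoc)

lemma polar_pts_eq:
  "polar_pts (v0, v1, v2) =
    (if v2 = 0 then insert (1, 0, 0) (affine_polar_pts (v0, v1, v2))
     else affine_polar_pts (v0, v1, v2))"
  using isotropic_infinity by (auto simp: affine_polar_pts_def polar_pts_def curve_pts_def)

lemma infinity_not_affine: "(1, 0, 0) \<notin> affine_polar_pts v"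
  by (simp add: affine_polar_pts_def)

lemma card_affine_polar_pts_infinity:
  assumes "herm (v0, v1, 0) (v0, v1, 0) = 1"
  shows "card (affine_polar_pts (v0, v1, 0)) = p"
proof -
  have "v1 \<noteq> 0" using assms by auto
  define b where "b = v0 ^ p / (2 * v1 ^ p)"
  have "v0 ^ p = 2 * (u1 * v1 ^ p) \<longleftrightarrow> u1 = b" for u1
    using \<open>v1 \<noteq> 0\<close> by (auto simp: b_def field_simps)
  then have "(u0, u1, u2) \<in> affine_polar_pts (v0, v1, 0)
      \<longleftrightarrow> u2 = 1 \<and> u1 = b \<and> u0 + u0 ^ p = 2 * (b * b ^ p)"
    for u0 u1 u2
    by (auto simp: affine_polar_pts_iff)
  then have "bij_betw (\<lambda>x. (x, b, 1))
      {x. x + x ^ p = 2 * (b * b ^ p)} (affine_polar_pts (v0, v1, 0))"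
    by (intro bij_betw_byWitness[where f' = fst]) auto
  then show ?thesis
    using bij_betw_same_card card_trace_fiber[of "2 * (b * b ^ p)"]
    by (fastforce simp: mult.commute)
qed

lemma card_affine_polar_pts_finite:
  assumes norm: "herm (v0, v1, v2) (v0, v1, v2) = 1" and "v2 \<noteq> 0"
  shows "card (affine_polar_pts (v0, v1, v2)) = p + 1"
proof -
  define c e k where "c = v1 ^ p / v2 ^ p" and "e = v0 ^ p / v2 ^ p"
    and "k = - 1 / (2 * (v2 * v2 ^ p))"
  have k: "k = c * c ^ p - (e + e ^ p) / 2"
  proof -
    have "k = - herm (v0, v1, v2) (v0, v1, v2) / (2 * (v2 * v2 ^ p))" by (simp only: norm k_def)
    then show ?thesis unfolding c_def e_def using \<open>v2 \<noteq> 0\<close> by (simp add: field_simps)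
  qed
  have iff: "(u0, u1, u2) \<in> affine_polar_pts (v0, v1, v2) \<longleftrightarrow>
      u2 = 1 \<and> u0 = 2 * (c * u1) - e \<and> (u1 - c ^ p) * (u1 - c ^ p) ^ p = k" for u0 u1 u2
  proof -
    have "u0 * v2 ^ p + v0 ^ p = 2 * (u1 * v1 ^ p) \<longleftrightarrow> u0 = 2 * (c * u1) - e"
      using \<open>v2 \<noteq> 0\<close> by (auto simp: c_def e_def field_simps)
    moreover have "u0 + u0 ^ p = 2 * (u1 * u1 ^ p) \<longleftrightarrow> (u1 - c ^ p) * (u1 - c ^ p) ^ p = k"
      if "u0 = 2 * (c * u1) - e"
    proof -
      have "2 * ((u1 - c ^ p) * (u1 - c ^ p) ^ p - k) = 2 * (u1 * u1 ^ p) - (u0 + u0 ^ p)"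
        unfolding that k by (simp add: algebra_simps)
      then show ?thesis by (metis eq_iff_diff_eq_0 mult_eq_0_iff two_nz)
    qed
    ultimately show ?thesis unfolding affine_polar_pts_iff by blast
  qed
  have "bij_betw (\<lambda>x. (2 * (c * (x + c ^ p)) - e, x + c ^ p, 1)) {x. x * x ^ p = k}
      (affine_polar_pts (v0, v1, v2))"
    by (rule bij_betw_byWitness[where f' = "\<lambda>u. fst (snd u) - c ^ p"]) (auto simp: iff)
  moreover have "k \<noteq> 0" "rational k" using \<open>v2 \<noteq> 0\<close> by (simp_all add: k_def mult.commute)
  ultimately show ?thesis
    using bij_betw_same_card card_norm_fiber[of k] by fastforce
qed

lemma card_affine_polar_pts:
  assumes "herm v v = 1"
  shows "card (affine_polar_pts v) = (if snd (snd v) = 0 then p else p + 1)"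
  using assms card_affine_polar_pts_infinity card_affine_polar_pts_finite by (cases v) auto

lemma card_polar_pts:
  assumes "herm v v = 1"
  shows "card (polar_pts v) = p + 1"
proof (cases v)
  case (fields v0 v1 v2)
  then show ?thesis
    using card_affine_polar_pts[OF assms]
    by (auto simp: polar_pts_eq card_insert_disjoint[OF finite infinity_not_affine])
qed

definition flag_sign :: "'f quad \<Rightarrow> 'f quad \<Rightarrow> int" where
  "flag_sign u w = (if positive u w then 1 else - 1)"

lemma flag_sign_minus: "flag u w \<Longrightarrow> flag_sign u (- w) = - flag_sign u w"
  by (simp add: flag_sign_def positive_minus)

section \<open>Imaginary points\<close>

text \<open>Since \<open>v(t) ^ m - (t ^ p - t)\<close> has degree \<open>p + 1\<close>, or \<open>p\<close> if \<open>v\<close> is linear, the curve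
  \<open>x ^ m = t ^ p - t\<close> has at most as many points with \<open>x = v(t)\<close> as there are points \<open>u\<close> on the polar
  line of \<open>v\<close>, and each of these has one or two roots among these points unless it is imaginary
  and negative.\<close>

definition curve_section :: "'f quad \<Rightarrow> 'f alg_closure set" where
  "curve_section v = {t. evalq (embq v) t ^ m = t ^ p - t}"

definition section_roots :: "'f quad \<Rightarrow> 'f quad \<Rightarrow> 'f alg_closure set" where
  "section_roots v u = {t \<in> curve_section v. evalq (embq u) t = 0}"

lemma finite_card_curve_section:
  "finite (curve_section (v0, v1, v2)) \<and>
    card (curve_section (v0, v1, v2)) \<le> (if v2 = 0 then p else p + 1)"
proof -
  let ?v = "(v0, v1, v2)"
  define V where "V = [:to_ac v0, 2 * to_ac v1, to_ac v2:]"
  have poly_V: "poly V t = evalq (embq ?v) t" for t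
    by (simp add: V_def algebra_simps power2_eq_square)
  show ?thesis
  proof (cases "v2 = 0")
    case True
    define g where "g = Polynomial.monom 1 1 + V ^ m"
    have "Polynomial.degree V \<le> 1" by (simp add: V_def True)
    then have "Polynomial.degree (V ^ m) \<le> m"
      using order_trans[OF degree_power_le mult_le_mono1[of "Polynomial.degree V" 1 m]] by simp
    then have "Polynomial.degree g < p"
      using two_m p_gt unfolding g_def
      by (intro degree_add_less le_less_trans[OF degree_monom_le]) simp_all
    moreover have "curve_section ?v = {t. t ^ p = poly g t}"
      by (auto simp: curve_section_def g_def poly_V poly_monom)
    ultimately show ?thesis
      using True finite_power_eq_poly[of g p] card_power_eq_poly_le[of g p] by simp
  next
    case False
    define f where "f = V ^ m - (Polynomial.monom 1 p - Polynomial.monom 1 1)"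
    have "V \<noteq> 0" "Polynomial.degree V = 2" by (simp_all add: V_def False)
    then have degree_V: "Polynomial.degree (V ^ m) = p + 1"
      using two_m by (simp add: degree_power_eq mult.commute)
    have "Polynomial.coeff f (p + 1) = Polynomial.lead_coeff (V ^ m)"
      using degree_V p_gt by (simp add: f_def)
    also have "\<dots> \<noteq> 0" by (simp add: V_def False)
    finally have "f \<noteq> 0" by auto
    moreover have "Polynomial.degree f \<le> p + 1"
      unfolding f_def using degree_V p_gt by (intro degree_diff_le) (auto simp: degree_monom_eq)
    moreover have "curve_section ?v = {t. poly f t = 0}"
      by (simp add: curve_section_def f_def poly_V poly_monom)
    ultimately show ?thesis using False card_poly_roots_bound[of f] poly_roots_finite[of f] by simp
  qed
qed

lemma
  assumes "herm v v = 1"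
  shows finite_curve_section: "finite (curve_section v)"
    and card_curve_section_le: "card (curve_section v) \<le> card (affine_polar_pts v)"
proof -
  obtain v0 v1 v2 where v: "v = (v0, v1, v2)" by (cases v)
  show "finite (curve_section v)" "card (curve_section v) \<le> card (affine_polar_pts v)"
    using finite_card_curve_section[of v0 v1 v2] card_affine_polar_pts[OF assms]
    by (simp_all add: v)
qed

lemma finite_section_roots: "herm v v = 1 \<Longrightarrow> finite (section_roots v u)"
  using finite_curve_section by (simp add: section_roots_def)

lemma common_root_imp_no_imaginary:
  assumes norm: "herm v v = 1" and polar: "u \<in> affine_polar_pts v" "w \<in> affine_polar_pts v" "u \<noteq> w"
    and roots: "evalq (embq u) t = 0" "evalq (embq w) t = 0" and x: "x \<in> polar_pts v"
  shows "real_pt x"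
proof -
  obtain u0 u1 where u: "u = (u0, u1, 1)"
    using polar(1) by (cases u) (auto simp: affine_polar_pts_def)
  obtain w0 w1 where w: "w = (w0, w1, 1)"
    using polar(2) by (cases w) (auto simp: affine_polar_pts_def)
  have "to_ac (u0 - w0) + 2 * to_ac (u1 - w1) * t = evalq (embq u) t - evalq (embq w) t"
    by (simp add: u w algebra_simps)
  then have diff: "to_ac (u0 - w0) + 2 * to_ac (u1 - w1) * t = 0" unfolding roots by simp
  then have "u1 \<noteq> w1" using polar(3) by (auto simp: u w)
  define y where "y = - ((u0 - w0) / (2 * (u1 - w1)))"
  have "2 * to_ac (u1 - w1) \<noteq> 0" using \<open>u1 \<noteq> w1\<close> by simp
  then have t: "t = to_ac y"
    using diff unfolding y_def by (simp add: field_simps add_eq_0_iff)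
  have "evalq u y = 0" "evalq w y = 0"
    using roots unfolding t evalq_embq_to_ac to_ac_eq_0_iff by simp_all
  moreover have "herm u v = 0" "herm w v = 0"
    using polar by (simp_all add: affine_polar_pts_def polar_pts_def)
  ultimately obtain k where k: "frobq v = scaleq k (conic_pt y)"
    using orthogonal_common_root[of u w y "frobq v"] polar(3) two_nz unfolding u w by auto
  have "k \<noteq> 0" using norm k by auto
  have "k * evalq x y = herm x v" by (simp add: k bil_conic_pt)
  then have "evalq x y = 0" using x \<open>k \<noteq> 0\<close> by (simp add: polar_pts_def)
  then show ?thesis
    using imaginary_no_rational_root[of x y] x by (auto simp: polar_pts_def curve_pts_def)
qed

lemma section_roots_conic_nonempty:
  assumes flag: "flag u v" and "bil u u = 0" "snd (snd u) = 1"
  shows "section_roots v u \<noteq> {}"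
  using flagD(2)[OF flag] assms(2)
proof (cases rule: isotropic_conic_cases)
  case (infinity c)
  then show ?thesis using assms(3) by simp
next
  case (affine c t)
  then have u: "u = conic_pt t" using assms(3) by (simp add: conic_pt_def)
  have "frobq u = u" using affine(2) by (simp add: u conic_pt_def)
  then have "evalq v t = 0" using flagD(5)[OF flag] by (simp add: u bil_conic_pt)
  then have "to_ac t \<in> curve_section v"
    using affine(2) m_pos
    by (simp add: curve_section_def evalq_embq_to_ac power_0_left flip: to_ac_power)
  moreover have "evalq u t = 0" using bil_conic_pt_self[of t] by (simp add: u bil_conic_pt)
  ultimately have "to_ac t \<in> section_roots v u" by (simp add: section_roots_def evalq_embq_to_ac)
  then show ?thesis by blast
qed

lemma section_roots_split_nonempty:
  assumes flag: "flag u v" and nonconic: "bil u u \<noteq> 0" and split: "bil u u ^ half_order = 1"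
    and monic: "snd (snd u) = 1"
  shows "section_roots v u \<noteq> {}"
proof -
  obtain t t' where roots: "embq u = monic_quad t t'" by (rule monic_quad_roots_exist[OF monic])
  consider (positive) "evalq (embq v) t ^ m = t ^ p - t"
    | (negative) "evalq (embq v) t ^ m = (- 1) * (t ^ p - t)"
    using flag_eval_root_power_m[OF flag nonconic roots] by auto
  then have "t \<in> section_roots v u \<or> t' \<in> section_roots v u"
  proof cases
    case positive
    then show ?thesis by (simp add: section_roots_def curve_section_def roots evalq_monic_quad)
  next
    case negative
    then have "evalq (embq v) t' ^ m = - (- 1) * (t' ^ p - t')"
      by (rule real_roots_opposite[OF flag nonconic split roots])
    then show ?thesis by (simp add: section_roots_def curve_section_def roots evalq_monic_quad)
  qed
  then show ?thesis by blast
qed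

lemma card_section_roots_imaginary:
  assumes norm: "herm v v = 1" and "isotropic u" and imaginary: "\<not> real_pt u" and "positive u v"
    and monic: "snd (snd u) = 1"
  shows "card (section_roots v u) \<ge> 2"
proof -
  obtain t t' where roots: "embq u = monic_quad t t'" by (rule monic_quad_roots_exist[OF monic])
  have "bil u u \<noteq> 0" using imaginary by (auto simp: real_pt_def)
  then have "t \<noteq> t'" by (rule isotropic_roots_distinct[OF \<open>isotropic u\<close> _ roots])
  moreover have "{t, t'} \<subseteq> section_roots v u"
    using \<open>positive u v\<close> imaginary
    by (auto simp: section_roots_def curve_section_def positive_def real_pt_def roots evalq_monic_quad)
  ultimately show ?thesis using card_mono[OF finite_section_roots[OF norm], of "{t, t'}" u] by simp
qed

lemma card_section_roots_ge:
  assumes norm: "herm v v = 1" and u: "u \<in> affine_polar_pts v"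
  shows "int (card (section_roots v u)) \<ge> 1 + of_bool (\<not> real_pt u) * flag_sign u v"
proof -
  have flag: "flag u v" and monic: "snd (snd u) = 1"
    using affine_polar_pts_flag[OF norm u] u by (auto simp: affine_polar_pts_def)
  show ?thesis
  proof (cases "real_pt u")
    case True
    then have "section_roots v u \<noteq> {}"
      using section_roots_conic_nonempty[OF flag _ monic]
        section_roots_split_nonempty[OF flag _ _ monic]
      unfolding real_pt_def by blast
    then have "card (section_roots v u) > 0"
      using finite_section_roots[OF norm] by (simp add: card_gt_0_iff)
    then show ?thesis using True by simp
  next
    case False
    then show ?thesis
      using card_section_roots_imaginary[OF norm flagD(2)[OF flag] False _ monic]
      by (simp add: flag_sign_def)
  qed
qed

lemma sum_card_section_roots_le:
  assumes norm: "herm v v = 1" and "u \<in> polar_pts v" "\<not> real_pt u"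
  shows "(\<Sum>u\<in>affine_polar_pts v. card (section_roots v u)) \<le> card (affine_polar_pts v)"
proof -
  have disjoint: "section_roots v a \<inter> section_roots v b = {}"
    if "a \<in> affine_polar_pts v" "b \<in> affine_polar_pts v" "a \<noteq> b" for a b
  proof (rule equals0I)
    fix t assume "t \<in> section_roots v a \<inter> section_roots v b"
    then have "real_pt u"
      by (intro common_root_imp_no_imaginary[OF norm that _ _ assms(2), of t])
        (simp_all add: section_roots_def)
    then show False using assms(3) by simp
  qed
  have "(\<Sum>u\<in>affine_polar_pts v. card (section_roots v u))
      = card (\<Union>u\<in>affine_polar_pts v. section_roots v u)"
    by (rule card_UN_disjoint[symmetric]) (use finite_section_roots[OF norm] disjoint in auto)
  also have "\<dots> \<le> card (curve_section v)"
    by (rule card_mono[OF finite_curve_section[OF norm]]) (auto simp: section_roots_def)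
  also have "\<dots> \<le> card (affine_polar_pts v)" by (rule card_curve_section_le[OF norm])
  finally show ?thesis .
qed

definition imaginary_sign_sum :: "'f quad \<Rightarrow> int" where
  "imaginary_sign_sum v = (\<Sum>u\<in>polar_pts v. of_bool (\<not> real_pt u) * flag_sign u v)"

lemma imaginary_sign_sum_le:
  assumes norm: "herm v v = 1"
  shows "imaginary_sign_sum v \<le> 0"
proof (cases "\<exists>u\<in>polar_pts v. \<not> real_pt u")
  case True
  then obtain u where "u \<in> polar_pts v" "\<not> real_pt u" by blast
  then have "(\<Sum>u\<in>affine_polar_pts v. int (card (section_roots v u)))
      \<le> int (card (affine_polar_pts v))"
    using sum_card_section_roots_le[OF norm] by (simp flip: of_nat_sum)
  moreover have "imaginary_sign_sum v
      = (\<Sum>u\<in>affine_polar_pts v. of_bool (\<not> real_pt u) * flag_sign u v)"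
    unfolding imaginary_sign_sum_def
  proof (rule sum.mono_neutral_right)
    show "\<forall>u\<in>polar_pts v - affine_polar_pts v. of_bool (\<not> real_pt u) * flag_sign u v = 0"
    proof
      fix u assume "u \<in> polar_pts v - affine_polar_pts v"
      then have "real_pt u" using imaginary_polar_pts_affine by blast
      then show "of_bool (\<not> real_pt u) * flag_sign u v = 0" by simp
    qed
  qed (simp_all add: affine_polar_pts_def)
  moreover have "(\<Sum>u\<in>affine_polar_pts v. 1 + of_bool (\<not> real_pt u) * flag_sign u v)
      \<le> (\<Sum>u\<in>affine_polar_pts v. int (card (section_roots v u)))"
    by (rule sum_mono) (rule card_section_roots_ge[OF norm])
  ultimately show ?thesis by (simp add: sum.distrib)
qed (simp add: imaginary_sign_sum_def)

lemma imaginary_sign_sum_minus: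
  assumes "herm v v = 1"
  shows "imaginary_sign_sum (- v) = - imaginary_sign_sum v"
  unfolding imaginary_sign_sum_def polar_pts_minus sum_negf[symmetric]
  by (rule sum.cong) (simp_all add: flag_sign_minus[OF polar_pts_flag[OF assms]])

lemma imaginary_balance: "herm v v = 1 \<Longrightarrow> imaginary_sign_sum v = 0"
  using imaginary_sign_sum_le[of v] imaginary_sign_sum_le[of "- v"] imaginary_sign_sum_minus[of v]
  by simp

section \<open>Real points\<close>

definition real_sign_sum :: "'f quad \<Rightarrow> int" where
  "real_sign_sum v = (\<Sum>u\<in>polar_pts v. of_bool (real_pt u) * flag_sign u v)"

lemma real_sign_sum_minus:
  assumes "herm v v = 1"
  shows "real_sign_sum (- v) = - real_sign_sum v"
  unfolding real_sign_sum_def polar_pts_minus sum_negf[symmetric]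
  by (rule sum.cong) (simp_all add: flag_sign_minus[OF polar_pts_flag[OF assms]])

lemma normalize_rot:
  assumes A: "rational_matrix A" "det A \<noteq> 0" and u: "u \<in> polar_pts v"
  shows "normalize_pt (rot A u) \<in> polar_pts (rot A v)"
    and "real_pt (normalize_pt (rot A u)) \<longleftrightarrow> real_pt u"
    and "real_pt u \<Longrightarrow> flag_sign (normalize_pt (rot A u)) (rot A v) = flag_sign u v"
proof -
  have iso: "isotropic (rot A u)"
    using u by (simp add: isotropic_rot[OF A] polar_pts_def curve_pts_def)
  obtain c where c: "c \<noteq> 0" "normalize_pt (rot A u) = scaleq c (rot A u)"
    by (rule normalize_pt_multiple[OF iso])
  show "normalize_pt (rot A u) \<in> polar_pts (rot A v)"
    using u normalize_pt_curve[OF iso] herm_rot[OF A, of u v] by (simp add: polar_pts_def c(2))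
  show "real_pt (normalize_pt (rot A u)) \<longleftrightarrow> real_pt u"
    using c A(2) by (simp add: real_pt_scaleq real_pt_rot)
  show "flag_sign (normalize_pt (rot A u)) (rot A v) = flag_sign u v" if "real_pt u"
    using positive_rot_real[OF A that] c by (simp add: flag_sign_def positive_scaleq)
qed

lemma real_sign_sum_rot:
  assumes A: "rational_matrix A" "det A \<noteq> 0"
  shows "real_sign_sum (rot A v) = real_sign_sum v"
proof -
  let ?A' = "adjugate_2 A"
  have A': "rational_matrix ?A'" "det ?A' \<noteq> 0"
    using A(1) by (simp add: forall_2 adjugate_2_def) (simp add: det_adjugate_2 A(2))
  have iso: "isotropic (rot A u)" "isotropic (rot ?A' u)" if "u \<in> polar_pts w" for u w
    using that A A' by (simp_all add: isotropic_rot polar_pts_def curve_pts_def)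
  show ?thesis
    unfolding real_sign_sum_def
  proof (rule sum.reindex_bij_witness[of _ "\<lambda>u. normalize_pt (rot A u)"
    "\<lambda>u. normalize_pt (rot ?A' u)"])
    fix u assume u: "u \<in> polar_pts v"
    show "normalize_pt (rot ?A' (normalize_pt (rot A u))) = u"
      using u by (intro normalize_rot_inverse iso rot_adjugate_2 A) (auto simp: polar_pts_def)
    show "normalize_pt (rot A u) \<in> polar_pts (rot A v)" by (rule normalize_rot[OF A u])
  next
    fix u assume u: "u \<in> polar_pts (rot A v)"
    show "normalize_pt (rot A (normalize_pt (rot ?A' u))) = u"
      using u by (intro normalize_rot_inverse iso rot_adjugate_2 A) (auto simp: polar_pts_def)
    show "normalize_pt (rot ?A' u) \<in> polar_pts v"
      using normalize_rot(1)[OF A' u] A(2) by simp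
    show "of_bool (real_pt (normalize_pt (rot ?A' u))) * flag_sign (normalize_pt (rot ?A' u)) v
        = of_bool (real_pt u) * flag_sign u (rot A v)"
      using normalize_rot(2,3)[OF A' u] A(2) by simp
  qed
qed

text \<open>The half turn about \<open>e\<close> maps \<open>v\<close> to \<open>- v\<close>.\<close>

lemma real_balance_half_turn:
  assumes "herm v v = 1" and e: "frobq e = e" "bil e e \<noteq> 0" and "bil e v = 0"
  shows "real_sign_sum v = 0"
proof -
  obtain e0 e1 e2 where e_def: "e = (e0, e1, e2)" by (cases e)
  obtain v0 v1 v2 where v: "v = (v0, v1, v2)" by (cases v)
  define A :: "'f^2^2" where "A = vector [vector [e1, - e0], vector [e2, - e1]]"
  have A: "rational_matrix A" using e(1) by (simp add: forall_2 A_def e_def)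
  have "2 * det A = bil e e" by (simp add: det_2 A_def e_def algebra_simps)
  then have det: "det A \<noteq> 0" using e(2) by auto
  have "act A v = scaleq (- det A) v + scaleq (bil e v) e"
    by (simp add: det_2 A_def v e_def algebra_simps power2_eq_square)
  then have "rot A v = - v" using det \<open>bil e v = 0\<close> by (simp add: rot_def)
  then show ?thesis
    using real_sign_sum_rot[OF A det, of v] real_sign_sum_minus[OF assms(1)] by simp
qed

lemma rational_perp_exists:
  obtains e where "frobq e = e" "e \<noteq> 0" "bil e v = 0"
proof -
  let ?R = "{x. rational x}"
  let ?S = "?R \<times> ?R \<times> ?R"
  have "card ((\<lambda>e. bil e v) ` ?S) \<le> CARD('f)" by (rule card_mono) auto
  also have "\<dots> < card ?S"
    using p_gt by (simp add: card_cartesian_product card_rational card_f power2_eq_square)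
  finally have "\<not> inj_on (\<lambda>e. bil e v) ?S" by (rule pigeonhole)
  then have "\<exists>e\<in>?S. \<exists>e'\<in>?S. bil e v = bil e' v \<and> e \<noteq> e'"
    by (simp only: inj_on_def ball_simps bex_simps not_imp)
  then obtain e e' where e: "e \<in> ?S" "e' \<in> ?S" "bil e v = bil e' v" "e \<noteq> e'"
    by (elim bexE conjE)
  have "frobq e = e" if "e \<in> ?S" for e using that by (cases e) simp
  then have "frobq (e + - e') = e + - e'" using e(1,2) by (simp del: add_uminus_conv_diff)
  moreover have "e + - e' \<noteq> 0" using e(4) by simp
  moreover have "bil (e + - e') v = 0" using e(3) by (simp del: add_uminus_conv_diff)
  ultimately show thesis by (rule that)
qed

text \<open>The points other than \<open>(1, 0, 0)\<close> on the line polar to a multiple of \<open>t + \<delta>\<close>.\<close>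

definition tangent_pt :: "'f \<Rightarrow> 'f quad" where
  "tangent_pt y = (2 * y * \<delta> - \<delta> ^ 2, - \<delta>, 1)"

lemma inj_tangent_pt: "inj tangent_pt"
  using \<delta>_nz by (auto simp: inj_def tangent_pt_def)

lemma affine_polar_pts_tangent:
  assumes norm: "herm (2 * v1 * \<delta>, v1, 0) (2 * v1 * \<delta>, v1, 0) = 1"
  shows "affine_polar_pts (2 * v1 * \<delta>, v1, 0) = tangent_pt ` {y. rational y}"
proof (rule card_subset_eq[symmetric])
  show "tangent_pt ` {y. rational y} \<subseteq> affine_polar_pts (2 * v1 * \<delta>, v1, 0)"
    by (auto simp: tangent_pt_def affine_polar_pts_iff \<delta>_conj power2_eq_square)
  show "card (tangent_pt ` {y. rational y}) = card (affine_polar_pts (2 * v1 * \<delta>, v1, 0))"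
    using card_affine_polar_pts[OF norm] card_rational
    by (simp add: card_image inj_on_subset[OF inj_tangent_pt])
qed simp

lemma bil_tangent_pt: "bil (tangent_pt y) (tangent_pt y) = 2 ^ 2 * (\<delta> * (y - \<delta>))"
  by (simp add: tangent_pt_def algebra_simps power2_eq_square)

lemma bil_tangent_pt_nz: "rational y \<Longrightarrow> bil (tangent_pt y) (tangent_pt y) \<noteq> 0"
  using \<delta>_nz \<delta>_not_rational by (auto simp: bil_tangent_pt)

lemma bil_tangent_pt_quarter:
  "bil (tangent_pt y) (tangent_pt y) ^ quarter_order = (\<delta> * (y - \<delta>)) ^ quarter_order"
proof -
  have "((2::'f) ^ 2) ^ quarter_order = 1"
    using rational_power_half_order[of 2]
    by (simp only: half_order_eq_twice_quarter power_mult) simp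
  then show ?thesis unfolding bil_tangent_pt power_mult_distrib[of "2 ^ 2"] by simp
qed

lemma conj_triple_tangent_pt:
  assumes "rational y"
  shows "conj_triple (tangent_pt y) (2 * v1 * \<delta>, v1, 0)
      = 2 * v1 * bil (tangent_pt y) (tangent_pt y) ^ p"
proof -
  have bil_frob: "bil (tangent_pt y) (tangent_pt y) ^ p = 2 ^ 2 * (- \<delta> * (y + \<delta>))"
    unfolding bil_tangent_pt by (simp add: \<delta>_conj assms)
  have frobq: "frobq (tangent_pt y) = (- (2 * y * \<delta>) - \<delta> ^ 2, \<delta>, 1)"
    by (simp add: tangent_pt_def \<delta>_conj assms)
  show ?thesis
    unfolding conj_triple_def bil_frob frobq
    unfolding tangent_pt_def cross.simps bil.simps by Groebner_Basis.algebra
qed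

lemma real_sign_tangent_pt:
  assumes y: "rational y" and s: "(2 * v1) ^ m = \<kappa> \<or> (2 * v1) ^ m = - \<kappa>"
  shows "of_bool (real_pt (tangent_pt y)) * flag_sign (tangent_pt y) (2 * v1 * \<delta>, v1, 0)
    = (if (2 * v1) ^ m = \<kappa> then 1 else - 1) * power_sign quarter_order (\<delta> * (y - \<delta>))"
proof -
  let ?b = "bil (tangent_pt y) (tangent_pt y)" and ?z = "(\<delta> * (y - \<delta>)) ^ quarter_order"
    and ?s = "(2 * v1) ^ m"
  note b_nz = bil_tangent_pt_nz[OF y]
  have half: "?b ^ half_order = ?z ^ 2"
    unfolding half_order_eq_twice_quarter power_even_eq bil_tangent_pt_quarter ..
  then have real: "real_pt (tangent_pt y) \<longleftrightarrow> ?z = 1 \<or> ?z = - 1"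
    using b_nz by (simp add: real_pt_def power2_eq_1_iff)
  have "conj_triple (tangent_pt y) (2 * v1 * \<delta>, v1, 0) ^ m = ?s * ?b ^ (m * p)"
    unfolding conj_triple_tangent_pt[OF y]
    by (simp only: power_mult_distrib power_mult[symmetric] mult.commute[of p])
  also have "\<dots> = (?s * ?z) * ?b ^ (m ^ 2)"
    unfolding m_mult_p power_add bil_tangent_pt_quarter by (simp only: mult_ac)
  finally have "positive (tangent_pt y) (2 * v1 * \<delta>, v1, 0)
      \<longleftrightarrow> ?s * ?z = \<kappa>" if "real_pt (tangent_pt y)"
    using that b_nz by (simp add: positive_def real_pt_def)
  then show ?thesis
    using real s by (auto simp: power_sign_def flag_sign_def)
qed

lemma real_sign_infinity:
  "of_bool (real_pt (1, 0, 0)) * flag_sign (1, 0, 0) (v0, v1, 0)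
      = (if (2 * v1) ^ m = \<kappa>' then 1 else - 1)"
  by (auto simp: real_pt_def flag_sign_def positive_def)

end

text \<open>The condition on \<open>\<kappa>'\<close> makes the signs of the points on a tangent line of the conic cancel.\<close>

locale hermitian_quads_choice = hermitian_quads p \<delta> \<kappa> \<kappa>'
  for p :: nat and \<delta> :: "'f::{field,finite}" and \<kappa> \<kappa>' :: 'f +
  assumes \<kappa>'_choice: "quartic_sum = (if \<kappa>' = \<kappa> then - 1 else 1)"
begin

lemma real_balance_tangent:
  assumes norm: "herm (2 * v1 * \<delta>, v1, 0) (2 * v1 * \<delta>, v1, 0) = 1"
  shows "real_sign_sum (2 * v1 * \<delta>, v1, 0) = 0"
proof -
  let ?v = "(2 * v1 * \<delta>, v1, 0)" and ?s = "(2 * v1) ^ m"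
  have "- 2 * (v1 * v1 ^ p) = 1" using norm by (simp add: algebra_simps)
  moreover have "(2 * v1) * (2 * v1) ^ p = - 2 * (- 2 * (v1 * v1 ^ p))" by simp
  ultimately have "(2 * v1) * (2 * v1) ^ p = - 2" by simp
  then have s: "?s = \<kappa> \<or> ?s = - \<kappa>" "?s = \<kappa>' \<or> ?s = - \<kappa>'"
    using norm_minus_2_power_m \<kappa>_squared \<kappa>'_squared by blast+
  have "real_sign_sum ?v = of_bool (real_pt (1, 0, 0)) * flag_sign (1, 0, 0) ?v
      + (\<Sum>u\<in>affine_polar_pts ?v. of_bool (real_pt u) * flag_sign u ?v)"
    unfolding real_sign_sum_def polar_pts_eq if_P[OF refl]
    by (rule sum.insert[OF finite infinity_not_affine])
  also have "(\<Sum>u\<in>affine_polar_pts ?v. of_bool (real_pt u) * flag_sign u ?v)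
      = (\<Sum>y\<in>{y. rational y}. (if ?s = \<kappa> then 1 else - 1) * power_sign quarter_order (\<delta> * (y - \<delta>)))"
    unfolding affine_polar_pts_tangent[OF norm]
      sum.reindex[OF inj_on_subset[OF inj_tangent_pt subset_UNIV]]
    by (rule sum.cong) (simp_all only: comp_def mem_Collect_eq real_sign_tangent_pt[OF _ s(1)])
  also have "\<dots> = (if ?s = \<kappa> then 1 else - 1) * quartic_sum"
    unfolding quartic_sum_def by (rule sum_distrib_left[symmetric])
  finally have "real_sign_sum ?v
      = (if ?s = \<kappa>' then 1 else - 1) + (if ?s = \<kappa> then 1 else - 1) * quartic_sum"
    unfolding real_sign_infinity .
  then show ?thesis using s \<kappa>'_choice by (auto split: if_splits)
qed

lemma real_balance_infinity:
  assumes norm: "herm (v0, v1, 0) (v0, v1, 0) = 1"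
  shows "real_sign_sum (v0, v1, 0) = 0"
proof -
  have "v1 \<noteq> 0" using norm by auto
  define \<alpha> where "\<alpha> = v0 / (2 * v1)"
  have v0: "v0 = 2 * v1 * \<alpha>" using \<open>v1 \<noteq> 0\<close> by (simp add: \<alpha>_def)
  obtain a b where ab: "rational a" "rational b" "\<alpha> = a + b * \<delta>" by (rule rational_parts)
  show ?thesis
  proof (cases "b = 0")
    case True
    show ?thesis
    proof (rule real_balance_half_turn[OF norm])
      let ?e = "(a ^ 2 + 1, a, 1)"
      show "frobq ?e = ?e" using ab(1) by simp
      show "bil ?e ?e \<noteq> 0" by (simp add: power2_eq_square)
      show "bil ?e (v0, v1, 0) = 0" by (simp add: v0 ab(3) True)
    qed
  next
    case False
    define A :: "'f^2^2" where "A = vector [vector [1, - a], vector [0, b]]"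
    have A: "rational_matrix A" "det A \<noteq> 0" using ab False by (simp_all add: A_def forall_2 det_2)
    have rot: "rot A (v0, v1, 0) = (2 * v1 * \<delta>, v1, 0)"
      using False by (simp add: rot_def A_def det_2 v0 ab(3) field_simps)
    have "real_sign_sum (2 * v1 * \<delta>, v1, 0) = 0"
      by (rule real_balance_tangent)
        (use herm_rot[OF A, of "(v0, v1, 0)" "(v0, v1, 0)"] norm in \<open>simp only: rot\<close>)
    then show ?thesis using real_sign_sum_rot[OF A, of "(v0, v1, 0)"] by (simp add: rot)
  qed
qed

lemma real_balance:
  assumes norm: "herm v v = 1"
  shows "real_sign_sum v = 0"
proof -
  obtain e where e: "frobq e = e" "e \<noteq> 0" "bil e v = 0" by (rule rational_perp_exists)
  show ?thesis
  proof (cases "bil e e = 0")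
    case False
    then show ?thesis using real_balance_half_turn[OF norm e(1)] e(3) by blast
  next
    case True
    then have "isotropic e" using e by (simp add: isotropic_def)
    then obtain A c where A: "rational_matrix A" "det A = 1"
      and c: "c \<noteq> 0" "rot A e = scaleq c (1, 0, 0)"
      using True by (rule conic_pt_to_infinity)
    have det: "det A \<noteq> 0" using A(2) by simp
    obtain v0 v1 v2 where v: "rot A v = (v0, v1, v2)" by (cases "rot A v")
    have "bil (rot A e) (rot A v) = 0" using e(3) by (simp add: bil_rot det)
    then have "v2 = 0" using c by (simp add: v)
    moreover have "herm (rot A v) (rot A v) = 1" by (simp add: herm_rot[OF A(1) det] norm)
    ultimately have "real_sign_sum (rot A v) = 0" using real_balance_infinity unfolding v by simp
    then show ?thesis by (simp add: real_sign_sum_rot[OF A(1) det])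
  qed
qed

theorem card_positive_polar_pts:
  assumes norm: "herm v v = 1"
  shows "card {u \<in> polar_pts v. positive u v} = m"
proof -
  have "2 * int (card {u \<in> polar_pts v. positive u v})
      = (\<Sum>u\<in>polar_pts v. 2 * of_bool (positive u v))"
    by (simp add: Int_def flip: sum_distrib_left)
  also have "\<dots>
      = (\<Sum>u\<in>polar_pts v.
          1 + (of_bool (real_pt u) * flag_sign u v + of_bool (\<not> real_pt u) * flag_sign u v))"
    by (rule sum.cong) (simp_all add: flag_sign_def)
  also have "\<dots> = int (p + 1) + (real_sign_sum v + imaginary_sign_sum v)"
    unfolding sum.distrib real_sign_sum_def imaginary_sign_sum_def
    by (simp add: card_polar_pts[OF norm])
  also have "\<dots> = 2 * int m"
    using real_balance[OF norm] imaginary_balance[OF norm] two_m by simp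
  finally show ?thesis by simp
qed

end

section \<open>Collineations and isometries\<close>

lemma mat_vector_mult: "mat c *v x = c *s x" for x :: "'a::field^'n"
  by (simp add: matrix_vector_mult_def mat_def vec_eq_iff if_distrib if_distribR cong: if_cong)

lemma inj_invertible: "invertible g \<Longrightarrow> inj ((*v) g)" for g :: "'a::field^'n^'n"
  using matrix_left_invertible_injective by (auto simp: invertible_left_inverse)

lemma collin_mult: "collin (g ** h) S = collin g (collin h S)" for g :: "'a::field^'n^'n"
  by (simp add: collin_def image_image matrix_vector_mul_assoc)

lemma collin_one: "collin (mat 1) S = S"
  by (simp add: collin_def)

lemma collin_cancel: "g ** h = mat 1 \<Longrightarrow> collin g (collin h S) = S" for g :: "'a::field^'n^'n"
  by (simp add: collin_one flip: collin_mult)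

lemma collin_mono: "S \<subseteq> T \<Longrightarrow> collin g S \<subseteq> collin g T"
  by (auto simp: collin_def)

lemma inj_collin: "invertible g \<Longrightarrow> inj (collin g)" for g :: "'a::field^'n^'n"
  by (rule injI) (simp add: collin_def inj_image_eq_iff[OF inj_invertible])

lemma collin_subspace: "vec.subspace S \<Longrightarrow> vec.subspace (collin g S)" for g :: "'a::field^'n^'n"
  unfolding collin_def by (rule vec.linear_subspace_image[OF matrix_vector_mul_linear_gen])

lemma collin_span: "collin g (vec.span S) = vec.span ((*v) g ` S)" for g :: "'a::field^'n^'n"
  unfolding collin_def by (rule vec.linear_span_image[OF matrix_vector_mul_linear_gen, symmetric])

lemma dim_collin: "invertible g \<Longrightarrow> vec.dim (collin g S) = vec.dim S" for g :: "'a::field^'n^'n"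
  unfolding collin_def
  by (rule vec.dim_image_eq[OF matrix_vector_mul_linear_gen])
    (blast intro: inj_on_subset inj_invertible)

lemma collin_pg_points: "invertible g \<Longrightarrow> P \<in> pg_points \<Longrightarrow> collin g P \<in> pg_points"
  and collin_pg_lines: "invertible g \<Longrightarrow> P \<in> pg_lines \<Longrightarrow> collin g P \<in> pg_lines"
  for g :: "'a::field^'n^'n"
  by (simp_all add: pg_points_def pg_lines_def collin_subspace dim_collin)

lemma collin_scalar_mult:
  fixes g :: "'a::field^'n^'n"
  assumes "vec.subspace S" "c \<noteq> 0"
  shows "collin (mat c ** g) S = collin g S"
proof -
  have subset: "collin (mat c) T \<subseteq> T" if "vec.subspace T" for c and T :: "('a^'n) set"
    using vec.subspace_scale[OF that] by (auto simp: collin_def mat_vector_mult)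
  have subspace: "vec.subspace (collin g S)" by (rule collin_subspace[OF assms(1)])
  have "mat c ** mat (inverse c) = (mat 1 :: 'a^'n^'n)" using assms(2) by (simp add: mat_mult_mat)
  then have "collin g S = collin (mat c) (collin (mat (inverse c)) (collin g S))"
    by (simp only: collin_cancel)
  also have "\<dots> \<subseteq> collin (mat c) (collin g S)" by (rule collin_mono[OF subset[OF subspace]])
  finally show ?thesis using subset[OF subspace, of c] by (simp add: collin_mult)
qed

definition isometry :: "nat \<Rightarrow> 'a::field^'n^'n \<Rightarrow> 'a^'n^'n \<Rightarrow> 'a^'n^'n \<Rightarrow> bool" where
  "isometry q H H' g \<longleftrightarrow> invertible g \<and> (\<forall>x y. hform q H' (g *v x) (g *v y) = hform q H x y)"

lemma isometry_trans: "isometry q H1 H2 g \<Longrightarrow> isometry q H2 H3 h \<Longrightarrow> isometry q H1 H3 (h ** g)"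
  by (simp add: isometry_def invertible_mult flip: matrix_vector_mul_assoc)

lemma isometry_inverse:
  assumes "isometry q H H' g" "g ** g' = mat 1"
  shows "isometry q H' H g'"
proof -
  have "g *v (g' *v x) = x" for x by (simp add: matrix_vector_mul_assoc assms(2))
  then show ?thesis
    using assms invertible_left_inverse[of g'] unfolding isometry_def by metis
qed

lemma herm_points_isometry:
  assumes "isometry q H H' g" "P \<in> herm_points q H"
  shows "collin g P \<in> herm_points q H'"
  using assms collin_pg_points[of g P]
  by (auto simp: herm_points_def polar_def collin_def isometry_def)

lemma generators_isometry:
  assumes g: "isometry q H H' g" and L: "L \<in> generators q H"
  shows "collin g L \<in> generators q H'"
proof -
  obtain g' where g': "g ** g' = mat 1" "g' ** g = mat 1"
    using g by (auto simp: isometry_def invertible_def)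
  have inv: "invertible g" "invertible g'" using g' by (auto simp: invertible_def)
  have "P \<in> herm_points q H'" if P: "P \<in> pg_points" "P \<subseteq> collin g L" for P
  proof -
    have "collin g' P \<subseteq> L" using collin_mono[OF P(2), of g'] by (simp add: collin_cancel[OF g'(2)])
    then have "collin g' P \<in> herm_points q H"
      using L collin_pg_points[OF inv(2) P(1)] by (simp add: generators_def)
    then have "collin g (collin g' P) \<in> herm_points q H'" by (rule herm_points_isometry[OF g])
    then show ?thesis by (simp add: collin_cancel[OF g'(1)])
  qed
  then show ?thesis using L collin_pg_lines[OF inv(1)] by (simp add: generators_def)
qed

lemma hemisystem_isometry:
  assumes g: "isometry q H H' g" and M: "hemisystem q H M"
  shows "hemisystem q H' (collin g ` M)"
proof -
  obtain g' where g': "g ** g' = mat 1" "g' ** g = mat 1"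
    using g by (auto simp: isometry_def invertible_def)
  have inj: "inj_on (collin g) N" for N
    by (rule inj_on_subset[OF inj_collin subset_UNIV]) (use g in \<open>simp add: isometry_def\<close>)
  have "card {L \<in> collin g ` M. P \<subseteq> L} = (q + 1) div 2" if P: "P \<in> herm_points q H'" for P
  proof -
    have "collin g' P \<subseteq> L \<longleftrightarrow> P \<subseteq> collin g L" for L
    proof
      show "P \<subseteq> collin g L" if "collin g' P \<subseteq> L"
        using collin_mono[OF that, of g] by (simp add: collin_cancel[OF g'(1)])
      show "collin g' P \<subseteq> L" if "P \<subseteq> collin g L"
        using collin_mono[OF that, of g'] by (simp add: collin_cancel[OF g'(2)])
    qed
    then have "{L \<in> collin g ` M. P \<subseteq> L} = collin g ` {L \<in> M. collin g' P \<subseteq> L}" by blast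
    moreover have "collin g' P \<in> herm_points q H"
      by (rule herm_points_isometry[OF isometry_inverse[OF g g'(1)] P])
    ultimately show ?thesis using M by (simp add: card_image[OF inj] hemisystem_def)
  qed
  then show ?thesis
    using M generators_isometry[OF g] by (auto simp: hemisystem_def card_image[OF inj])
qed

section \<open>Hermitian forms\<close>

context quadratic_extension
begin

lemma hform_scale [simp]:
  fixes x :: "'f^'n"
  shows "hform p H (c *s x) y = c * hform p H x y" "hform p H x (c *s y) = c ^ p * hform p H x y"
  by (simp_all add: hform_def sum_distrib_left mult_ac)

lemma hform_add [simp]:
  fixes x :: "'f^'n"
  shows "hform p H (x + x') y = hform p H x y + hform p H x' y"
    "hform p H x (y + y') = hform p H x y + hform p H x y'"
  by (simp_all add: hform_def distrib_left distrib_right sum.distrib)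

lemma hform_diff [simp]:
  fixes x :: "'f^'n"
  shows "hform p H (x - x') y = hform p H x y - hform p H x' y"
    "hform p H x (y - y') = hform p H x y - hform p H x y'"
  by (simp_all add: hform_def left_diff_distrib right_diff_distrib sum_subtractf)

lemma hform_zero [simp]: "hform p H 0 y = 0" "hform p H x 0 = 0" for x :: "'f^'n"
  by (simp_all add: hform_def)

lemma hform_sum:
  fixes b :: "'i \<Rightarrow> 'f^'n"
  shows "hform p H (\<Sum>i\<in>A. f i *s b i) y = (\<Sum>i\<in>A. f i * hform p H (b i) y)"
    "hform p H y (\<Sum>i\<in>A. f i *s b i) = (\<Sum>i\<in>A. f i ^ p * hform p H y (b i))"
  by (induction A rule: infinite_finite_induct) simp_all

lemma hform_conj:
  fixes H :: "'f^'n^'n"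
  assumes "nondeg_hermitian p H"
  shows "hform p H x y = (hform p H y x) ^ p"
proof -
  have H: "(H $ i $ j) ^ p = H $ j $ i" for i j using assms by (simp add: nondeg_hermitian_def)
  have "(hform p H y x) ^ p = (\<Sum>i\<in>UNIV. \<Sum>j\<in>UNIV. (y $ i) ^ p * H $ j $ i * x $ j)"
    by (simp add: hform_def frob_sum H)
  also have "\<dots> = hform p H x y"
    unfolding hform_def by (subst sum.swap) (simp add: mult_ac)
  finally show ?thesis by simp
qed

lemma hform_nondegenerate:
  fixes H :: "'f^'n^'n"
  assumes "nondeg_hermitian p H" "\<And>y. hform p H x y = 0"
  shows "x = 0"
proof -
  have "x $ i * H $ i $ k * (axis j 1 $ k) ^ p = (if k = j then H $ i $ j * x $ i else 0)" for i j k
    by (simp add: axis_def mult.commute)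
  then have "(\<Sum>i\<in>UNIV. H $ i $ j * x $ i) = hform p H x (axis j 1)" for j
    by (simp add: hform_def)
  then have "transpose H *v x = 0"
    using assms(2) by (simp add: vec_eq_iff matrix_vector_mult_def transpose_def)
  moreover have "invertible (transpose H)"
    using assms(1) by (simp add: nondeg_hermitian_def invertible_det_nz)
  ultimately show ?thesis
    by (metis invertible_def matrix_vector_mul_assoc matrix_vector_mul_lid matrix_vector_mult_0_right)
qed

lemma exists_nonisotropic:
  fixes H :: "'f^'n^'n"
  assumes H: "nondeg_hermitian p H" and W: "vec.subspace W" "z \<in> W" "w \<in> W" and "hform p H z w \<noteq> 0"
  obtains x where "x \<in> W" "hform p H x x \<noteq> 0"
proof (rule ccontr)
  let ?h = "hform p H"
  assume "\<not> thesis"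
  then have isotropic: "?h x x = 0" if "x \<in> W" for x
    using that \<open>\<And>x. x \<in> W \<Longrightarrow> ?h x x \<noteq> 0 \<Longrightarrow> thesis\<close> by blast
  define c where "c = (1 / ?h z w) ^ p"
  have "c ^ p * ?h z w = 1" unfolding c_def frob_frob using \<open>?h z w \<noteq> 0\<close> by simp
  moreover have "c * ?h w z = (1 / ?h z w * ?h z w) ^ p"
    unfolding c_def hform_conj[OF H, of w z] by (simp only: frob_mult)
  then have "c * ?h w z = 1" using \<open>?h z w \<noteq> 0\<close> by simp
  moreover have "?h (z + c *s w) (z + c *s w) = 0"
    by (intro isotropic vec.subspace_add vec.subspace_scale W)
  then have "c ^ p * ?h z w + c * ?h w z = 0"
    using isotropic[OF W(2)] isotropic[OF W(3)] by (simp add: add.commute)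
  ultimately show False by simp
qed

definition orthonormal :: "'f^'n^'n \<Rightarrow> ('f^'n) set \<Rightarrow> bool" where
  "orthonormal H S \<longleftrightarrow> (\<forall>x\<in>S. \<forall>y\<in>S. hform p H x y = of_bool (x = y))"

lemma orthonormal_combination:
  assumes "orthonormal H S" "U \<subseteq> S" "t \<in> S"
  shows "hform p H (\<Sum>s\<in>U. c s *s s) t = (if t \<in> U then c t else 0)"
proof -
  have "hform p H (\<Sum>s\<in>U. c s *s s) t = (\<Sum>s\<in>U. if s = t then c s else 0)"
    unfolding hform_sum by (rule sum.cong) (use assms in \<open>auto simp: orthonormal_def\<close>)
  then show ?thesis by simp
qed

lemma orthonormal_independent:
  assumes "orthonormal H S"
  shows "vec.independent S"
proof
  assume "vec.dependent S"
  then obtain U c t where U: "U \<subseteq> S" "(\<Sum>s\<in>U. c s *s s) = 0" "t \<in> U" "c t \<noteq> 0"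
    unfolding vec.dependent_explicit by blast
  then have "hform p H (\<Sum>s\<in>U. c s *s s) t = c t"
    using orthonormal_combination[OF assms U(1), of t c] by (simp only: subset_eq if_True)
  then show False using U by simp
qed

lemma orthonormal_extend:
  fixes H :: "'f^'n^'n"
  assumes H: "nondeg_hermitian p H" and S: "orthonormal H S" and "vec.span S \<noteq> UNIV"
  obtains w where "w \<notin> S" "orthonormal H (insert w S)"
proof -
  let ?h = "hform p H"
  define W where "W = {z. \<forall>s\<in>S. ?h z s = 0}"
  have W: "vec.subspace W" by (rule vec.subspaceI) (auto simp: W_def)
  define proj where "proj x = (\<Sum>s\<in>S. ?h x s *s s)" for x
  have residual: "x - proj x \<in> W" for x
    using orthonormal_combination[OF S subset_refl] by (simp add: W_def proj_def)
  obtain x where "x \<notin> vec.span S" using assms(3) by blast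
  moreover have "proj x \<in> vec.span S"
    unfolding proj_def by (intro vec.span_sum vec.span_scale vec.span_base)
  ultimately have "x - proj x \<noteq> 0" by auto
  then obtain y where "?h (x - proj x) y \<noteq> 0" using hform_nondegenerate[OF H] by blast
  moreover have "?h (x - proj x) (proj y) = 0"
    unfolding proj_def[of y] hform_sum using residual[of x] by (simp add: W_def)
  ultimately have "?h (x - proj x) (y - proj y) \<noteq> 0" by simp
  then obtain z where z: "z \<in> W" "?h z z \<noteq> 0"
    by (rule exists_nonisotropic[OF H W residual residual])
  have "rational (1 / ?h z z)" using hform_conj[OF H, of z z] by simp
  then obtain k where k: "k * k ^ p = 1 / ?h z z" by (rule norm_surj) (use z(2) in simp_all)
  define w where "w = k *s z"
  have "?h w w = (k * k ^ p) * ?h z z" by (simp add: w_def)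
  then have unit: "?h w w = 1" unfolding k using z(2) by simp
  have orthogonal: "?h w s = 0" "?h s w = 0" if "s \<in> S" for s
  proof -
    show "?h w s = 0" using z(1) that by (simp add: W_def w_def)
    then show "?h s w = 0" unfolding hform_conj[OF H, of s w] by simp
  qed
  show thesis
  proof (rule that)
    show "w \<notin> S" using orthogonal(1)[of w] unit by auto
    then show "orthonormal H (insert w S)" using S unit orthogonal by (auto simp: orthonormal_def)
  qed
qed

lemma orthonormal_basis_exists:
  fixes H :: "'f^'n^'n"
  assumes H: "nondeg_hermitian p H"
  obtains b :: "'n \<Rightarrow> 'f^'n" where "\<And>i j. hform p H (b i) (b j) = of_bool (i = j)"
proof -
  have "\<exists>S. orthonormal H S \<and> (\<forall>T. orthonormal H T \<longrightarrow> card T \<le> card S)"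
  proof (rule ex_has_greatest_nat)
    show "orthonormal H {}" by (simp add: orthonormal_def)
    show "\<forall>S. orthonormal H S \<longrightarrow> card S < Suc (card (UNIV :: ('f^'n) set))"
      unfolding less_Suc_eq_le using card_mono[OF finite subset_UNIV] by blast
  qed
  then obtain S where S: "orthonormal H S" and maximal: "\<And>T. orthonormal H T \<Longrightarrow> card T \<le> card S"
    by blast
  have "vec.span S = UNIV"
  proof (rule ccontr)
    assume "vec.span S \<noteq> UNIV"
    then obtain w where "w \<notin> S" "orthonormal H (insert w S)" by (rule orthonormal_extend[OF H S])
    then show False using maximal[of "insert w S"] by simp
  qed
  then have "vec.dim (UNIV :: ('f^'n) set) = card S"
    by (intro vec.dim_eq_card) (simp_all add: orthonormal_independent[OF S])
  then have "card (UNIV :: 'n set) = card S" by (simp only: vec_dim_card)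
  then obtain b where b: "bij_betw b (UNIV :: 'n set) S"
    using finite_same_card_bij[of "UNIV :: 'n set" S] by auto
  have "hform p H (b i) (b j) = of_bool (i = j)" for i j
  proof -
    have "b i \<in> S" "b j \<in> S" "b i = b j \<longleftrightarrow> i = j" using b by (auto simp: bij_betw_def inj_def)
    then show ?thesis using S by (simp add: orthonormal_def)
  qed
  then show thesis by (rule that)
qed

lemma isometry_orthonormal_exists:
  fixes H :: "'f^'n^'n"
  assumes "nondeg_hermitian p H"
  obtains Q where "isometry p (mat 1) H Q"
proof -
  obtain b :: "'n \<Rightarrow> 'f^'n" where b: "\<And>i j. hform p H (b i) (b j) = of_bool (i = j)"
    by (rule orthonormal_basis_exists[OF assms]) blast
  define Q where "Q = (\<chi> i j. b j $ i)"
  have Q: "Q *v x = (\<Sum>i\<in>UNIV. x $ i *s b i)" for x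
    by (simp add: vec_eq_iff matrix_vector_mult_def Q_def mult.commute)
  have coordinate: "hform p H (Q *v x) (b j) = x $ j" for x j
    unfolding Q hform_sum by (simp add: b)
  have "x = 0" if "Q *v x = 0" for x
    using coordinate[of x] that by (simp add: vec_eq_iff)
  then have "invertible Q" by (simp add: invertible_left_inverse matrix_left_invertible_ker)
  moreover have "hform p (mat 1) x y = (\<Sum>i\<in>UNIV. x $ i * (y $ i) ^ p)" for x y :: "'f^'n"
    by (simp add: hform_def mat_def if_distrib if_distribR cong: if_cong)
  then have "hform p H (Q *v x) (Q *v y) = hform p (mat 1) x y" for x y
    unfolding Q[of y] hform_sum coordinate by (simp only: mult.commute)
  ultimately show thesis using that unfolding isometry_def by blast
qed

lemma isometry_exists:
  fixes H H' :: "'f^'n^'n"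
  assumes "nondeg_hermitian p H" "nondeg_hermitian p H'"
  obtains Q where "isometry p H H' Q"
proof -
  obtain P where P: "isometry p (mat 1) H P" by (rule isometry_orthonormal_exists[OF assms(1)])
  obtain R where R: "isometry p (mat 1) H' R" by (rule isometry_orthonormal_exists[OF assms(2)])
  obtain P' where "P ** P' = mat 1" using P by (auto simp: isometry_def invertible_def)
  then show thesis using isometry_trans[OF isometry_inverse[OF P] R] that by blast
qed

end

section \<open>The hemisystem of a standard Hermitian surface\<close>

lemma pg_points_span:
  fixes P :: "('a::field^'n) set"
  assumes "P \<in> pg_points"
  obtains z where "z \<noteq> 0" "P = vec.span {z}"
proof -
  have P: "vec.subspace P" "vec.dim P = 1" using assms by (auto simp: pg_points_def)
  obtain B where B: "B \<subseteq> P" "vec.independent B" "P \<subseteq> vec.span B" "card B = vec.dim P"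
    by (rule vec.basis_exists)
  then obtain z where z: "B = {z}" using P(2) by (metis card_1_singletonE)
  have "P = vec.span {z}" using B(1,3) P(1) z by (metis subset_antisym vec.span_minimal)
  moreover have "z \<noteq> 0" using B(2) z by (auto simp: vec.dependent_zero)
  ultimately show thesis using that by blast
qed

lemma span_pair_scale:
  fixes x y :: "'a::field^'n"
  assumes "c \<noteq> 0" "d \<noteq> 0"
  shows "vec.span {c *s x, d *s y} = vec.span {x, y}"
proof -
  have "vec.span {a *s u, b *s v} \<subseteq> vec.span {u, v}" for a b and u v :: "'a^'n"
    by (rule vec.span_minimal) (simp_all add: vec.span_base vec.span_scale)
  from this[of c x d y] this[of "inverse c" "c *s x" "inverse d" "d *s y"] show ?thesis
    using assms by simp
qed

lemma span_singleton_scale: "c \<noteq> 0 \<Longrightarrow> vec.span {c *s z} = vec.span {z}" for z :: "'a::field^'n"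
  using span_pair_scale[of c c z z] by simp

lemma span_singleton_subset_iff: "vec.subspace L \<Longrightarrow> vec.span {z} \<subseteq> L \<longleftrightarrow> z \<in> L" for z :: "'a::field^'n"
  using vec.span_base[of z "{z}"] vec.span_minimal[of "{z}" L] by auto

lemma span_pair: "vec.span {x, y} = {c *s x + d *s y | c d. True}" for x :: "'a::field^'n"
proof -
  have "z \<in> vec.span {x, y} \<longleftrightarrow> (\<exists>c d. z = c *s x + d *s y)" for z
    unfolding vec.span_breakdown_eq[of z x] vec.span_singleton image_iff
    by (simp add: diff_eq_eq add.commute)
  then show ?thesis by blast
qed

context hermitian_quads
begin

definition vec4 :: "'f \<Rightarrow> 'f quad \<Rightarrow> 'f^4" where
  "vec4 x u = vector [x, fst u, fst (snd u), snd (snd u)]"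

definition std_gram :: "'f^4^4" where
  "std_gram = (\<chi> i j. if i = 1 \<and> j = 1 then - 1 else if i = 2 \<and> j = 4 \<or> i = 4 \<and> j = 2 then 1
     else if i = 3 \<and> j = 3 then - 2 else 0)"

lemma vec4_nth [simp]:
  "vec4 x u $ 1 = x" "vec4 x u $ 2 = fst u" "vec4 x u $ 3 = fst (snd u)"
  "vec4 x u $ 4 = snd (snd u)"
  by (simp_all add: vec4_def vector_def)

lemma vec4_eq_iff [simp]: "vec4 x u = vec4 y w \<longleftrightarrow> x = y \<and> u = w"
  by (cases u; cases w) (auto simp: vec_eq_iff forall_4)

lemma vec4_exhaust: obtains x u where "z = vec4 x u"
proof
  show "z = vec4 (z $ 1) (z $ 2, z $ 3, z $ 4)" by (simp add: vec_eq_iff forall_4)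
qed

lemma vec4_linear [simp]:
  "vec4 x u + vec4 y w = vec4 (x + y) (u + w)"
  "c *s vec4 x u = vec4 (c * x) (scaleq c u)"
  by (cases u; cases w; simp add: vec_eq_iff forall_4)+

lemma vec4_eq_zero_iff [simp]: "vec4 x u = 0 \<longleftrightarrow> x = 0 \<and> u = 0"
  by (cases u) (simp add: vec_eq_iff forall_4 zero_prod_def)

lemma hform_vec4: "hform p std_gram (vec4 x u) (vec4 y w) = herm u w - x * y ^ p"
  by (cases u; cases w) (simp add: hform_def std_gram_def sum_4 algebra_simps)

lemma nondeg_hermitian_std_gram: "nondeg_hermitian p std_gram"
proof -
  let ?I = "\<chi> i j. if i = 3 \<and> j = 3 then - 1 / 2 else std_gram $ i $ j"
  have "std_gram ** ?I = mat 1"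
    by (simp add: vec_eq_iff forall_4 matrix_matrix_mult_def sum_4 std_gram_def mat_def)
  then have "det std_gram * det ?I = 1" by (simp flip: det_mul)
  then have "det std_gram \<noteq> 0" by auto
  then show ?thesis by (simp add: nondeg_hermitian_def forall_4 std_gram_def)
qed

definition gen_line :: "'f quad \<Rightarrow> 'f quad \<Rightarrow> ('f^4) set" where
  "gen_line u w = vec.span {vec4 0 u, vec4 1 w}"

lemma gen_line_eq: "gen_line u w = {vec4 y (scaleq c u + scaleq y w) | c y. True}"
  unfolding gen_line_def span_pair by simp

lemma vec4_in_gen_line: "vec4 y t \<in> gen_line u w \<longleftrightarrow> (\<exists>c. t = scaleq c u + scaleq y w)"
  by (auto simp: gen_line_eq)

lemma vec4_0_in_gen_line: "vec4 0 u \<in> gen_line u w"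
  and vec4_1_in_gen_line: "vec4 1 w \<in> gen_line u w"
  unfolding gen_line_def by (simp_all add: vec.span_base)

lemma gen_line_subspace: "vec.subspace (gen_line u w)"
  by (simp add: gen_line_def)

lemma gen_line_pg_line: assumes "u \<noteq> 0" shows "gen_line u w \<in> pg_lines"
proof -
  have "vec4 1 w \<notin> vec.span {vec4 0 u}" by (auto simp: vec.span_singleton)
  moreover have "vec.independent {vec4 0 u}" using assms by simp
  ultimately have "vec.independent {vec4 1 w, vec4 0 u}" by (rule vec.independent_insertI)
  then have "vec.independent {vec4 0 u, vec4 1 w}" by (simp add: insert_commute)
  then have "vec.dim (gen_line u w) = card {vec4 0 u, vec4 1 w}"
    unfolding gen_line_def by (rule vec.dim_span_eq_card_independent)
  then show ?thesis using gen_line_subspace by (simp add: pg_lines_def)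
qed

lemma gen_line_generator:
  assumes flag: "flag u w" shows "gen_line u w \<in> generators p std_gram"
proof -
  note D = flagD[OF flag]
  have "hform p std_gram x y = 0" if "x \<in> gen_line u w" "y \<in> gen_line u w" for x y
    using that D by (auto simp: gen_line_eq hform_vec4)
  then have "P \<in> herm_points p std_gram" if "P \<in> pg_points" "P \<subseteq> gen_line u w" for P
    using that by (auto simp: herm_points_def polar_def)
  then show ?thesis using gen_line_pg_line[OF D(1)] by (simp add: generators_def)
qed

lemma gen_line_add: "gen_line u (w + scaleq k u) = gen_line u w"
proof -
  have subset: "gen_line u (w + scaleq k u) \<subseteq> gen_line u w" for w k
  proof (unfold gen_line_def[of u "w + scaleq k u"], rule vec.span_minimal)
    have "vec4 1 w + k *s vec4 0 u \<in> gen_line u w"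
      by (intro vec.subspace_add vec.subspace_scale gen_line_subspace vec4_0_in_gen_line
          vec4_1_in_gen_line)
    then show "{vec4 0 u, vec4 1 (w + scaleq k u)} \<subseteq> gen_line u w" using vec4_0_in_gen_line by simp
  qed (rule gen_line_subspace)
  have "gen_line u w \<subseteq> gen_line u (w + scaleq k u)" using subset[of "w + scaleq k u" "- k"] by simp
  then show ?thesis using subset by blast
qed

lemma gen_line_scaleq: "k \<noteq> 0 \<Longrightarrow> gen_line (scaleq k u) w = gen_line u w"
  using span_pair_scale[of k 1 "vec4 0 u" "vec4 1 w"] by (simp add: gen_line_def)

lemma gen_line_unique:
  assumes "gen_line u w = gen_line u' w'" "u \<in> curve_pts" "u' \<in> curve_pts" shows "u = u'"
proof -
  have "vec4 0 u \<in> gen_line u' w'" using vec4_0_in_gen_line assms(1) by blast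
  then obtain c where "u = scaleq c u'" by (auto simp: vec4_in_gen_line)
  then show ?thesis using curve_pts_multiple_eq assms by blast
qed

lemma inj_gen_line_scaleq:
  assumes flag: "flag u w"
  shows "inj (\<lambda>l. gen_line u (scaleq l w))"
proof (rule injI)
  fix l l' assume "gen_line u (scaleq l w) = gen_line u (scaleq l' w)"
  then have "vec4 1 (scaleq l w) \<in> gen_line u (scaleq l' w)" using vec4_1_in_gen_line by blast
  then obtain c where "scaleq l w = scaleq c u + scaleq l' w" by (auto simp: vec4_in_gen_line)
  then have "herm (scaleq l w) w = herm (scaleq c u + scaleq l' w) w" by simp
  then show "l = l'" using flagD[OF flag] by simp
qed

definition pencil :: "'f quad \<Rightarrow> ('f^4) set set" where
  "pencil u = {gen_line u w | w. flag u w \<and> positive u w}"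

definition std_hemi :: "('f^4) set set" where
  "std_hemi = (\<Union>u\<in>curve_pts. pencil u)"

lemma std_hemiI:
  assumes "flag u w" "positive u w" shows "gen_line u w \<in> std_hemi"
proof -
  have iso: "isotropic u" using assms(1) by (rule flagD)
  obtain c where c: "c \<noteq> 0" "normalize_pt u = scaleq c u" by (rule normalize_pt_multiple[OF iso])
  then have "flag (normalize_pt u) w" "positive (normalize_pt u) w"
    "gen_line u w = gen_line (normalize_pt u) w"
    using assms by (simp_all add: flag_scaleq positive_scaleq gen_line_scaleq)
  then show ?thesis using normalize_pt_curve[OF iso] unfolding std_hemi_def pencil_def by blast
qed

lemma std_hemiE:
  assumes "L \<in> std_hemi"
  obtains u w where "L = gen_line u w" "u \<in> curve_pts" "flag u w" "positive u w"
proof -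
  obtain u where u: "u \<in> curve_pts" "L \<in> pencil u" using assms unfolding std_hemi_def by (rule UN_E)
  then obtain w where "L = gen_line u w" "flag u w" "positive u w" unfolding pencil_def by auto
  then show thesis using u(1) by (intro that)
qed

lemma std_hemi_subspace: "L \<in> std_hemi \<Longrightarrow> vec.subspace L"
  by (erule std_hemiE) (simp add: gen_line_subspace)

lemma flag_exists_infinity:
  assumes x: "x * x ^ p = - 1 / 2"
  shows "flag (1, 0, 0) (0, x, 0)"
    and "flag (1, 0, 0) w' \<Longrightarrow> \<exists>l c. w' = scaleq l (0, x, 0) + scaleq c (1, 0, 0)"
proof -
  have "- (2 * x * x ^ p) = 1" using x by (simp add: mult.assoc)
  then show "flag (1, 0, 0) (0, x, 0)" by (simp add: flag_def isotropic_infinity)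
  have "x \<noteq> 0" using x by auto
  assume "flag (1, 0, 0) w'"
  then have "herm w' (1, 0, 0) = 0" by (rule flagD)
  then have "w' = scaleq (fst (snd w') / x) (0, x, 0) + scaleq (fst w') (1, 0, 0)"
    using \<open>x \<noteq> 0\<close> by (cases w') simp
  then show "\<exists>l c. w' = scaleq l (0, x, 0) + scaleq c (1, 0, 0)" by blast
qed

lemma flag_exists_affine:
  assumes x: "x * x ^ p = - 1 / 2" and iso: "isotropic (u0, u1, 1)"
  shows "flag (u0, u1, 1) (2 * x * u1 ^ p, x, 0)"
    and "flag (u0, u1, 1) w' \<Longrightarrow> \<exists>l c. w' = scaleq l (2 * x * u1 ^ p, x, 0) + scaleq c (u0, u1, 1)"
proof -
  let ?u = "(u0, u1, 1)" and ?w = "(2 * x * u1 ^ p, x, 0)"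
  have "herm ?w ?u = 0" by simp
  then have "herm ?u ?w = 0" using herm_conj[of ?u ?w] by simp
  moreover have "- (2 * x * x ^ p) = 1" using x by (simp add: mult.assoc)
  ultimately show "flag ?u ?w" using iso by (simp add: flag_def)
  have "x \<noteq> 0" using x by auto
  assume "flag ?u w'"
  then have orthogonal: "herm w' ?u = 0" by (rule flagD)
  obtain w0 w1 w2 where w': "w' = (w0, w1, w2)" by (cases w')
  have "w0 - w2 * u0 - 2 * (w1 - w2 * u1) * u1 ^ p = herm w' ?u - w2 * herm ?u ?u"
    by (simp add: w' algebra_simps)
  also have "\<dots> = 0" using iso orthogonal unfolding isotropic_def by simp
  finally have w0: "w0 = 2 * (w1 - w2 * u1) * u1 ^ p + w2 * u0" by (simp add: diff_eq_eq)
  define l where "l = (w1 - w2 * u1) / x"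
  have l: "l * x = w1 - w2 * u1" using \<open>x \<noteq> 0\<close> by (simp add: l_def)
  have "w' = (2 * (l * x) * u1 ^ p + w2 * u0, l * x + w2 * u1, w2)" unfolding l by (simp add: w' w0)
  also have "\<dots> = scaleq l ?w + scaleq w2 ?u" by (simp add: mult_ac)
  finally have "w' = scaleq l ?w + scaleq w2 ?u" .
  then show "\<exists>l c. w' = scaleq l ?w + scaleq c ?u" by blast
qed

lemma positive_flag_exists:
  assumes "u \<in> curve_pts"
  obtains w where "flag u w" "positive u w" "\<And>w'. flag u w' \<Longrightarrow> \<exists>l c. w' = scaleq l w + scaleq c u"
proof -
  obtain x :: 'f where x: "x * x ^ p = - 1 / 2"
    by (rule norm_surj[of "- 1 / 2"]) simp_all
  obtain w where flag: "flag u w" and span: "\<And>w'. flag u w' \<Longrightarrow> \<exists>l c. w' = scaleq l w + scaleq c u"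
  proof (cases "u = (1, 0, 0)")
    case True
    then show thesis using that flag_exists_infinity[OF x] by blast
  next
    case False
    then obtain u0 u1 where "u = (u0, u1, 1)" using assms by (cases u) (auto simp: curve_pts_def)
    then show thesis
      using that flag_exists_affine[OF x, of u0 u1] assms by (auto simp: curve_pts_def)
  qed
  show thesis
  proof (cases "positive u w")
    case True
    then show thesis using that flag span by blast
  next
    case False
    show thesis
    proof (rule that)
      show "flag u (- w)" "positive u (- w)"
        using False flag flag_minus positive_minus[OF flag] by simp_all
      fix w' assume "flag u w'"
      then obtain l c where "w' = scaleq l w + scaleq c u" using span by blast
      then have "w' = scaleq (- l) (- w) + scaleq c u" by simp
      then show "\<exists>l c. w' = scaleq l (- w) + scaleq c u" by blast
    qed
  qed
qed

lemma flag_multiple_torsion: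
  assumes flag: "flag u w" "flag u (scaleq l w + scaleq c u)"
    and pos: "positive u w" "positive u (scaleq l w + scaleq c u)"
  shows "l ^ m = 1"
proof (rule ccontr)
  have norm: "l * l ^ p = 1"
    using flagD[OF flag(1)] flagD(6)[OF flag(2)] by (simp add: mult.commute)
  assume "l ^ m \<noteq> 1"
  then have torsion: "(- l) ^ m = 1" using norm_one_cases[OF norm] by simp
  have "flag u (scaleq l w)" by (rule flag_norm_one[OF norm flag(1)])
  then have "positive u (- scaleq l w) \<longleftrightarrow> \<not> positive u (scaleq l w)" by (rule positive_minus)
  then show False using pos positive_torsion[OF torsion, of u w] by (simp add: positive_add)
qed

lemma card_pencil:
  assumes u: "u \<in> curve_pts" shows "card (pencil u) = m"
proof -
  obtain w where w: "flag u w" "positive u w"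
    and span: "\<And>w'. flag u w' \<Longrightarrow> \<exists>l c. w' = scaleq l w + scaleq c u"
    by (rule positive_flag_exists[OF u]) blast
  have "pencil u = (\<lambda>l. gen_line u (scaleq l w)) ` {l. l ^ m = 1}"
  proof (intro equalityI subsetI)
    fix L assume "L \<in> pencil u"
    then obtain w' where w': "flag u w'" "positive u w'" "L = gen_line u w'"
      unfolding pencil_def by blast
    then obtain l c where l: "w' = scaleq l w + scaleq c u" using span by blast
    then have "l ^ m = 1" using flag_multiple_torsion[OF w(1) _ w(2)] w' by simp
    then show "L \<in> (\<lambda>l. gen_line u (scaleq l w)) ` {l. l ^ m = 1}"
      using w'(3) by (simp add: l gen_line_add)
  next
    fix L assume "L \<in> (\<lambda>l. gen_line u (scaleq l w)) ` {l. l ^ m = 1}"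
    then obtain l where l: "l ^ m = 1" "L = gen_line u (scaleq l w)" by blast
    then show "L \<in> pencil u"
      using flag_norm_one[OF m_torsion_norm w(1)] w(2) positive_torsion[OF l(1)]
      unfolding pencil_def by blast
  qed
  then show ?thesis
    using card_m_torsion by (simp add: card_image inj_on_subset[OF inj_gen_line_scaleq[OF w(1)]])
qed

lemma card_std_hemi: "card std_hemi = (p ^ 3 + 1) * m"
proof -
  have "card std_hemi = (\<Sum>u\<in>curve_pts. card (pencil u))"
    unfolding std_hemi_def
  proof (rule card_UN_disjoint)
    show "\<forall>u\<in>curve_pts. \<forall>u'\<in>curve_pts. u \<noteq> u' \<longrightarrow> pencil u \<inter> pencil u' = {}"
      using gen_line_unique unfolding pencil_def by blast
  qed simp_all
  then show ?thesis by (simp add: card_pencil card_curve_pts)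
qed

lemma herm_points_std_cases:
  assumes "P \<in> herm_points p std_gram"
  obtains (curve) u where "u \<in> curve_pts" "P = vec.span {vec4 0 u}"
    | (affine) v where "herm v v = 1" "P = vec.span {vec4 1 v}"
proof -
  obtain z where z: "z \<noteq> 0" "P = vec.span {z}"
    using assms by (auto simp: herm_points_def elim: pg_points_span)
  obtain x u where xu: "z = vec4 x u" by (rule vec4_exhaust)
  have "hform p std_gram z z = 0" using assms vec.span_base[of z "{z}"]
    by (auto simp: herm_points_def polar_def z(2))
  then have norm: "herm u u = x * x ^ p" by (simp add: xu hform_vec4)
  show thesis
  proof (cases "x = 0")
    case True
    then have iso: "isotropic u" using norm z(1) by (simp add: isotropic_def xu)
    obtain c where c: "c \<noteq> 0" "normalize_pt u = scaleq c u" by (rule normalize_pt_multiple[OF iso])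
    have "P = vec.span {vec4 0 (normalize_pt u)}"
      using span_singleton_scale[OF c(1), of "vec4 0 u"] by (simp add: z(2) xu True c(2))
    then show thesis by (rule that(1)[OF normalize_pt_curve[OF iso]])
  next
    case False
    show thesis
    proof (rule that(2))
      show "herm (scaleq (inverse x) u) (scaleq (inverse x) u) = 1"
        using False by (simp add: norm power_inverse field_simps)
      show "P = vec.span {vec4 1 (scaleq (inverse x) u)}"
        using span_singleton_scale[of "inverse x" "vec4 x u"] False by (simp add: z(2) xu)
    qed
  qed
qed

lemma std_hemi_through_curve_pt:
  assumes u: "u \<in> curve_pts"
  shows "{L \<in> std_hemi. vec4 0 u \<in> L} = pencil u"
proof (intro equalityI subsetI)
  fix L assume L: "L \<in> {L \<in> std_hemi. vec4 0 u \<in> L}"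
  then obtain u' w where w: "L = gen_line u' w" "u' \<in> curve_pts" "flag u' w" "positive u' w"
    by (auto elim: std_hemiE)
  then obtain k where "u = scaleq k u'" using L by (auto simp: vec4_in_gen_line)
  then have "u = u'" using curve_pts_multiple_eq[OF w(2) u] by blast
  then show "L \<in> pencil u" using w unfolding pencil_def by blast
next
  fix L assume "L \<in> pencil u"
  then show "L \<in> {L \<in> std_hemi. vec4 0 u \<in> L}"
    using u vec4_0_in_gen_line unfolding std_hemi_def pencil_def by blast
qed

lemma std_hemi_through_affine_pt:
  assumes norm: "herm v v = 1"
  shows "{L \<in> std_hemi. vec4 1 v \<in> L} = (\<lambda>u. gen_line u v) ` {u \<in> polar_pts v. positive u v}"
proof (intro equalityI subsetI)
  fix L assume L: "L \<in> {L \<in> std_hemi. vec4 1 v \<in> L}"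
  then obtain u w where w: "L = gen_line u w" "u \<in> curve_pts" "flag u w" "positive u w"
    by (auto elim: std_hemiE)
  then obtain c where v: "v = w + scaleq c u" using L by (auto simp: vec4_in_gen_line add.commute)
  have "L = gen_line u v" using w(1) by (simp add: v gen_line_add)
  moreover have "u \<in> polar_pts v"
    using flag_add[OF w(3)] w(2) by (simp add: v polar_pts_def flag_def)
  moreover have "positive u v" using w(4) by (simp add: v positive_add)
  ultimately show "L \<in> (\<lambda>u. gen_line u v) ` {u \<in> polar_pts v. positive u v}" by blast
next
  fix L assume "L \<in> (\<lambda>u. gen_line u v) ` {u \<in> polar_pts v. positive u v}"
  then show "L \<in> {L \<in> std_hemi. vec4 1 v \<in> L}"
    using std_hemiI polar_pts_flag[OF norm] vec4_1_in_gen_line by blast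
qed

end

context hermitian_quads_choice
begin

lemma card_std_hemi_point:
  assumes P: "P \<in> herm_points p std_gram"
  shows "card {L \<in> std_hemi. P \<subseteq> L} = m"
proof -
  have through: "{L \<in> std_hemi. vec.span {z} \<subseteq> L} = {L \<in> std_hemi. z \<in> L}" for z
    using span_singleton_subset_iff std_hemi_subspace by blast
  from P show ?thesis
  proof (cases rule: herm_points_std_cases)
    case (curve u)
    then show ?thesis by (simp add: through std_hemi_through_curve_pt card_pencil)
  next
    case (affine v)
    have "inj_on (\<lambda>u. gen_line u v) {u \<in> polar_pts v. positive u v}"
      using gen_line_unique unfolding inj_on_def polar_pts_def by blast
    then show ?thesis
      using affine by (simp add: through std_hemi_through_affine_pt card_image card_positive_polar_pts)
  qed
qed

theorem hemisystem_std: "hemisystem p std_gram std_hemi"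
proof -
  have "(p ^ 3 + 1) * (p + 1) div 2 = (p ^ 3 + 1) * m"
    unfolding two_m[symmetric] by simp
  moreover have "std_hemi \<subseteq> generators p std_gram"
    using gen_line_generator by (blast elim: std_hemiE)
  ultimately show ?thesis
    using odd_p card_std_hemi card_std_hemi_point unfolding hemisystem_def m_def[symmetric] by simp
qed

end

section \<open>The group\<close>

lemma image_iso_Mod_DirProd:
  assumes groups: "group G" "group K" "group L" and hom: "h \<in> hom (G \<times>\<times> K) L"
    and normal: "N \<lhd> G" and kernel: "kernel (G \<times>\<times> K) L h = N \<times> {\<one>\<^bsub>K\<^esub>}"
  shows "L\<lparr>carrier := h ` carrier (G \<times>\<times> K)\<rparr> \<cong> (G Mod N) \<times>\<times> K"
proof -
  let ?GK = "G \<times>\<times> K" and ?I = "L\<lparr>carrier := h ` carrier (G \<times>\<times> K)\<rparr>"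
  interpret G: group G by (rule groups(1))
  interpret K: group K by (rule groups(2))
  interpret h: group_hom ?GK L h
    by (intro group_hom.intro group_hom_axioms.intro DirProd_group groups hom)
  interpret image: group ?I by (rule h.H.subgroup_imp_group[OF h.img_is_subgroup])
  interpret h': group_hom ?GK ?I h
    by unfold_locales (use hom in \<open>auto simp: hom_def\<close>)
  have "?GK Mod (N \<times> {\<one>\<^bsub>K\<^esub>}) \<cong> ?I"
    using h'.FactGroup_iso kernel by (simp add: kernel_def)
  moreover have "(G Mod N) \<times>\<times> (K Mod {\<one>\<^bsub>K\<^esub>}) \<cong> ?GK Mod (N \<times> {\<one>\<^bsub>K\<^esub>})"
    by (rule G.FactGroup_DirProd_multiplication_iso_1[OF groups(2) normal K.one_is_normal])
  moreover have "group ((G Mod N) \<times>\<times> K)"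
    by (rule DirProd_group[OF normal.factorgroup_is_group[OF normal] groups(2)])
  moreover have "(G Mod N) \<times>\<times> K \<cong> (G Mod N) \<times>\<times> (K Mod {\<one>\<^bsub>K\<^esub>})"
  proof (rule group.DirProd_iso_trans[OF normal.factorgroup_is_group[OF normal] iso_refl])
    have "K Mod {\<one>\<^bsub>K\<^esub>} \<cong> K" using K.trivial_factor_iso by (rule is_isoI)
    then show "K \<cong> K Mod {\<one>\<^bsub>K\<^esub>}"
      by (rule group.iso_sym[OF normal.factorgroup_is_group[OF K.one_is_normal]])
  qed
  ultimately show ?thesis by (meson group.iso_sym iso_trans)
qed

lemma scalars_Int_SL_normal: "scalars \<inter> carrier SL \<lhd> (SL :: ('a::field^'n^'n) monoid)"
proof -
  have SL: "SL = (GL :: ('a^'n^'n) monoid)\<lparr>carrier := {A. det A = 1}\<rparr>"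
    by (simp add: SL_def GL_def)
  show ?thesis
    unfolding SL using group.normal_Int_subgroup[OF group_GL SL_subgroup_GL scalars_normal_GL]
    by simp
qed

lemma group_PGU: "group (PGU q H)"
proof -
  have "PGU q H = PGL\<lparr>carrier := carrier (PGU q H)\<rparr>" by (simp add: PGU_def)
  then show ?thesis using group.subgroup_imp_group[OF group_PGL PGU_subgroup_PGL] by metis
qed

lemma preserves_scalar_coset:
  fixes g :: "'a::field^'n^'n"
  assumes "invertible g" "finite N" and subspaces: "\<And>S. S \<in> N \<Longrightarrow> vec.subspace S"
    and maps: "\<And>S. S \<in> N \<Longrightarrow> collin g S \<in> N"
  shows "preserves (scalars #>\<^bsub>GL\<^esub> g) N"
  unfolding preserves_def
proof
  have image: "collin g ` N = N"
    by (rule endo_inj_surj[OF \<open>finite N\<close>])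
      (use maps inj_on_subset[OF inj_collin[OF \<open>invertible g\<close>]] in auto)
  fix h assume "h \<in> scalars #>\<^bsub>GL\<^esub> g"
  then obtain c where c: "c \<noteq> 0" "h = mat c ** g" by (auto simp: r_coset_def scalars_def)
  have "collin h ` N = collin g ` N"
    unfolding c(2) by (rule image_cong[OF refl]) (rule collin_scalar_mult[OF subspaces c(1)])
  then show "collin h ` N = N" using image by simp
qed

lemma scalar_coset_PGU:
  fixes g :: "'a::{field,finite}^'n^'n"
  assumes "isometry q H H g"
  shows "scalars #>\<^bsub>GL\<^esub> g \<in> carrier (PGU q H)"
proof -
  have "invertible g" using assms by (simp add: isometry_def)
  then have "preserves (scalars #>\<^bsub>GL\<^esub> g) (herm_points q H)"
    by (rule preserves_scalar_coset)
      (simp_all add: herm_points_isometry[OF assms], simp add: herm_points_def pg_points_def)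
  then show ?thesis
    using \<open>invertible g\<close> by (auto simp: PGU_def PGL_def FactGroup_def RCOSETS_def)
qed

lemma scalars_r_coset_eq_one_iff:
  fixes g :: "'a::field^'n^'n"
  assumes "invertible g"
  shows "scalars #>\<^bsub>GL\<^esub> g = \<one>\<^bsub>PGL\<^esub> \<longleftrightarrow> g \<in> scalars"
proof -
  have g: "g \<in> carrier GL" using assms by simp
  have "\<one>\<^bsub>PGL\<^esub> = (scalars :: ('a^'n^'n) set)" by (simp add: PGL_def FactGroup_def)
  then show ?thesis
    using group.coset_join1[OF group_GL _ g scalars_subgroup_GL]
      group.coset_join2[OF group_GL g scalars_subgroup_GL] by metis
qed

lemma act_eq_id_imp_scalar:
  fixes A :: "'a::field^2^2"
  assumes "\<And>u. act A u = u"
  obtains a where "a \<noteq> 0" "A = mat a"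
proof -
  have "(A $ 1 $ 1) ^ 2 = 1" "A $ 1 $ 1 * A $ 2 $ 1 = 0"
    using assms[of "(1, 0, 0)"] by simp_all
  moreover have "(A $ 1 $ 2) ^ 2 = 0" using assms[of "(0, 0, 1)"] by simp
  ultimately have a: "A $ 1 $ 1 * A $ 1 $ 1 = 1" "A $ 1 $ 1 \<noteq> 0" "A $ 2 $ 1 = 0" "A $ 1 $ 2 = 0"
    by (auto simp: power2_eq_square)
  have "A $ 1 $ 1 * A $ 2 $ 2 = 1" using assms[of "(0, 1, 0)"] a by simp
  then have "A $ 2 $ 2 = A $ 1 $ 1" using a(1,2) by (metis mult_left_cancel)
  then have "A = mat (A $ 1 $ 1)" using a by (simp add: vec_eq_iff forall_2 mat_def)
  then show thesis using that a(2) by blast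
qed

lemma rot_scalar_imp_one:
  assumes det: "det A \<noteq> 0" and rot: "\<And>u. rot A u = scaleq c u"
  shows "c = 1"
proof -
  have "bil (rot A (1, 0, 0)) (rot A (0, 0, 1)) = 1" unfolding bil_rot[OF det] by simp
  then have "c * c = 1" by (simp add: rot)
  moreover have "cross (rot A (1, 0, 0)) (rot A (0, 0, 1)) = scaleq c (0, 1, 0)"
    unfolding cross_rot[OF det] by (simp add: rot)
  then have "c * c = c" by (simp add: rot)
  ultimately show ?thesis by simp
qed

locale surface_group = hermitian_quads_choice p \<delta> \<kappa> \<kappa>' + field_embedding \<iota>
  for p :: nat and \<delta> :: "'f::{field,finite}" and \<kappa> \<kappa>' :: 'f
    and \<iota> :: "'k::{field,finite} \<Rightarrow> 'f" +
  fixes \<zeta> :: 'f and H Q Q' :: "'f^4^4"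
  assumes card_k: "CARD('k) = p"
    and \<zeta>_torsion: "\<zeta> ^ m = 1" and \<zeta>_primitive: "j < m \<Longrightarrow> \<zeta> ^ j = 1 \<Longrightarrow> j = 0"
    and isometry_Q: "isometry p std_gram H Q" and Q_inverse: "Q ** Q' = mat 1" "Q' ** Q = mat 1"
begin

abbreviation rot_\<iota> :: "'k^2^2 \<Rightarrow> 'f quad \<Rightarrow> 'f quad" where
  "rot_\<iota> A \<equiv> rot (map_matrix \<iota> A)"

lemma det_map_matrix_\<iota>: "det (map_matrix \<iota> A :: 'f^2^2) = \<iota> (det A)"
  by (simp add: det_2 \<iota>_diff \<iota>_mult)

lemma map_matrix_\<iota>_mult:
  "map_matrix \<iota> (A ** B) = (map_matrix \<iota> A :: 'f^2^2) ** map_matrix \<iota> (B :: 'k^2^2)"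
  by (simp add: vec_eq_iff matrix_matrix_mult_def sum_2 \<iota>_add \<iota>_mult)

lemma map_matrix_\<iota>_mat: "map_matrix \<iota> (mat c) = (mat (\<iota> c) :: 'f^2^2)"
  by (simp add: vec_eq_iff mat_def \<iota>_0)

lemma rational_map_matrix_\<iota>: "rational_matrix (map_matrix \<iota> A)"
  using range_embedding_eq_rational[OF field_embedding_axioms card_k] by auto

definition diag_rot :: "'f \<Rightarrow> 'k^2^2 \<Rightarrow> 'f^4^4" where
  "diag_rot l A = matrix (\<lambda>z. vec4 (l * z $ 1) (rot_\<iota> A (z $ 2, z $ 3, z $ 4)))"

lemma diag_rot_vec4: "diag_rot l A *v vec4 x u = vec4 (l * x) (rot_\<iota> A u)"
proof -
  define f where "f z = vec4 (l * z $ 1) (rot_\<iota> A (z $ 2, z $ 3, z $ 4))" for z :: "'f^4"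
  have f_vec4: "f (vec4 x u) = vec4 (l * x) (rot_\<iota> A u)" for x u by (cases u) (simp add: f_def)
  have "Vector_Spaces.linear (*s) (*s) f"
  proof (unfold_locales)
    fix c and z z' :: "'f^4"
    obtain x u where z: "z = vec4 x u" by (rule vec4_exhaust)
    obtain x' u' where z': "z' = vec4 x' u'" by (rule vec4_exhaust)
    show "f (z + z') = f z + f z'" "f (c *s z) = c *s f z"
      by (simp_all add: z z' f_vec4 distrib_left mult.left_commute)
  qed
  then show ?thesis using f_vec4 unfolding diag_rot_def f_def by (simp only: matrix_works)
qed

lemma matrix_eq_vec4I: "(\<And>x u. g *v vec4 x u = h *v vec4 x u) \<Longrightarrow> g = h"
  unfolding matrix_eq by (metis vec4_exhaust)

lemma diag_rot_mult: "diag_rot l A ** diag_rot l' A' = diag_rot (l * l') (A ** A')"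
  by (rule matrix_eq_vec4I)
    (simp only: matrix_vector_mul_assoc[symmetric] diag_rot_vec4 rot_rot map_matrix_\<iota>_mult mult.assoc)

lemma diag_rot_one: "e \<noteq> 0 \<Longrightarrow> diag_rot 1 (mat e) = mat 1"
  by (rule matrix_eq_vec4I) (simp add: diag_rot_vec4 map_matrix_\<iota>_mat rot_mat \<iota>_eq_0_iff)

lemma diag_rot_invertible:
  assumes "l \<noteq> 0" "det A = 1"
  shows "invertible (diag_rot l A)"
proof -
  have "invertible A" using assms(2) by (simp add: invertible_det_nz)
  then obtain A' where "A ** A' = mat 1" by (auto simp: invertible_def)
  then have "diag_rot l A ** diag_rot (inverse l) A' = mat 1"
    using assms(1) by (simp add: diag_rot_mult diag_rot_one)
  then show ?thesis by (auto simp: invertible_right_inverse)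
qed

lemma diag_rot_eq_mat_imp:
  assumes eq: "diag_rot l A = mat c" and det: "det A = 1"
  shows "l = 1" "A \<in> scalars"
proof -
  have det_\<iota>: "det (map_matrix \<iota> A :: 'f^2^2) = 1" by (simp add: det_map_matrix_\<iota> det \<iota>_1)
  have "vec4 (l * x) (rot_\<iota> A u) = vec4 (c * x) (scaleq c u)" for x u
    using arg_cong[OF eq, of "\<lambda>g. g *v vec4 x u"]
    by (simp only: diag_rot_vec4 mat_vector_mult vec4_linear)
  then have "l * 1 = c * 1" and rot: "rot_\<iota> A u = scaleq c u" for u unfolding vec4_eq_iff by blast+
  then have "l = c" by simp
  have "c = 1" by (rule rot_scalar_imp_one[OF _ rot]) (simp add: det_\<iota>)
  then show "l = 1" using \<open>l = c\<close> by simp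
  have "act (map_matrix \<iota> A) u = u" for u using rot[of u] by (simp add: rot_def det_\<iota> \<open>c = 1\<close>)
  then obtain a where "a \<noteq> 0" and a: "map_matrix \<iota> A = (mat a :: 'f^2^2)"
    by (rule act_eq_id_imp_scalar)
  have "\<iota> (A $ i $ j) = (if i = j then a else 0)" for i j
    using arg_cong[OF a, of "\<lambda>B. B $ i $ j"] by (simp add: mat_def)
  then have "A $ 1 $ 2 = 0" "A $ 2 $ 1 = 0" "A $ 1 $ 1 = A $ 2 $ 2" "A $ 1 $ 1 \<noteq> 0"
    using \<open>a \<noteq> 0\<close> by (simp_all add: \<iota>_0 flip: \<iota>_eq_iff)
  then have "A = mat (A $ 1 $ 1)" by (simp add: vec_eq_iff forall_2 mat_def)
  then show "A \<in> scalars" using \<open>A $ 1 $ 1 \<noteq> 0\<close> unfolding scalars_def by blast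
qed

lemma isometry_diag_rot:
  assumes "l ^ m = 1" "det A = 1"
  shows "isometry p std_gram std_gram (diag_rot l A)"
proof -
  have "hform p std_gram (diag_rot l A *v z) (diag_rot l A *v z') = hform p std_gram z z'" for z z'
  proof -
    obtain x u where z: "z = vec4 x u" by (rule vec4_exhaust)
    obtain y w where z': "z' = vec4 y w" by (rule vec4_exhaust)
    have "herm (rot_\<iota> A u) (rot_\<iota> A w) = herm u w"
      by (rule herm_rot[OF rational_map_matrix_\<iota>]) (simp add: det_map_matrix_\<iota> assms(2) \<iota>_1)
    moreover have "(l * x) * (l * y) ^ p = (l * l ^ p) * (x * y ^ p)" by (simp add: mult_ac)
    ultimately show ?thesis
      unfolding z z' diag_rot_vec4 hform_vec4 using m_torsion_norm[OF assms(1)] by simp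
  qed
  then show ?thesis
    using diag_rot_invertible[OF m_torsion_nz[OF assms(1)] assms(2)] by (simp add: isometry_def)
qed

lemma collin_diag_rot_gen_line:
  assumes "l \<noteq> 0"
  shows "collin (diag_rot l A) (gen_line u w)
      = gen_line (rot_\<iota> A u) (scaleq (inverse l) (rot_\<iota> A w))"
  using span_pair_scale[of 1 l "vec4 0 (rot_\<iota> A u)" "vec4 1 (scaleq (inverse l) (rot_\<iota> A w))"] assms
  by (simp add: gen_line_def collin_span diag_rot_vec4)

lemma collin_diag_rot_std_hemi:
  assumes l: "l ^ m = 1" and "det A = 1" and L: "L \<in> std_hemi"
  shows "collin (diag_rot l A) L \<in> std_hemi"
proof -
  obtain u w where uw: "L = gen_line u w" "flag u w" "positive u w" using L by (rule std_hemiE)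
  have torsion: "inverse l ^ m = 1" using l by (simp add: power_inverse)
  have det: "det (map_matrix \<iota> A :: 'f^2^2) = 1" by (simp add: det_map_matrix_\<iota> assms(2) \<iota>_1)
  have "flag (rot_\<iota> A u) (rot_\<iota> A w)"
    using uw(2) by (simp add: flag_rot[OF rational_map_matrix_\<iota>] det)
  then have "flag (rot_\<iota> A u) (scaleq (inverse l) (rot_\<iota> A w))"
    by (rule flag_norm_one[OF m_torsion_norm[OF torsion]])
  moreover have "positive (rot_\<iota> A u) (scaleq (inverse l) (rot_\<iota> A w))"
    unfolding positive_torsion[OF torsion]
    by (rule positive_rot[OF rational_map_matrix_\<iota> det uw(2,3)])
  ultimately show ?thesis
    unfolding uw(1) collin_diag_rot_gen_line[OF m_torsion_nz[OF l]] by (rule std_hemiI)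
qed

definition hemi :: "('f^4) set set" where
  "hemi = collin Q ` std_hemi"

lemma hemisystem_hemi: "hemisystem p H hemi"
  unfolding hemi_def by (rule hemisystem_isometry[OF isometry_Q hemisystem_std])

lemma hemi_subspace: "L \<in> hemi \<Longrightarrow> vec.subspace L"
  unfolding hemi_def using std_hemi_subspace collin_subspace by blast

abbreviation SL_times_cyclic :: "(('k^2^2) \<times> int) monoid" where
  "SL_times_cyclic \<equiv> SL \<times>\<times> integer_mod_group m"

definition surface_matrix :: "('k^2^2) \<times> int \<Rightarrow> 'f^4^4" where
  "surface_matrix = (\<lambda>(A, j). Q ** diag_rot (\<zeta> ^ nat j) A ** Q')"

definition surface_coset :: "('k^2^2) \<times> int \<Rightarrow> ('f^4^4) set" where
  "surface_coset x = scalars #>\<^bsub>GL\<^esub> surface_matrix x"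

lemma \<zeta>_power_torsion: "(\<zeta> ^ j) ^ m = 1"
  by (metis \<zeta>_torsion mult.commute power_mult power_one)

lemma \<zeta>_power_mod: "\<zeta> ^ (n mod m) = \<zeta> ^ n"
proof -
  have "\<zeta> ^ n = \<zeta> ^ (m * (n div m) + n mod m)" by simp
  also have "\<dots> = \<zeta> ^ (n mod m)" unfolding power_add power_mult \<zeta>_torsion by simp
  finally show ?thesis by simp
qed

lemma isometry_surface_matrix:
  assumes "x \<in> carrier SL_times_cyclic"
  shows "isometry p H H (surface_matrix x)"
proof -
  obtain A j where x: "x = (A, j)" "det A = 1" using assms by (cases x) (simp add: DirProd_def)
  have "isometry p std_gram H (Q ** diag_rot (\<zeta> ^ nat j) A)"
    by (rule isometry_trans[OF isometry_diag_rot[OF \<zeta>_power_torsion x(2)] isometry_Q])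
  then show ?thesis
    using isometry_trans[OF isometry_inverse[OF isometry_Q Q_inverse(1)]]
    by (simp add: surface_matrix_def x(1))
qed

lemma surface_matrix_invertible: "x \<in> carrier SL_times_cyclic \<Longrightarrow> invertible (surface_matrix x)"
  using isometry_surface_matrix by (simp add: isometry_def)

lemma collin_surface_matrix_hemi:
  assumes "x \<in> carrier SL_times_cyclic" and L: "L \<in> hemi"
  shows "collin (surface_matrix x) L \<in> hemi"
proof -
  obtain A j where x: "x = (A, j)" "det A = 1" using assms(1) by (cases x) (simp add: DirProd_def)
  obtain L0 where L0: "L = collin Q L0" "L0 \<in> std_hemi" using L unfolding hemi_def by blast
  have "collin (surface_matrix x) L = collin Q (collin (diag_rot (\<zeta> ^ nat j) A) L0)"
    by (simp add: surface_matrix_def x(1) L0(1) collin_mult collin_cancel[OF Q_inverse(2)])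
  then show ?thesis
    using collin_diag_rot_std_hemi[OF \<zeta>_power_torsion x(2) L0(2)] by (simp add: hemi_def)
qed

lemma surface_matrix_hom: "surface_matrix \<in> hom SL_times_cyclic GL"
proof (rule homI)
  fix x y assume xy: "x \<in> carrier SL_times_cyclic" "y \<in> carrier SL_times_cyclic"
  obtain A j where x: "x = (A, j)" "0 \<le> j"
    using xy(1) m_pos by (cases x) (simp add: DirProd_def carrier_integer_mod_group)
  obtain B k where y: "y = (B, k)" "0 \<le> k"
    using xy(2) m_pos by (cases y) (simp add: DirProd_def carrier_integer_mod_group)
  have "nat ((j + k) mod int m) = (nat j + nat k) mod m"
    using x(2) y(2) by (simp add: nat_mod_distrib nat_add_distrib)
  then have power: "\<zeta> ^ nat ((j + k) mod int m) = \<zeta> ^ nat j * \<zeta> ^ nat k"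
    by (simp only: \<zeta>_power_mod power_add)
  have "surface_matrix x ** surface_matrix y
      = Q ** diag_rot (\<zeta> ^ nat j) A ** (Q' ** Q) ** diag_rot (\<zeta> ^ nat k) B ** Q'"
    by (simp only: surface_matrix_def x(1) y(1) prod.case matrix_mul_assoc)
  also have "\<dots> = Q ** (diag_rot (\<zeta> ^ nat j) A ** diag_rot (\<zeta> ^ nat k) B) ** Q'"
    by (simp add: Q_inverse matrix_mul_assoc)
  also have "\<dots> = surface_matrix (A ** B, (j + k) mod int m)"
    by (simp add: diag_rot_mult surface_matrix_def power)
  finally show "surface_matrix (x \<otimes>\<^bsub>SL_times_cyclic\<^esub> y) = surface_matrix x \<otimes>\<^bsub>GL\<^esub> surface_matrix y"
    by (simp add: x(1) y(1))
qed (simp add: surface_matrix_invertible)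

lemma surface_coset_hom: "surface_coset \<in> hom SL_times_cyclic (PGU p H)"
proof -
  have "(\<lambda>g. scalars #>\<^bsub>GL\<^esub> g) \<circ> surface_matrix \<in> hom SL_times_cyclic (GL Mod scalars)"
    by (rule hom_compose[OF surface_matrix_hom normal.r_coset_hom_Mod[OF scalars_normal_GL]])
  then show ?thesis
    using scalar_coset_PGU[OF isometry_surface_matrix]
    by (auto simp: hom_def surface_coset_def PGU_def PGL_def)
qed

lemma surface_coset_preserves_hemi:
  assumes "x \<in> carrier SL_times_cyclic"
  shows "preserves (surface_coset x) hemi"
  unfolding surface_coset_def
  by (rule preserves_scalar_coset[OF surface_matrix_invertible[OF assms] finite])
    (simp_all add: hemi_subspace collin_surface_matrix_hemi[OF assms])

lemma surface_matrix_scalar_iff: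
  assumes "det A = 1" "0 \<le> j" "j < int m"
  shows "surface_matrix (A, j) \<in> scalars \<longleftrightarrow> A \<in> scalars \<and> j = 0"
proof
  assume "surface_matrix (A, j) \<in> scalars"
  then obtain c where c: "surface_matrix (A, j) = mat c" by (auto simp: scalars_def)
  have "diag_rot (\<zeta> ^ nat j) A = (Q' ** Q) ** diag_rot (\<zeta> ^ nat j) A ** (Q' ** Q)"
    by (simp add: Q_inverse)
  also have "\<dots> = Q' ** surface_matrix (A, j) ** Q"
    by (simp only: surface_matrix_def prod.case matrix_mul_assoc)
  also have "\<dots> = mat c ** (Q' ** Q)" by (simp only: c mat_commute[symmetric] matrix_mul_assoc)
  finally have "diag_rot (\<zeta> ^ nat j) A = mat c" by (simp add: Q_inverse)
  from diag_rot_eq_mat_imp[OF this assms(1)] \<zeta>_primitive[of "nat j"] assms(2,3)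
  show "A \<in> scalars \<and> j = 0" by simp
next
  assume "A \<in> scalars \<and> j = 0"
  then obtain e where "A = mat e" "e \<noteq> 0" "j = 0" by (auto simp: scalars_def)
  then have "surface_matrix (A, j) = mat 1" by (simp add: surface_matrix_def diag_rot_one Q_inverse)
  then show "surface_matrix (A, j) \<in> scalars" unfolding scalars_def by force
qed

lemma kernel_surface_coset:
  "kernel SL_times_cyclic (PGU p H) surface_coset = (scalars \<inter> carrier SL) \<times> {0}"
proof -
  have "surface_coset x = \<one>\<^bsub>PGU p H\<^esub> \<longleftrightarrow> surface_matrix x \<in> scalars"
    if "x \<in> carrier SL_times_cyclic" for x
    using scalars_r_coset_eq_one_iff[OF surface_matrix_invertible[OF that]]
    by (simp add: surface_coset_def PGU_def)
  then have "kernel SL_times_cyclic (PGU p H) surface_coset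
      = {x \<in> carrier SL_times_cyclic. surface_matrix x \<in> scalars}"
    by (auto simp: kernel_def)
  also have "\<dots> = (scalars \<inter> carrier SL) \<times> {0}"
    using m_pos by (auto simp: DirProd_def carrier_integer_mod_group surface_matrix_scalar_iff)
  finally show ?thesis .
qed

theorem invariant_hemisystem_exists:
  "\<exists>M K. hemisystem p H M \<and> subgroup K (PGU p H) \<and> (\<forall>C\<in>K. preserves C M) \<and>
     (PGU p H)\<lparr>carrier := K\<rparr> \<cong> (PSL :: ('k^2^2) set monoid) \<times>\<times> integer_mod_group ((p + 1) div 2)"
proof (intro exI conjI)
  let ?K = "surface_coset ` carrier SL_times_cyclic"
  interpret group_hom SL_times_cyclic "PGU p H" surface_coset
    by (intro group_hom.intro group_hom_axioms.intro DirProd_group group_SL group_integer_mod_group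
        group_PGU surface_coset_hom)
  show "hemisystem p H hemi" by (rule hemisystem_hemi)
  show "subgroup ?K (PGU p H)" by (rule img_is_subgroup)
  show "\<forall>C\<in>?K. preserves C hemi" using surface_coset_preserves_hemi by blast
  show "(PGU p H)\<lparr>carrier := ?K\<rparr> \<cong>
      (PSL :: ('k^2^2) set monoid) \<times>\<times> integer_mod_group ((p + 1) div 2)"
    unfolding PSL_def m_def[symmetric]
    by (rule image_iso_Mod_DirProd[OF group_SL group_integer_mod_group group_PGU surface_coset_hom
          scalars_Int_SL_normal]) (simp add: kernel_surface_coset)
qed

end

section \<open>Main theorem\<close>

lemma quadratic_extension_exists:
  assumes prime: "prime p" and p_mod_4: "p mod 4 = 1"
    and card_f: "CARD('f::{field,finite}) = p ^ 2" and card_k: "CARD('k::{field,finite}) = p"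
  obtains \<iota> :: "'k::{field,finite} \<Rightarrow> 'f::{field,finite}" and \<delta> d
  where "field_embedding \<iota>" "quadratic_extension p \<delta>" "\<delta> ^ 2 = \<iota> d"
proof -
  obtain \<iota> :: "'k \<Rightarrow> 'f" where "field_embedding \<iota>"
    by (rule prime_field_embedding_exists[OF prime card_k CHAR_of_CARD_prime_power[OF prime card_f]])
  then interpret field_embedding \<iota> .
  interpret J: field_card_1_mod_4 p "TYPE('k)" by unfold_locales (rule card_k p_mod_4)+
  define h where "h = (p - 1) div 2"
  have p: "p = 1 + 2 * h" "even h" "h > 0" using p_mod_4 J.q_gt unfolding h_def by presburger+
  obtain d where d: "J.chi d = - 1" by (rule J.nonsquare_exists)
  then have "d ^ h = - 1" using J.of_int_chi[of d] by (simp add: h_def)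
  then have \<iota>_d: "\<iota> d ^ h = - 1" by (metis \<iota>_1 \<iota>_minus \<iota>_power)
  obtain \<delta> where \<delta>_squared: "\<delta> ^ 2 = \<iota> d"
  proof (rule finite_field_nth_root_exists)
    show "CARD('f) - 1 = 2 * (h * (p + 1))"
      using p(1) by (simp add: card_f power2_eq_square algebra_simps)
    have "(- 1 :: 'f) ^ (p + 1) = 1" using p(1) by simp
    then show "\<iota> d ^ (h * (p + 1)) = 1" by (simp only: power_mult \<iota>_d)
    show "h * (p + 1) > 0" using p(3) by simp
  qed auto
  have "\<delta> ^ (1 + 2 * h) = \<delta> * (\<delta> ^ 2) ^ h" by (simp only: power_add power_one_right power_mult)
  then have "\<delta> ^ p = - \<delta>" by (simp only: p(1)[symmetric] \<delta>_squared \<iota>_d mult_minus1_right)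
  moreover have "\<delta> \<noteq> 0"
    using \<delta>_squared \<iota>_d p(3)
    by (metis neg_equal_0_iff_equal one_neq_zero power_0_left zero_neq_numeral not_gr_zero)
  ultimately have "quadratic_extension p \<delta>" by unfold_locales (use prime p_mod_4 card_f in auto)
  then show thesis using that \<open>field_embedding \<iota>\<close> \<delta>_squared by blast
qed

lemma (in quadratic_extension) hermitian_quads_choice_exists:
  assumes "quartic_sum \<in> {1, - 1}"
  obtains \<kappa> \<kappa>' where "hermitian_quads_choice p \<delta> \<kappa> \<kappa>'"
proof -
  obtain \<kappa> :: 'f where \<kappa>: "\<kappa> ^ 2 = - 2" by (rule rational_square_exists[of "- 2"]) simp_all
  then have "\<kappa> \<noteq> 0" using two_nz by (metis neg_equal_0_iff_equal power_zero_numeral)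
  define \<kappa>' where "\<kappa>' = (if quartic_sum = - 1 then \<kappa> else - \<kappa>)"
  have "hermitian_quads_choice p \<delta> \<kappa> \<kappa>'"
    by unfold_locales (use assms \<kappa> \<open>\<kappa> \<noteq> 0\<close> in \<open>auto simp: \<kappa>'_def eq_commute[of "- \<kappa>"]\<close>)
  then show thesis by (rule that)
qed

theorem theorem1p1:
  fixes p :: nat and a :: int and H :: "'f::{field,finite}^4^4"
  assumes "prime p"
    and "int p = 1 + 16 * a ^ 2"
    and "CARD('f) = p ^ 2"
    and "CARD('k::{field,finite}) = p"
    and "nondeg_hermitian p H"
  shows "\<exists>M K. hemisystem p H M \<and>
           subgroup K (PGU p H) \<and>
           (\<forall>C\<in>K. preserves C M) \<and>
           (PGU p H)\<lparr>carrier := K\<rparr> \<cong>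
             (PSL :: ('k^2^2) set monoid) \<times>\<times> integer_mod_group ((p + 1) div 2)"
proof -
  have "p mod 4 = 1" using assms(2) by presburger
  then obtain \<iota> :: "'k \<Rightarrow> 'f" and \<delta> d
    where \<iota>: "field_embedding \<iota>" and "quadratic_extension p \<delta>" and \<delta>: "\<delta> ^ 2 = \<iota> d"
    by (rule quadratic_extension_exists[OF assms(1) _ assms(3,4)])
  then interpret quadratic_extension p \<delta> by simp
  obtain \<kappa> \<kappa>' where "hermitian_quads_choice p \<delta> \<kappa> \<kappa>'"
    by (rule hermitian_quads_choice_exists[OF quartic_sum_cases[OF \<iota> assms(4) \<delta> assms(2)]])
  then interpret hermitian_quads_choice p \<delta> \<kappa> \<kappa>' .
  obtain \<zeta> :: 'f where \<zeta>: "\<zeta> ^ m = 1" "\<And>j. j < m \<Longrightarrow> \<zeta> ^ j = 1 \<Longrightarrow> j = 0"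
    by (rule primitive_m_torsion_exists) blast
  obtain Q where Q: "isometry p std_gram H Q"
    by (rule isometry_exists[OF nondeg_hermitian_std_gram assms(5)])
  then obtain Q' where Q': "Q ** Q' = mat 1" "Q' ** Q = mat 1"
    by (auto simp: isometry_def invertible_def)
  interpret field_embedding \<iota> by (rule \<iota>)
  interpret surface_group p \<delta> \<kappa> \<kappa>' \<iota> \<zeta> H Q Q'
    by unfold_locales (fact assms(4) \<zeta> Q Q')+
  show ?thesis by (rule invariant_hemisystem_exists)
qed

end
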